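(* Let $Q$ be a quiver, let $\kappa\geq\max\{\mathrm{rccn}(Q),\mathrm{ltccn}(Q)\}$ be an infinite cardinal and let $\mathcal{C}$ be an $AB3(\kappa)$ abelian category. Then there is an exact sequence $$0\to\coprod_{\rho\in Q_1} f_{t(\rho)}e_{s(\rho)}\xrightarrow{\Gamma}\coprod_{i\in Q_0}f_ie_i\to 1_{\mathrm{Rep}(Q,\mathcal{C})}\to 0$$ in the category $\mathrm{End}(\mathrm{Rep}(Q,\mathcal{C}))$ of endofunctors of $\mathrm{Rep}(Q,\mathcal{C})$. Moreover, for each $F\in\mathrm{Rep}(Q,\mathcal{C})$, the exact sequence $$0\to\coprod_{\rho\in Q_1} f_{t(\rho)}e_{s(\rho)}(F)\xrightarrow{\Gamma_F}\coprod_{i\in Q_0}f_ie_i(F)\to F\to 0$$ in $\mathrm{Rep}(Q,\mathcal{C})$ splits vertex-wise in $\mathcal{C}$ (i.e. its evaluation at every vertex $k\in Q_0$ is a split exact sequence in $\mathcal{C}$).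
   Context: A quiver $Q$ consists of (possibly infinite) sets $Q_0$ of vertices and $Q_1$ of arrows with source and target maps $s,t:Q_1\to Q_0$. $Q(i,j)$ is the set of paths from $i$ to $j$ (including the trivial path $\epsilon_i$ if $i=j$), $Q(-,j)=\bigcup_{i}Q(i,j)$. $\mathrm{Rep}(Q,\mathcal{C})$ is the abelian category of $\mathcal{C}$-valued representations of $Q$ (functors from the path category of $Q$ to $\mathcal{C}$), with kernels, cokernels computed vertex-wise; for a representation $F$ write $F_i$, $F_\alpha$ for its values at vertices and arrows. $e_i:\mathrm{Rep}(Q,\mathcal{C})\to\mathcal{C}$, $F\mapsto F_i$, is the evaluation functor. For a set $X$ of cardinals, $\mathrm{size}(X):=\sup X$ if $x<\sup X$ for all $x\in X$, and $\mathrm{size}(X):=(\sup X)^+$ (cardinal successor) otherwise. Put $\mathrm{rccn}_i(Q):=\mathrm{size}(\{|Q(i,j)|\}_{j\in Q_0})$, $\mathrm{rccn}(Q):=\sup_{i\in Q_0}\mathrm{rccn}_i(Q)$, and $\mathrm{ltccn}(Q):=\mathrm{size}(\{|Q(-,i)|\}_{i\in Q_0})$. An abelian category is $AB3(\kappa)$ if it has coproducts of families indexed by sets of cardinality $<\kappa$. The functor $f_i:\mathcal{C}\to\mathrm{Rep}(Q,\mathcal{C})$ is given by $(f_i(C))_j:=C^{(Q(i,j))}$ (coproduct of copies of $C$ indexed by $Q(i,j)$, with canonical inclusions $\mu_\rho^C$), and for an arrow $\alpha:k\to l$, $(f_i(C))_\alpha$ is the unique morphism with $(f_i(C))_\alpha\circ\mu^C_\rho=\mu^C_{\alpha\rho}$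 for all $\rho\in Q(i,k)$; on morphisms it is defined componentwise. Colimits, kernels and cokernels in the category of endofunctors of $\mathrm{Rep}(Q,\mathcal{C})$ are computed point-wise. *)

theory Defs
  imports Main "HOL-Library.FuncSet" "HOL-Algebra.Group" "Graph_Theory.Arc_Walk"
begin

unbundle cardinal_syntax

section \<open>Cardinals\<close>

text \<open>
  Cardinals are cardinal orders (\<^const>\<open>Card_order\<close>), compared by \<open>\<le>o\<close> and \<open><o\<close>.
  A set of cardinals on a type \<open>'x\<close> has its supremum again on \<open>'x\<close>, because all of them are
  bounded by the cardinality of \<open>'x\<close>; for the same reason it suffices to compare the supremum
  with upper bounds on \<open>'x\<close>.
\<close>

definition is_card_sup :: "'x rel set \<Rightarrow> 'x rel \<Rightarrow> bool" where
  "is_card_sup X s \<longleftrightarrow> Card_order s \<and> (\<forall>r\<in>X. r \<le>o s) \<and>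
     (\<forall>t :: 'x rel. Card_order t \<longrightarrow> (\<forall>r\<in>X. r \<le>o t) \<longrightarrow> s \<le>o t)"

definition card_sup :: "'x rel set \<Rightarrow> 'x rel" where
  "card_sup X = (SOME s. is_card_sup X s)"

lemma card_sup_exists:
  fixes X :: "'x rel set"
  assumes C: "\<And>r. r \<in> X \<Longrightarrow> Card_order r"
  shows "is_card_sup X (card_sup X)"
proof -
  let ?U = "{t :: 'x rel. Card_order t \<and> (\<forall>r\<in>X. r \<le>o t)}"
  have "|UNIV :: 'x set| \<in> ?U"
  proof -
    have "r \<le>o |UNIV :: 'x set|" if "r \<in> X" for r
      using card_of_Field_ordIso[OF C[OF that]] card_of_mono1[of "Field r" UNIV]
      by (meson ordIso_symmetric ordIso_ordLeq_trans subset_UNIV)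
    then show ?thesis by (auto simp: card_of_Card_order)
  qed
  then obtain s where s: "s \<in> ?U" "\<And>t. (t, s) \<in> ordLess \<Longrightarrow> t \<notin> ?U"
    using wfE_min[OF wf_ordLess, of _ ?U] by blast
  have "s \<le>o t" if "Card_order t" "\<forall>r\<in>X. r \<le>o t" for t :: "'x rel"
  proof -
    have "Well_order s" "Well_order t" using s(1) that(1) by (auto dest: card_order_on_well_order_on)
    moreover have "\<not> t <o s" using s(2) that by blast
    ultimately show ?thesis using not_ordLess_iff_ordLeq by blast
  qed
  with s(1) have "is_card_sup X s"
    by (auto simp: is_card_sup_def)
  then show ?thesis
    unfolding card_sup_def by (rule someI)
qed

text \<open>
  The successor of a cardinal on \<open>'x\<close> lives on \<open>'x set\<close>; when no successor is needed, the
  supremum is transported to \<open>'x set\<close> along singletons.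
\<close>

definition card_size :: "'x rel set \<Rightarrow> 'x set rel" where
  "card_size X =
     (if \<forall>r\<in>X. r <o card_sup X then |(\<lambda>x. {x}) ` Field (card_sup X)| else cardSuc (card_sup X))"

section \<open>Categories\<close>

record ('o, 'm) cat =
  Ob :: "'o set"
  Ar :: "'m set"
  Dom :: "'m \<Rightarrow> 'o"
  Cod :: "'m \<Rightarrow> 'o"
  Idt :: "'o \<Rightarrow> 'm"
  Cmp :: "'m \<Rightarrow> 'm \<Rightarrow> 'm" (infixr "\<cdot>\<index>" 70)

definition Hom :: "('o, 'm) cat \<Rightarrow> 'o \<Rightarrow> 'o \<Rightarrow> 'm set" where
  "Hom C A B = {f \<in> Ar C. Dom C f = A \<and> Cod C f = B}"

locale category =
  fixes C :: "('o, 'm) cat" (structure)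
  assumes Dom_Ob: "f \<in> Ar C \<Longrightarrow> Dom C f \<in> Ob C"
    and Cod_Ob: "f \<in> Ar C \<Longrightarrow> Cod C f \<in> Ob C"
    and Idt_Hom: "A \<in> Ob C \<Longrightarrow> Idt C A \<in> Hom C A A"
    and Cmp_Hom: "\<lbrakk>f \<in> Hom C A B; g \<in> Hom C B D\<rbrakk> \<Longrightarrow> g \<cdot> f \<in> Hom C A D"
    and Cmp_Idt: "f \<in> Hom C A B \<Longrightarrow> f \<cdot> Idt C A = f"
    and Idt_Cmp: "f \<in> Hom C A B \<Longrightarrow> Idt C B \<cdot> f = f"
    and Cmp_assoc: "\<lbrakk>f \<in> Hom C A B; g \<in> Hom C B D; h \<in> Hom C D E\<rbrakk>
      \<Longrightarrow> h \<cdot> (g \<cdot> f) = (h \<cdot> g) \<cdot> f"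

definition is_mono :: "('o, 'm) cat \<Rightarrow> 'm \<Rightarrow> bool" where
  "is_mono C f \<longleftrightarrow> f \<in> Ar C \<and>
     (\<forall>X. \<forall>g \<in> Hom C X (Dom C f). \<forall>h \<in> Hom C X (Dom C f). f \<cdot>\<^bsub>C\<^esub> g = f \<cdot>\<^bsub>C\<^esub> h \<longrightarrow> g = h)"

definition is_epi :: "('o, 'm) cat \<Rightarrow> 'm \<Rightarrow> bool" where
  "is_epi C f \<longleftrightarrow> f \<in> Ar C \<and>
     (\<forall>X. \<forall>g \<in> Hom C (Cod C f) X. \<forall>h \<in> Hom C (Cod C f) X. g \<cdot>\<^bsub>C\<^esub> f = h \<cdot>\<^bsub>C\<^esub> f \<longrightarrow> g = h)"

definition is_zero_ob :: "('o, 'm) cat \<Rightarrow> 'o \<Rightarrow> bool" where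
  "is_zero_ob C Z \<longleftrightarrow> Z \<in> Ob C \<and> (\<forall>X \<in> Ob C. (\<exists>!f. f \<in> Hom C X Z) \<and> (\<exists>!f. f \<in> Hom C Z X))"

definition is_zero_ar :: "('o, 'm) cat \<Rightarrow> 'm \<Rightarrow> bool" where
  "is_zero_ar C f \<longleftrightarrow> f \<in> Ar C \<and>
     (\<exists>Z a b. is_zero_ob C Z \<and> a \<in> Hom C (Dom C f) Z \<and> b \<in> Hom C Z (Cod C f) \<and> f = b \<cdot>\<^bsub>C\<^esub> a)"

definition is_kernel :: "('o, 'm) cat \<Rightarrow> 'm \<Rightarrow> 'm \<Rightarrow> bool" where
  "is_kernel C k f \<longleftrightarrow> f \<in> Ar C \<and> k \<in> Ar C \<and> Cod C k = Dom C f \<and> is_zero_ar C (f \<cdot>\<^bsub>C\<^esub> k) \<and>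
     (\<forall>X. \<forall>g \<in> Hom C X (Dom C f). is_zero_ar C (f \<cdot>\<^bsub>C\<^esub> g) \<longrightarrow>
        (\<exists>!h. h \<in> Hom C X (Dom C k) \<and> k \<cdot>\<^bsub>C\<^esub> h = g))"

definition is_cokernel :: "('o, 'm) cat \<Rightarrow> 'm \<Rightarrow> 'm \<Rightarrow> bool" where
  "is_cokernel C c f \<longleftrightarrow> f \<in> Ar C \<and> c \<in> Ar C \<and> Dom C c = Cod C f \<and> is_zero_ar C (c \<cdot>\<^bsub>C\<^esub> f) \<and>
     (\<forall>X. \<forall>g \<in> Hom C (Cod C f) X. is_zero_ar C (g \<cdot>\<^bsub>C\<^esub> f) \<longrightarrow>
        (\<exists>!h. h \<in> Hom C (Cod C c) X \<and> h \<cdot>\<^bsub>C\<^esub> c = g))"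

definition is_coproduct ::
  "('o, 'm) cat \<Rightarrow> 'i set \<Rightarrow> ('i \<Rightarrow> 'o) \<Rightarrow> 'o \<Rightarrow> ('i \<Rightarrow> 'm) \<Rightarrow> bool" where
  "is_coproduct C I A P \<iota> \<longleftrightarrow> P \<in> Ob C \<and> (\<forall>i\<in>I. \<iota> i \<in> Hom C (A i) P) \<and>
     (\<forall>X \<in> Ob C. \<forall>g. (\<forall>i\<in>I. g i \<in> Hom C (A i) X) \<longrightarrow>
        (\<exists>!h. h \<in> Hom C P X \<and> (\<forall>i\<in>I. h \<cdot>\<^bsub>C\<^esub> \<iota> i = g i)))"

text \<open>
  An abelian group structure on every hom-set, with bilinear composition.
\<close>

definition preadditive :: "('o, 'm) cat \<Rightarrow> ('o \<Rightarrow> 'o \<Rightarrow> 'm monoid) \<Rightarrow> bool" where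
  "preadditive C G \<longleftrightarrow>
     (\<forall>A \<in> Ob C. \<forall>B \<in> Ob C. comm_group (G A B) \<and> carrier (G A B) = Hom C A B) \<and>
     (\<forall>A \<in> Ob C. \<forall>B \<in> Ob C. \<forall>D \<in> Ob C.
        (\<forall>f \<in> Hom C A B. (\<lambda>g. g \<cdot>\<^bsub>C\<^esub> f) \<in> hom (G B D) (G A D)) \<and>
        (\<forall>g \<in> Hom C B D. (\<lambda>f. g \<cdot>\<^bsub>C\<^esub> f) \<in> hom (G A B) (G A D)))"

definition abelian_category :: "('o, 'm) cat \<Rightarrow> bool" where
  "abelian_category C \<longleftrightarrow> category C \<and>
     (\<exists>G. preadditive C G) \<and>
     (\<exists>Z. is_zero_ob C Z) \<and>
     (\<forall>A \<in> Ob C. \<forall>B \<in> Ob C. \<exists>P \<iota>. is_coproduct C UNIV (\<lambda>b :: bool. if b then A else B) P \<iota>) \<and>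
     (\<forall>f \<in> Ar C. \<exists>k. is_kernel C k f) \<and>
     (\<forall>f \<in> Ar C. \<exists>c. is_cokernel C c f) \<and>
     (\<forall>f. is_mono C f \<longrightarrow> (\<exists>g. is_kernel C f g)) \<and>
     (\<forall>f. is_epi C f \<longrightarrow> (\<exists>g. is_cokernel C f g))"

text \<open>
  Every set of cardinality \<open>< \<kappa>\<close> is in bijection with a subset of \<open>Field \<kappa>\<close>, so it suffices to
  take index sets from there.
\<close>

definition AB3 :: "'k rel \<Rightarrow> ('o, 'm) cat \<Rightarrow> bool" where
  "AB3 \<kappa> C \<longleftrightarrow>
     (\<forall>I \<subseteq> Field \<kappa>. |I| <o \<kappa> \<longrightarrow>
        (\<forall>A. (\<forall>i\<in>I. A i \<in> Ob C) \<longrightarrow> (\<exists>P \<iota>. is_coproduct C I A P \<iota>)))"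

text \<open>
  Exactness of \<open>\<bullet> \<midarrow>f\<rightarrow> \<bullet> \<midarrow>g\<rightarrow> \<bullet>\<close>: the image of \<open>f\<close>, that is the kernel of its cokernel,
  is the kernel of \<open>g\<close>.
\<close>

definition exact_at :: "('o, 'm) cat \<Rightarrow> 'm \<Rightarrow> 'm \<Rightarrow> bool" where
  "exact_at C f g \<longleftrightarrow> f \<in> Ar C \<and> g \<in> Ar C \<and> Cod C f = Dom C g \<and>
     (\<exists>c m. is_cokernel C c f \<and> is_kernel C m c \<and> is_kernel C m g)"

definition short_exact :: "('o, 'm) cat \<Rightarrow> 'm \<Rightarrow> 'm \<Rightarrow> bool" where
  "short_exact C f g \<longleftrightarrow>
     (\<exists>Z a b. is_zero_ob C Z \<and> a \<in> Hom C Z (Dom C f) \<and> b \<in> Hom C (Cod C g) Z \<and>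
        exact_at C a f \<and> exact_at C f g \<and> exact_at C g b)"

definition split_short_exact :: "('o, 'm) cat \<Rightarrow> 'm \<Rightarrow> 'm \<Rightarrow> bool" where
  "split_short_exact C f g \<longleftrightarrow> short_exact C f g \<and>
     (\<exists>r \<in> Hom C (Cod C f) (Dom C f). r \<cdot>\<^bsub>C\<^esub> f = Idt C (Dom C f)) \<and>
     (\<exists>s \<in> Hom C (Cod C g) (Dom C g). g \<cdot>\<^bsub>C\<^esub> s = Idt C (Cod C g))"

section \<open>Functor categories\<close>

text \<open>
  The maps of a functor, and the components of a natural transformation, are extensional, so that
  equality in HOL is equality on the relevant carriers.
\<close>

record ('o, 'm, 'p, 'n) func =
  FOb :: "'o \<Rightarrow> 'p"
  FAr :: "'m \<Rightarrow> 'n"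

definition is_functor :: "('o, 'm) cat \<Rightarrow> ('p, 'n) cat \<Rightarrow> ('o, 'm, 'p, 'n) func \<Rightarrow> bool" where
  "is_functor C D F \<longleftrightarrow>
     FOb F \<in> Ob C \<rightarrow>\<^sub>E Ob D \<and> FAr F \<in> extensional (Ar C) \<and>
     (\<forall>f \<in> Ar C. FAr F f \<in> Hom D (FOb F (Dom C f)) (FOb F (Cod C f))) \<and>
     (\<forall>A \<in> Ob C. FAr F (Idt C A) = Idt D (FOb F A)) \<and>
     (\<forall>f \<in> Ar C. \<forall>g \<in> Ar C. Cod C f = Dom C g \<longrightarrow>
        FAr F (g \<cdot>\<^bsub>C\<^esub> f) = FAr F g \<cdot>\<^bsub>D\<^esub> FAr F f)"

definition id_func :: "('o, 'm) cat \<Rightarrow> ('o, 'm, 'o, 'm) func" where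
  "id_func C = \<lparr>FOb = (\<lambda>A \<in> Ob C. A), FAr = (\<lambda>f \<in> Ar C. f)\<rparr>"

definition comp_func ::
  "('o, 'm) cat \<Rightarrow> ('p, 'n, 'q, 'l) func \<Rightarrow> ('o, 'm, 'p, 'n) func \<Rightarrow> ('o, 'm, 'q, 'l) func" where
  "comp_func C G F = \<lparr>FOb = (\<lambda>A \<in> Ob C. FOb G (FOb F A)), FAr = (\<lambda>f \<in> Ar C. FAr G (FAr F f))\<rparr>"

record ('o, 'm, 'p, 'n) nat_trans =
  NDom :: "('o, 'm, 'p, 'n) func"
  NCod :: "('o, 'm, 'p, 'n) func"
  NAt :: "'o \<Rightarrow> 'n"

definition is_nat_trans :: "('o, 'm) cat \<Rightarrow> ('p, 'n) cat \<Rightarrow> ('o, 'm, 'p, 'n) nat_trans \<Rightarrow> bool" where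
  "is_nat_trans C D \<eta> \<longleftrightarrow>
     is_functor C D (NDom \<eta>) \<and> is_functor C D (NCod \<eta>) \<and> NAt \<eta> \<in> extensional (Ob C) \<and>
     (\<forall>A \<in> Ob C. NAt \<eta> A \<in> Hom D (FOb (NDom \<eta>) A) (FOb (NCod \<eta>) A)) \<and>
     (\<forall>f \<in> Ar C. NAt \<eta> (Cod C f) \<cdot>\<^bsub>D\<^esub> FAr (NDom \<eta>) f = FAr (NCod \<eta>) f \<cdot>\<^bsub>D\<^esub> NAt \<eta> (Dom C f))"

definition func_cat ::
  "('o, 'm) cat \<Rightarrow> ('p, 'n) cat \<Rightarrow> (('o, 'm, 'p, 'n) func, ('o, 'm, 'p, 'n) nat_trans) cat" where
  "func_cat C D =
     \<lparr>Ob = {F. is_functor C D F}, Ar = {\<eta>. is_nat_trans C D \<eta>}, Dom = NDom, Cod = NCod,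
      Idt = (\<lambda>F. \<lparr>NDom = F, NCod = F, NAt = (\<lambda>A \<in> Ob C. Idt D (FOb F A))\<rparr>),
      Cmp = (\<lambda>\<theta> \<eta>. \<lparr>NDom = NDom \<eta>, NCod = NCod \<theta>,
                    NAt = (\<lambda>A \<in> Ob C. NAt \<theta> A \<cdot>\<^bsub>D\<^esub> NAt \<eta> A)\<rparr>)\<rparr>"

abbreviation End_cat ::
  "('o, 'm) cat \<Rightarrow> (('o, 'm, 'o, 'm) func, ('o, 'm, 'o, 'm) nat_trans) cat" where
  "End_cat C \<equiv> func_cat C C"

section \<open>Quivers and their representations\<close>

text \<open>
  A quiver is a \<^const>\<open>wf_digraph\<close>: loops, parallel arrows, and infinite (or empty) sets of
  vertices and arrows are allowed; \<^const>\<open>tail\<close> is the source and \<^const>\<open>head\<close> the target.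
  A path from \<open>i\<close> to \<open>j\<close> is a triple \<open>(i, p, j)\<close> where \<open>p\<close> lists the arrows from \<open>i\<close> to \<open>j\<close> in the
  order in which they are traversed, so that the composite \<open>\<alpha>\<rho>\<close> has underlying list \<open>p @ [\<alpha>]\<close>.
\<close>

definition path_cat :: "('v, 'a) pre_digraph \<Rightarrow> ('v, 'v \<times> 'a list \<times> 'v) cat" where
  "path_cat Q =
     \<lparr>Ob = verts Q, Ar = {(i, p, j). pre_digraph.awalk Q i p j},
      Dom = (\<lambda>(i, p, j). i), Cod = (\<lambda>(i, p, j). j), Idt = (\<lambda>i. (i, [], i)),
      Cmp = (\<lambda>(j, q, k) (i, p, j'). (i, p @ q, k))\<rparr>"

abbreviation paths :: "('v, 'a) pre_digraph \<Rightarrow> 'v \<Rightarrow> 'v \<Rightarrow> ('v \<times> 'a list \<times> 'v) set" where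
  "paths Q i j \<equiv> Hom (path_cat Q) i j"

definition paths_to :: "('v, 'a) pre_digraph \<Rightarrow> 'v \<Rightarrow> ('v \<times> 'a list \<times> 'v) set" where
  "paths_to Q j = (\<Union>i \<in> verts Q. paths Q i j)"

definition rccn_at :: "('v, 'a) pre_digraph \<Rightarrow> 'v \<Rightarrow> ('v \<times> 'a list \<times> 'v) set rel" where
  "rccn_at Q i = card_size ((\<lambda>j. |paths Q i j| ) ` verts Q)"

definition rccn :: "('v, 'a) pre_digraph \<Rightarrow> ('v \<times> 'a list \<times> 'v) set rel" where
  "rccn Q = card_sup (rccn_at Q ` verts Q)"

definition ltccn :: "('v, 'a) pre_digraph \<Rightarrow> ('v \<times> 'a list \<times> 'v) set rel" where
  "ltccn Q = card_size ((\<lambda>i. |paths_to Q i| ) ` verts Q)"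

type_synonym ('v, 'a, 'o, 'm) rep = "('v, 'v \<times> 'a list \<times> 'v, 'o, 'm) func"
type_synonym ('v, 'a, 'o, 'm) rep_mor = "('v, 'v \<times> 'a list \<times> 'v, 'o, 'm) nat_trans"

definition Rep ::
  "('v, 'a) pre_digraph \<Rightarrow> ('o, 'm) cat \<Rightarrow> (('v, 'a, 'o, 'm) rep, ('v, 'a, 'o, 'm) rep_mor) cat" where
  "Rep Q C = func_cat (path_cat Q) C"

definition eval_func ::
  "('v, 'a) pre_digraph \<Rightarrow> ('o, 'm) cat \<Rightarrow> 'v \<Rightarrow>
   (('v, 'a, 'o, 'm) rep, ('v, 'a, 'o, 'm) rep_mor, 'o, 'm) func" where
  "eval_func Q C i =
     \<lparr>FOb = (\<lambda>F \<in> Ob (Rep Q C). FOb F i), FAr = (\<lambda>\<eta> \<in> Ar (Rep Q C). NAt \<eta> i)\<rparr>"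

text \<open>
  A chosen coproduct of copies of \<open>A\<close> indexed by \<open>X\<close>, with its inclusions.
\<close>

definition copower :: "('o, 'm) cat \<Rightarrow> 'o \<Rightarrow> 'i set \<Rightarrow> 'o \<times> ('i \<Rightarrow> 'm)" where
  "copower C A X = (SOME (P, \<mu>). is_coproduct C X (\<lambda>_. A) P \<mu>)"

abbreviation copow :: "('o, 'm) cat \<Rightarrow> 'o \<Rightarrow> 'i set \<Rightarrow> 'o" where
  "copow C A X \<equiv> fst (copower C A X)"

abbreviation copow_in :: "('o, 'm) cat \<Rightarrow> 'o \<Rightarrow> 'i set \<Rightarrow> 'i \<Rightarrow> 'm" where
  "copow_in C A X \<equiv> snd (copower C A X)"

text \<open>
  A representation is a functor on the path category, so the map \<open>\<mu>\<^sub>\<rho> \<mapsto> \<mu>\<^sub>\<alpha>\<^sub>\<rho>\<close> belonging to an arrow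
  \<open>\<alpha>\<close> is given directly for every path \<open>\<alpha>\<close>; by functoriality its values on arrows determine the rest.
\<close>

definition free_rep ::
  "('v, 'a) pre_digraph \<Rightarrow> ('o, 'm) cat \<Rightarrow> 'v \<Rightarrow> 'o \<Rightarrow> ('v, 'a, 'o, 'm) rep" where
  "free_rep Q C i A =
     \<lparr>FOb = (\<lambda>j \<in> verts Q. copow C A (paths Q i j)),
      FAr = (\<lambda>\<alpha> \<in> Ar (path_cat Q).
        let k = Dom (path_cat Q) \<alpha>; l = Cod (path_cat Q) \<alpha> in
        THE h. h \<in> Hom C (copow C A (paths Q i k)) (copow C A (paths Q i l)) \<and>
          (\<forall>\<rho> \<in> paths Q i k. h \<cdot>\<^bsub>C\<^esub> copow_in C A (paths Q i k) \<rho>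
             = copow_in C A (paths Q i l) (\<alpha> \<cdot>\<^bsub>path_cat Q\<^esub> \<rho>)))\<rparr>"

definition free_rep_mor ::
  "('v, 'a) pre_digraph \<Rightarrow> ('o, 'm) cat \<Rightarrow> 'v \<Rightarrow> 'm \<Rightarrow> ('v, 'a, 'o, 'm) rep_mor" where
  "free_rep_mor Q C i u =
     \<lparr>NDom = free_rep Q C i (Dom C u), NCod = free_rep Q C i (Cod C u),
      NAt = (\<lambda>j \<in> verts Q.
        THE h. h \<in> Hom C (copow C (Dom C u) (paths Q i j)) (copow C (Cod C u) (paths Q i j)) \<and>
          (\<forall>\<rho> \<in> paths Q i j. h \<cdot>\<^bsub>C\<^esub> copow_in C (Dom C u) (paths Q i j) \<rho>
             = copow_in C (Cod C u) (paths Q i j) \<rho> \<cdot>\<^bsub>C\<^esub> u))\<rparr>"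

definition free_func ::
  "('v, 'a) pre_digraph \<Rightarrow> ('o, 'm) cat \<Rightarrow> 'v \<Rightarrow>
   ('o, 'm, ('v, 'a, 'o, 'm) rep, ('v, 'a, 'o, 'm) rep_mor) func" where
  "free_func Q C i =
     \<lparr>FOb = (\<lambda>A \<in> Ob C. free_rep Q C i A), FAr = (\<lambda>u \<in> Ar C. free_rep_mor Q C i u)\<rparr>"

text \<open>The endofunctor \<open>f\<^sub>j e\<^sub>i\<close> of the category of representations.\<close>

definition fe ::
  "('v, 'a) pre_digraph \<Rightarrow> ('o, 'm) cat \<Rightarrow> 'v \<Rightarrow> 'v \<Rightarrow>
   (('v, 'a, 'o, 'm) rep, ('v, 'a, 'o, 'm) rep_mor, ('v, 'a, 'o, 'm) rep, ('v, 'a, 'o, 'm) rep_mor) func"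
  where
  "fe Q C j i = comp_func (Rep Q C) (free_func Q C j) (eval_func Q C i)"

end

theory Submission
  imports Defs
begin

text \<open>
  Everything is checked vertex-wise, because zero arrows, kernels, cokernels and coproducts of
  functors are computed pointwise. At a vertex \<open>k\<close> the coproduct of the \<open>f\<^sub>i e\<^sub>i(F)\<close> is the coproduct \<open>S\<close>
  of the \<open>F\<^sub>i\<close> over all paths \<open>p\<close> from \<open>i\<close> to \<open>k\<close>, with inclusions \<open>\<tau>\<^sub>p\<close>; the first term of the sequence
  is the coproduct over all nontrivial such paths, written as \<open>pe\<close> with \<open>e\<close> an arrow, with inclusions
  \<open>\<gamma>\<^sub>e\<^sub>,\<^sub>p\<close>. There are fewer than \<open>\<kappa>\<close> paths ending at \<open>k\<close>, so both exist. By the adjunction between \<open>f\<^sub>i\<close>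
  and \<open>e\<^sub>i\<close> there are natural \<open>\<Gamma>\<close> and \<open>\<epsilon>\<close> with \<open>\<Gamma> \<gamma>\<^sub>e\<^sub>,\<^sub>p = \<tau>\<^sub>p\<^sub>e - \<tau>\<^sub>p F\<^sub>e\<close> and \<open>\<epsilon> \<tau>\<^sub>p = F\<^sub>p\<close>. The inclusion
  of the trivial path is a section \<open>s\<close> of \<open>\<epsilon>\<close>, and stripping off first arrows one after the other,
  \<open>r \<tau>\<^sub>p\<^sub>e = \<gamma>\<^sub>e\<^sub>,\<^sub>p + r \<tau>\<^sub>p F\<^sub>e\<close>, defines a retraction \<open>r\<close> of \<open>\<Gamma>\<close> with \<open>\<Gamma> r + s \<epsilon> = 1\<close>.
\<close>

section \<open>Coproducts and short exact sequences\<close>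

text \<open>The obstacle is size. \<open>AB3\<close> gives coproducts with fewer than \<kappa>
  summands, but \<open>arcs Q\<close> and \<open>verts Q\<close> may be larger and \<kappa> may be
  singular, so the outer coproducts cannot be formed by applying \<open>AB3\<close> to families of
  copowers. What is bounded is the set of pairs of an outer index and a path ending at a given
  vertex. So at each vertex the flat coproduct over these pairs is formed and then regrouped over
  the outer index; indices without a path to the vertex contribute initial objects. The second
  obstacle is that r and s are in general not compatible with the arrows of Q: an arrow from k to l
  sends the inclusion of the trivial path at k to that of a path of length one. Hence the splitting
  itself is not lifted to \<open>Rep\<close> or \<open>End\<close>. What is lifted is its
  consequence that \<Gamma> is a kernel of \<epsilon> and \<epsilon> a cokernel of \<Gamma>, because
  factorisations that are unique at each object are automatically natural. The shape of the first
  term comes from cutting a path after its first arrow e: the rest starts at the target of e, which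
  is the index of the free functor, while the arrow into the summand starts from F at the source of
  e.\<close>

lemma Hom_simp: "f \<in> Hom C A B \<longleftrightarrow> f \<in> Ar C \<and> Dom C f = A \<and> Cod C f = B"
  by (auto simp: Hom_def)

context category
begin

lemma Hom_Ob: "f \<in> Hom C A B \<Longrightarrow> A \<in> Ob C" "f \<in> Hom C A B \<Longrightarrow> B \<in> Ob C"
  by (auto simp: Hom_def Dom_Ob Cod_Ob)

lemma Ar_Hom: "f \<in> Ar C \<Longrightarrow> f \<in> Hom C (Dom C f) (Cod C f)"
  by (simp add: Hom_simp)

section \<open>Zero objects and zero arrows\<close>

lemma zero_ob_Hom_unique:
  assumes "is_zero_ob C Z"
  shows "\<lbrakk>f \<in> Hom C X Z; g \<in> Hom C X Z\<rbrakk> \<Longrightarrow> f = g"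
    and "\<lbrakk>f \<in> Hom C Z X; g \<in> Hom C Z X\<rbrakk> \<Longrightarrow> f = g"
  using assms Hom_Ob unfolding is_zero_ob_def by metis+

lemma zero_ob_Hom_exists:
  assumes "is_zero_ob C Z" "X \<in> Ob C"
  shows "\<exists>f. f \<in> Hom C X Z" "\<exists>f. f \<in> Hom C Z X"
  using assms unfolding is_zero_ob_def by blast+

text \<open>\<open>is_zero_ar\<close> allows a zero object that depends on the arrow. Any two zero
  objects are isomorphic, so the factorisation can be moved to a prescribed Z. This makes zero
  arrows comparable and lets one constant functor serve for all of them in a functor
  category.\<close>

lemma zero_ar_factors:
  assumes Z: "is_zero_ob C Z" and f: "is_zero_ar C f" "f \<in> Hom C A B"
  shows "\<exists>a b. a \<in> Hom C A Z \<and> b \<in> Hom C Z B \<and> f = b \<cdot> a"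
proof -
  from f obtain Y a b where Y: "is_zero_ob C Y" and a: "a \<in> Hom C A Y" and b: "b \<in> Hom C Y B"
    and fab: "f = b \<cdot> a"
    unfolding is_zero_ar_def Hom_simp by blast
  have "Y \<in> Ob C" "Z \<in> Ob C" using Y Z by (auto simp: is_zero_ob_def)
  then obtain u v where u: "u \<in> Hom C Y Z" and v: "v \<in> Hom C Z Y"
    using zero_ob_Hom_exists[OF Z] by blast
  have "v \<cdot> u = Idt C Y"
    using zero_ob_Hom_unique(1)[OF Y Cmp_Hom[OF u v] Idt_Hom] \<open>Y \<in> Ob C\<close> by blast
  then have "f = (b \<cdot> v) \<cdot> (u \<cdot> a)"
    using Cmp_assoc[OF Cmp_Hom[OF a u] v b] Cmp_assoc[OF a u v] Idt_Cmp[OF a] fab by simp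
  then show ?thesis using a b u v Cmp_Hom by blast
qed

lemma zero_arI:
  "\<lbrakk>is_zero_ob C Z; a \<in> Hom C A Z; b \<in> Hom C Z B\<rbrakk> \<Longrightarrow> is_zero_ar C (b \<cdot> a)"
  unfolding is_zero_ar_def using Cmp_Hom[of a A Z b B] by (auto simp: Hom_simp)

lemma zero_ar_unique:
  assumes "is_zero_ar C f" "is_zero_ar C g" "f \<in> Hom C A B" "g \<in> Hom C A B"
  shows "f = g"
proof -
  obtain Z where Z: "is_zero_ob C Z" using assms unfolding is_zero_ar_def by blast
  show ?thesis
    using zero_ar_factors[OF Z assms(1,3)] zero_ar_factors[OF Z assms(2,4)]
      zero_ob_Hom_unique[OF Z] by blast
qed

lemma zero_ar_Cmp:
  assumes "is_zero_ar C f" "f \<in> Hom C A B"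
  shows "g \<in> Hom C B D \<Longrightarrow> is_zero_ar C (g \<cdot> f)" "g \<in> Hom C D A \<Longrightarrow> is_zero_ar C (f \<cdot> g)"
proof -
  obtain Z where Z: "is_zero_ob C Z" using assms unfolding is_zero_ar_def by blast
  obtain a b where ab: "a \<in> Hom C A Z" "b \<in> Hom C Z B" "f = b \<cdot> a"
    using zero_ar_factors[OF Z assms] by blast
  show "is_zero_ar C (g \<cdot> f)" if g: "g \<in> Hom C B D"
    using zero_arI[OF Z ab(1) Cmp_Hom[OF ab(2) g]] Cmp_assoc[OF ab(1,2) g] ab(3) by simp
  show "is_zero_ar C (f \<cdot> g)" if g: "g \<in> Hom C D A"
    using zero_arI[OF Z Cmp_Hom[OF g ab(1)] ab(2)] Cmp_assoc[OF g ab(1,2)] ab(3) by simp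
qed

section \<open>Coproducts: universal property, regrouping, existence\<close>

lemma coproduct_desc:
  assumes "is_coproduct C I A P \<iota>" "X \<in> Ob C" "\<And>i. i \<in> I \<Longrightarrow> g i \<in> Hom C (A i) X"
  shows "\<exists>h. h \<in> Hom C P X \<and> (\<forall>i\<in>I. h \<cdot> \<iota> i = g i)"
  using assms unfolding is_coproduct_def by blast

lemma coproduct_eqI:
  assumes "is_coproduct C I A P \<iota>" "g \<in> Hom C P X" "h \<in> Hom C P X"
    and "\<And>i. i \<in> I \<Longrightarrow> g \<cdot> \<iota> i = h \<cdot> \<iota> i"
  shows "g = h"
proof -
  have "\<forall>i\<in>I. h \<cdot> \<iota> i \<in> Hom C (A i) X"
    using assms(1,3) unfolding is_coproduct_def by (blast intro: Cmp_Hom)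
  then have "\<exists>!k. k \<in> Hom C P X \<and> (\<forall>i\<in>I. k \<cdot> \<iota> i = h \<cdot> \<iota> i)"
    using assms(1) Hom_Ob(2)[OF assms(2)] unfolding is_coproduct_def by simp
  then show ?thesis using assms(2-4) by blast
qed

lemma coproduct_Ob: "is_coproduct C I A P \<iota> \<Longrightarrow> P \<in> Ob C"
  and coproduct_in: "is_coproduct C I A P \<iota> \<Longrightarrow> i \<in> I \<Longrightarrow> \<iota> i \<in> Hom C (A i) P"
  by (auto simp: is_coproduct_def)

lemma coproductI:
  assumes "P \<in> Ob C" "\<And>i. i \<in> I \<Longrightarrow> \<iota> i \<in> Hom C (A i) P"
    and ex: "\<And>X g. \<lbrakk>X \<in> Ob C; \<And>i. i \<in> I \<Longrightarrow> g i \<in> Hom C (A i) X\<rbrakk>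
      \<Longrightarrow> \<exists>h. h \<in> Hom C P X \<and> (\<forall>i\<in>I. h \<cdot> \<iota> i = g i)"
    and uniq: "\<And>X g h. \<lbrakk>g \<in> Hom C P X; h \<in> Hom C P X; \<And>i. i \<in> I \<Longrightarrow> g \<cdot> \<iota> i = h \<cdot> \<iota> i\<rbrakk> \<Longrightarrow> g = h"
  shows "is_coproduct C I A P \<iota>"
  unfolding is_coproduct_def
proof (intro conjI ballI allI impI)
  fix X g assume X: "X \<in> Ob C" and g: "\<forall>i\<in>I. g i \<in> Hom C (A i) X"
  obtain h where h: "h \<in> Hom C P X" "\<forall>i\<in>I. h \<cdot> \<iota> i = g i" using ex[OF X, of g] g by blast
  show "\<exists>!h. h \<in> Hom C P X \<and> (\<forall>i\<in>I. h \<cdot> \<iota> i = g i)"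
  proof (rule ex1I[of _ h])
    fix h' assume h': "h' \<in> Hom C P X \<and> (\<forall>i\<in>I. h' \<cdot> \<iota> i = g i)"
    show "h' = h" using h h' by (intro uniq[of h' X h]) auto
  qed (use h in blast)
qed (use assms in auto)

text \<open>A map out of P is a family of maps out of the A i, and each of these is in turn a family
  over J i. Applied at a vertex, it describes a coproduct of free representations by one inclusion
  per path.\<close>

lemma coproduct_Sigma:
  assumes P: "is_coproduct C I A P \<iota>"
    and A: "\<And>i. i \<in> I \<Longrightarrow> is_coproduct C (J i) (\<lambda>_. B i) (A i) (\<mu> i)"
  shows "is_coproduct C (Sigma I J) (\<lambda>(i, _). B i) P (\<lambda>(i, j). \<iota> i \<cdot> \<mu> i j)"
proof (rule coproductI)
  show "P \<in> Ob C" using P by (rule coproduct_Ob)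
  show "(case x of (i, j) \<Rightarrow> \<iota> i \<cdot> \<mu> i j) \<in> Hom C (case x of (i, _) \<Rightarrow> B i) P"
    if "x \<in> Sigma I J" for x
    using that Cmp_Hom[OF coproduct_in[OF A] coproduct_in[OF P]] by auto
next
  fix X g assume X: "X \<in> Ob C"
    and g: "\<And>x. x \<in> Sigma I J \<Longrightarrow> g x \<in> Hom C (case x of (i, _) \<Rightarrow> B i) X"
  have "\<exists>h. h \<in> Hom C (A i) X \<and> (\<forall>j\<in>J i. h \<cdot> \<mu> i j = g (i, j))" if "i \<in> I" for i
    using coproduct_desc[OF A[OF that] X, of "\<lambda>j. g (i, j)"] g[of "(i, _)"] that by simp
  then obtain h where h: "\<And>i. i \<in> I \<Longrightarrow> h i \<in> Hom C (A i) X"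
    "\<And>i j. i \<in> I \<Longrightarrow> j \<in> J i \<Longrightarrow> h i \<cdot> \<mu> i j = g (i, j)" by (metis (no_types))
  obtain k where k: "k \<in> Hom C P X" "\<And>i. i \<in> I \<Longrightarrow> k \<cdot> \<iota> i = h i"
    using coproduct_desc[OF P X, of h] h(1) by blast
  have "k \<cdot> (\<iota> i \<cdot> \<mu> i j) = g (i, j)" if "i \<in> I" "j \<in> J i" for i j
    using Cmp_assoc[OF coproduct_in[OF A[OF that(1)] that(2)] coproduct_in[OF P that(1)] k(1)]
      k(2) h(2) that by simp
  then show "\<exists>h. h \<in> Hom C P X \<and> (\<forall>x\<in>Sigma I J. h \<cdot> (case x of (i, j) \<Rightarrow> \<iota> i \<cdot> \<mu> i j) = g x)"
    using k(1) by auto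
next
  fix X g h assume g: "g \<in> Hom C P X" and h: "h \<in> Hom C P X"
    and gh: "\<And>x. x \<in> Sigma I J \<Longrightarrow>
      g \<cdot> (case x of (i, j) \<Rightarrow> \<iota> i \<cdot> \<mu> i j) = h \<cdot> (case x of (i, j) \<Rightarrow> \<iota> i \<cdot> \<mu> i j)"
  show "g = h"
  proof (rule coproduct_eqI[OF P g h], rule coproduct_eqI[OF A])
    fix i assume i: "i \<in> I"
    note \<iota> = coproduct_in[OF P i]
    show "g \<cdot> \<iota> i \<in> Hom C (A i) X" "h \<cdot> \<iota> i \<in> Hom C (A i) X" using \<iota> g h by (blast intro: Cmp_Hom)+
    show "(g \<cdot> \<iota> i) \<cdot> \<mu> i j = (h \<cdot> \<iota> i) \<cdot> \<mu> i j" if "j \<in> J i" for j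
      using gh[of "(i, j)"] that i Cmp_assoc[OF coproduct_in[OF A[OF i] that] \<iota>] g h by simp
  qed
qed

text \<open>The converse regrouping. Each A i maps into the flat coproduct by its own universal
  property. The set I may be too large for \<open>AB3\<close> even when the set of pairs is not,
  since an i with empty J i, for which A i is initial, contributes no pair.\<close>

lemma coproduct_of_copowers:
  assumes P: "is_coproduct C (Sigma I J) (\<lambda>(i, _). B i) P \<gamma>"
    and A: "\<And>i. i \<in> I \<Longrightarrow> is_coproduct C (J i) (\<lambda>_. B i) (A i) (\<mu> i)"
  shows "\<exists>\<iota>. is_coproduct C I A P \<iota>"
proof -
  have "\<exists>h. h \<in> Hom C (A i) P \<and> (\<forall>j\<in>J i. h \<cdot> \<mu> i j = \<gamma> (i, j))" if "i \<in> I" for i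
    using coproduct_desc[OF A[OF that] coproduct_Ob[OF P], of "\<lambda>j. \<gamma> (i, j)"]
      coproduct_in[OF P, of "(i, _)"] that by simp
  then obtain \<iota> where \<iota>: "\<And>i. i \<in> I \<Longrightarrow> \<iota> i \<in> Hom C (A i) P"
    "\<And>i j. i \<in> I \<Longrightarrow> j \<in> J i \<Longrightarrow> \<iota> i \<cdot> \<mu> i j = \<gamma> (i, j)" by metis
  have "is_coproduct C I A P \<iota>"
  proof (rule coproductI)
    show "P \<in> Ob C" using P by (rule coproduct_Ob)
    show "\<iota> i \<in> Hom C (A i) P" if "i \<in> I" for i using \<iota>(1) that .
  next
    fix X g assume X: "X \<in> Ob C" and g: "\<And>i. i \<in> I \<Longrightarrow> g i \<in> Hom C (A i) X"
    have "(case x of (i, j) \<Rightarrow> g i \<cdot> \<mu> i j) \<in> Hom C (case x of (i, _) \<Rightarrow> B i) X"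
      if "x \<in> Sigma I J" for x
      using that Cmp_Hom[OF coproduct_in[OF A] g] by auto
    from coproduct_desc[OF P X this] obtain h where h: "h \<in> Hom C P X"
      "\<And>x. x \<in> Sigma I J \<Longrightarrow> h \<cdot> \<gamma> x = (case x of (i, j) \<Rightarrow> g i \<cdot> \<mu> i j)" by blast
    have "h \<cdot> \<iota> i = g i" if i: "i \<in> I" for i
    proof (rule coproduct_eqI[OF A[OF i] Cmp_Hom[OF \<iota>(1)[OF i] h(1)] g[OF i]])
      fix j assume j: "j \<in> J i"
      show "(h \<cdot> \<iota> i) \<cdot> \<mu> i j = g i \<cdot> \<mu> i j"
        using Cmp_assoc[OF coproduct_in[OF A[OF i] j] \<iota>(1)[OF i] h(1)] h(2)[of "(i, j)"]
          \<iota>(2)[OF i j] i j by simp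
    qed
    then show "\<exists>h. h \<in> Hom C P X \<and> (\<forall>i\<in>I. h \<cdot> \<iota> i = g i)" using h(1) by blast
  next
    fix X g h assume g: "g \<in> Hom C P X" and h: "h \<in> Hom C P X"
      and gh: "\<And>i. i \<in> I \<Longrightarrow> g \<cdot> \<iota> i = h \<cdot> \<iota> i"
    show "g = h"
    proof (rule coproduct_eqI[OF P g h])
      fix x assume "x \<in> Sigma I J"
      then obtain i j where x: "x = (i, j)" "i \<in> I" "j \<in> J i" by blast
      have "k \<cdot> \<gamma> x = (k \<cdot> \<iota> i) \<cdot> \<mu> i j" if "k \<in> Hom C P X" for k
        using Cmp_assoc[OF coproduct_in[OF A[OF x(2)] x(3)] \<iota>(1)[OF x(2)] that] \<iota>(2) x by simp
      then show "g \<cdot> \<gamma> x = h \<cdot> \<gamma> x" using gh x g h by simp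
    qed
  qed
  then show ?thesis by blast
qed

text \<open>\<open>AB3\<close> speaks only of index sets inside \<open>Field \<kappa>\<close>. An
  injection f of X into that field moves the family there, reindexed by \<open>inv_into\<close>, and
  composing the inclusions with f moves the result back.\<close>

lemma AB3_coproduct:
  assumes \<kappa>: "AB3 \<kappa> C" "Card_order \<kappa>" and X: "|X| <o \<kappa>" and A: "\<And>x. x \<in> X \<Longrightarrow> A x \<in> Ob C"
  shows "\<exists>P \<iota>. is_coproduct C X A P \<iota>"
proof -
  have "|X| \<le>o |Field \<kappa>|"
    using X \<kappa>(2) by (meson card_of_Field_ordIso ordIso_symmetric ordLeq_ordIso_trans ordLess_imp_ordLeq)
  then obtain f where f: "inj_on f X" "f ` X \<subseteq> Field \<kappa>" using card_of_ordLeq by metis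
  have "|f ` X| <o \<kappa>"
    using X card_of_image ordLeq_ordLess_trans by blast
  then obtain P \<iota> where P: "is_coproduct C (f ` X) (\<lambda>i. A (inv_into X f i)) P \<iota>"
    using \<kappa>(1) f A unfolding AB3_def by (metis (mono_tags, lifting) imageE inv_into_into imageI)
  have "is_coproduct C X A P (\<lambda>x. \<iota> (f x))"
  proof (rule coproductI)
    show "P \<in> Ob C" using P by (rule coproduct_Ob)
    show "\<iota> (f x) \<in> Hom C (A x) P" if "x \<in> X" for x
      using coproduct_in[OF P, of "f x"] that f(1) by simp
  next
    fix Y g assume Y: "Y \<in> Ob C" and g: "\<And>x. x \<in> X \<Longrightarrow> g x \<in> Hom C (A x) Y"
    have "g (inv_into X f i) \<in> Hom C (A (inv_into X f i)) Y" if "i \<in> f ` X" for i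
      using g[OF inv_into_into[OF that]] .
    from coproduct_desc[OF P Y this] obtain h
      where h: "h \<in> Hom C P Y" "\<And>i. i \<in> f ` X \<Longrightarrow> h \<cdot> \<iota> i = g (inv_into X f i)" by blast
    have "h \<cdot> \<iota> (f x) = g x" if "x \<in> X" for x
      using h(2)[of "f x"] that f(1) by simp
    then show "\<exists>h. h \<in> Hom C P Y \<and> (\<forall>x\<in>X. h \<cdot> \<iota> (f x) = g x)" using h(1) by blast
  next
    fix Y g h assume gh: "g \<in> Hom C P Y" "h \<in> Hom C P Y"
      and eq: "\<And>x. x \<in> X \<Longrightarrow> g \<cdot> \<iota> (f x) = h \<cdot> \<iota> (f x)"
    show "g = h" by (rule coproduct_eqI[OF P gh]) (use eq in blast)
  qed
  then show ?thesis by blast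
qed

text \<open>Exactness is phrased through a cokernel and its kernel, so each of the three places
  needs such a pair. The pairs are the identity of A with kernel a, then g with kernel f, then b
  with kernel the identity of D, where a and b are the arrows from and to zero. Apart from f and g
  only a zero object enters, so the lemma serves C, \<open>Rep\<close> and \<open>End\<close>
  alike.\<close>

lemma short_exactI:
  assumes Z: "is_zero_ob C Z" and f: "f \<in> Hom C A B" and g: "g \<in> Hom C B D"
    and k: "is_kernel C f g" and c: "is_cokernel C g f"
  shows "short_exact C f g"
proof -
  obtain a where a: "a \<in> Hom C Z A" using zero_ob_Hom_exists(2)[OF Z] Hom_Ob(1)[OF f] by blast
  obtain b where b: "b \<in> Hom C D Z" using zero_ob_Hom_exists(1)[OF Z] Hom_Ob(2)[OF g] by blast
  have zob: "Z \<in> Ob C" using Z by (simp add: is_zero_ob_def)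
  have a0: "is_zero_ar C a" using zero_arI[OF Z Idt_Hom[OF zob] a] Cmp_Idt[OF a] by simp
  have b0: "is_zero_ar C b" using zero_arI[OF Z b Idt_Hom[OF zob]] Idt_Cmp[OF b] by simp
  have DC: "f \<in> Ar C" "g \<in> Ar C" "a \<in> Ar C" "b \<in> Ar C" "Dom C f = A" "Cod C f = B" "Dom C g = B"
    "Cod C g = D" "Dom C a = Z" "Cod C a = A" "Dom C b = D" "Cod C b = Z"
    using f g a b by (auto simp: Hom_simp)
  have obs: "A \<in> Ob C" "B \<in> Ob C" "D \<in> Ob C" using Hom_Ob f g by blast+
  note IA = Idt_Hom[OF obs(1)] and ID = Idt_Hom[OF obs(3)]
  \<comment> \<open>A kernel is a monomorphism: h and h' both factor the same arrow through f, and
    that arrow is killed by g.\<close>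
  have f_mono: "h = h'" if "h \<in> Hom C X A" "h' \<in> Hom C X A" "f \<cdot> h = f \<cdot> h'" for h h' X
  proof -
    have gf: "is_zero_ar C (g \<cdot> f)" using k by (simp add: is_kernel_def)
    have "is_zero_ar C (g \<cdot> (f \<cdot> h))"
      using zero_ar_Cmp(2)[OF gf Cmp_Hom[OF f g] that(1)] Cmp_assoc[OF that(1) f g] by simp
    then have "\<exists>!h'. h' \<in> Hom C X A \<and> f \<cdot> h' = f \<cdot> h"
      using k Cmp_Hom[OF that(1) f] DC unfolding is_kernel_def by simp
    then show ?thesis using that by metis
  qed
  have g_epi: "h = h'" if "h \<in> Hom C D X" "h' \<in> Hom C D X" "h \<cdot> g = h' \<cdot> g" for h h' X
  proof -
    have gf: "is_zero_ar C (g \<cdot> f)" using k by (simp add: is_kernel_def)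
    have "is_zero_ar C ((h \<cdot> g) \<cdot> f)"
      using zero_ar_Cmp(1)[OF gf Cmp_Hom[OF f g] that(1)] Cmp_assoc[OF f g that(1)] by simp
    then have "\<exists>!h'. h' \<in> Hom C D X \<and> h' \<cdot> g = h \<cdot> g"
      using c Cmp_Hom[OF g that(1)] DC unfolding is_cokernel_def by simp
    then show ?thesis using that by metis
  qed
  have "is_cokernel C (Idt C A) a"
    unfolding is_cokernel_def
  proof (intro conjI allI ballI impI)
    fix X h assume "h \<in> Hom C (Cod C a) X"
    then show "\<exists>!k. k \<in> Hom C (Cod C (Idt C A)) X \<and> k \<cdot> Idt C A = h"
      using IA DC by (metis Cmp_Idt Hom_simp)
  qed (use IA DC a0 Idt_Cmp[OF a] in \<open>auto simp: Hom_simp\<close>)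
  moreover have "is_kernel C a (Idt C A)"
    unfolding is_kernel_def
  proof (intro conjI allI ballI impI)
    fix X h assume h0: "h \<in> Hom C X (Dom C (Idt C A))" "is_zero_ar C (Idt C A \<cdot> h)"
    then have h: "h \<in> Hom C X A" "is_zero_ar C h" using IA Idt_Cmp[of h X A] by (auto simp: Hom_simp)
    obtain u v where "u \<in> Hom C X Z" "v \<in> Hom C Z A" "h = v \<cdot> u"
      using zero_ar_factors[OF Z h(2,1)] by blast
    then show "\<exists>!k. k \<in> Hom C X (Dom C a) \<and> a \<cdot> k = h"
      using zero_ob_Hom_unique[OF Z] a DC by metis
  qed (use IA DC a0 Idt_Cmp[OF a] in \<open>auto simp: Hom_simp\<close>)
  moreover have "is_kernel C a f"
    unfolding is_kernel_def
  proof (intro conjI allI ballI impI)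
    show "is_zero_ar C (f \<cdot> a)" using zero_ar_Cmp(1)[OF a0 a f] .
    fix X h assume h0: "h \<in> Hom C X (Dom C f)" "is_zero_ar C (f \<cdot> h)"
    then have h: "h \<in> Hom C X A" using DC by simp
    obtain u where u: "u \<in> Hom C X Z" using zero_ob_Hom_exists(1)[OF Z] Hom_Ob(1)[OF h] by blast
    have au: "a \<cdot> u \<in> Hom C X A" "is_zero_ar C (a \<cdot> u)" using Cmp_Hom[OF u a] zero_arI[OF Z u a] by auto
    \<comment> \<open>Two zero arrows between the same objects agree; cancelling f then makes h
      factor through Z.\<close>
    have "f \<cdot> h = f \<cdot> (a \<cdot> u)"
      using zero_ar_unique[OF h0(2) zero_ar_Cmp(1)[OF au(2,1) f]] h au(1) f Cmp_Hom by blast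
    then have "h = a \<cdot> u" using f_mono h au(1) by blast
    then show "\<exists>!k. k \<in> Hom C X (Dom C a) \<and> a \<cdot> k = h"
      using zero_ob_Hom_unique[OF Z] u DC by metis
  qed (use DC in auto)
  moreover have "is_cokernel C b g"
    unfolding is_cokernel_def
  proof (intro conjI allI ballI impI)
    show "is_zero_ar C (b \<cdot> g)" using zero_ar_Cmp(2)[OF b0 b g] .
    fix X h assume h0: "h \<in> Hom C (Cod C g) X" "is_zero_ar C (h \<cdot> g)"
    then have h: "h \<in> Hom C D X" using DC by simp
    obtain u where u: "u \<in> Hom C Z X" using zero_ob_Hom_exists(2)[OF Z] Hom_Ob(2)[OF h] by blast
    have ub: "u \<cdot> b \<in> Hom C D X" "is_zero_ar C (u \<cdot> b)" using Cmp_Hom[OF b u] zero_arI[OF Z b u] by auto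
    have "h \<cdot> g = (u \<cdot> b) \<cdot> g"
      using zero_ar_unique[OF h0(2) zero_ar_Cmp(2)[OF ub(2,1) g]] h ub(1) g Cmp_Hom by blast
    then have "h = u \<cdot> b" using g_epi h ub(1) by blast
    then show "\<exists>!k. k \<in> Hom C (Cod C b) X \<and> k \<cdot> b = h"
      using zero_ob_Hom_unique[OF Z] u DC by metis
  qed (use DC in auto)
  moreover have "is_kernel C (Idt C D) b"
    unfolding is_kernel_def
  proof (intro conjI allI ballI impI)
    fix X h assume "h \<in> Hom C X (Dom C b)"
    then show "\<exists>!k. k \<in> Hom C X (Dom C (Idt C D)) \<and> Idt C D \<cdot> k = h"
      using ID DC by (metis Idt_Cmp Hom_simp)
  qed (use ID DC b0 Cmp_Idt[OF b] in \<open>auto simp: Hom_simp\<close>)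
  ultimately show ?thesis
    unfolding short_exact_def exact_at_def using Z a b DC k c by metis
qed

end

section \<open>Split sequences in preadditive categories\<close>

text \<open>\<open>abelian_category\<close> asserts only that some group structure on the hom-sets
  exists. Fixing one as a parameter allows sums of arrows to be written; the zero object serves to
  recognise the group units as zero arrows.\<close>

locale preadditive_category = category C for C :: "('o, 'm) cat" (structure) +
  fixes G :: "'o \<Rightarrow> 'o \<Rightarrow> 'm monoid"
  assumes preadditive: "preadditive C G"
    and zero_ob_exists: "\<exists>Z. is_zero_ob C Z"
begin

section \<open>Arithmetic in the hom-groups\<close>

lemma Hom_comm_group:
  assumes "f \<in> Hom C A B"
  shows "comm_group (G A B)" and "carrier (G A B) = Hom C A B"
  using preadditive Hom_Ob[OF assms] unfolding preadditive_def by blast+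

lemma Cmp_hom_left:
  assumes "f \<in> Hom C A B" "D \<in> Ob C"
  shows "group_hom (G B D) (G A D) (\<lambda>g. g \<cdot> f)"
  using preadditive Hom_Ob[OF assms(1)] assms unfolding preadditive_def group_hom_def group_hom_axioms_def
  by (metis comm_group_def)

lemma Cmp_hom_right:
  assumes "g \<in> Hom C B D" "A \<in> Ob C"
  shows "group_hom (G A B) (G A D) (\<lambda>f. g \<cdot> f)"
  using preadditive Hom_Ob[OF assms(1)] assms unfolding preadditive_def group_hom_def group_hom_axioms_def
  by (metis comm_group_def)

text \<open>The groups are written multiplicatively, so \<open>\<otimes>\<close> is addition of
  arrows and \<open>\<one>\<close> is the zero arrow. The two objects are arguments because each
  hom-set carries its own group.\<close>

definition sub :: "'o \<Rightarrow> 'o \<Rightarrow> 'm \<Rightarrow> 'm \<Rightarrow> 'm" where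
  "sub A B f g = f \<otimes>\<^bsub>G A B\<^esub> inv\<^bsub>G A B\<^esub> g"

lemma one_Hom: "\<lbrakk>A \<in> Ob C; B \<in> Ob C\<rbrakk> \<Longrightarrow> \<one>\<^bsub>G A B\<^esub> \<in> Hom C A B"
  using preadditive unfolding preadditive_def
  by (metis comm_group_def group.is_monoid monoid.one_closed)

lemma mult_Hom: "\<lbrakk>f \<in> Hom C A B; g \<in> Hom C A B\<rbrakk> \<Longrightarrow> f \<otimes>\<^bsub>G A B\<^esub> g \<in> Hom C A B"
  using Hom_comm_group by (metis comm_group_def group.is_monoid monoid.m_closed)

lemma sub_Hom: "\<lbrakk>f \<in> Hom C A B; g \<in> Hom C A B\<rbrakk> \<Longrightarrow> sub A B f g \<in> Hom C A B"
  unfolding sub_def using Hom_comm_group mult_Hom by (metis comm_group_def group.inv_closed)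

lemma Cmp_mult:
  assumes "f \<in> Hom C A B" "f' \<in> Hom C A B"
  shows "g \<in> Hom C B D \<Longrightarrow> g \<cdot> (f \<otimes>\<^bsub>G A B\<^esub> f') = (g \<cdot> f) \<otimes>\<^bsub>G A D\<^esub> (g \<cdot> f')"
    and "g \<in> Hom C X A \<Longrightarrow> (f \<otimes>\<^bsub>G A B\<^esub> f') \<cdot> g = (f \<cdot> g) \<otimes>\<^bsub>G X B\<^esub> (f' \<cdot> g)"
  using group_hom.hom_mult[OF Cmp_hom_right, of g B D A f f']
    group_hom.hom_mult[OF Cmp_hom_left, of g X A B f f']
    assms Hom_comm_group[OF assms(1)] Hom_Ob[OF assms(1)] by simp_all

lemma Cmp_one:
  assumes "f \<in> Hom C A B"
  shows "D \<in> Ob C \<Longrightarrow> \<one>\<^bsub>G B D\<^esub> \<cdot> f = \<one>\<^bsub>G A D\<^esub>"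
    and "X \<in> Ob C \<Longrightarrow> f \<cdot> \<one>\<^bsub>G X A\<^esub> = \<one>\<^bsub>G X B\<^esub>"
  using group_hom.hom_one[OF Cmp_hom_left[OF assms]] group_hom.hom_one[OF Cmp_hom_right[OF assms]]
  by simp_all

lemma Cmp_sub:
  assumes "f \<in> Hom C A B" "f' \<in> Hom C A B"
  shows "g \<in> Hom C B D \<Longrightarrow> g \<cdot> sub A B f f' = sub A D (g \<cdot> f) (g \<cdot> f')"
    and "g \<in> Hom C X A \<Longrightarrow> sub A B f f' \<cdot> g = sub X B (f \<cdot> g) (f' \<cdot> g)"
proof -
  note grp = Hom_comm_group[OF assms(1)]
  have i: "inv\<^bsub>G A B\<^esub> f' \<in> Hom C A B"
    using grp assms(2) by (metis comm_group_def group.inv_closed)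
  show "g \<cdot> sub A B f f' = sub A D (g \<cdot> f) (g \<cdot> f')" if g: "g \<in> Hom C B D"
    unfolding sub_def Cmp_mult(1)[OF assms(1) i g]
    using group_hom.hom_inv[OF Cmp_hom_right[OF g], of A f'] assms grp Hom_Ob[OF assms(1)] by simp
  show "sub A B f f' \<cdot> g = sub X B (f \<cdot> g) (f' \<cdot> g)" if g: "g \<in> Hom C X A"
    unfolding sub_def Cmp_mult(2)[OF assms(1) i g]
    using group_hom.hom_inv[OF Cmp_hom_left[OF g], of B f'] assms grp Hom_Ob[OF assms(1)] by simp
qed

lemma sub_self: "f \<in> Hom C A B \<Longrightarrow> sub A B f f = \<one>\<^bsub>G A B\<^esub>"
  unfolding sub_def using Hom_comm_group by (metis comm_group_def group.r_inv)

lemma add_sub_cancel: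
  assumes "f \<in> Hom C A B" "g \<in> Hom C A B"
  shows "sub A B (f \<otimes>\<^bsub>G A B\<^esub> g) g = f" "sub A B f g \<otimes>\<^bsub>G A B\<^esub> g = f"
proof -
  interpret comm_group "G A B" using Hom_comm_group[OF assms(1)] by simp
  have "f \<in> carrier (G A B)" "g \<in> carrier (G A B)" using assms Hom_comm_group[OF assms(1)] by simp_all
  then show "sub A B (f \<otimes>\<^bsub>G A B\<^esub> g) g = f" "sub A B f g \<otimes>\<^bsub>G A B\<^esub> g = f"
    by (simp_all add: sub_def m_assoc)
qed

lemma mult_assoc:
  assumes "f \<in> Hom C A B" "g \<in> Hom C A B" "h \<in> Hom C A B"
  shows "(f \<otimes>\<^bsub>G A B\<^esub> g) \<otimes>\<^bsub>G A B\<^esub> h = f \<otimes>\<^bsub>G A B\<^esub> (g \<otimes>\<^bsub>G A B\<^esub> h)"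
  using assms Hom_comm_group[OF assms(1)] by (metis comm_group_def group.is_monoid monoid.m_assoc)

lemma mult_one:
  assumes "f \<in> Hom C A B"
  shows "\<one>\<^bsub>G A B\<^esub> \<otimes>\<^bsub>G A B\<^esub> f = f" "f \<otimes>\<^bsub>G A B\<^esub> \<one>\<^bsub>G A B\<^esub> = f"
  using assms Hom_comm_group[OF assms(1)]
  by (metis comm_group_def group.is_monoid monoid.l_one) (metis assms Hom_comm_group comm_group_def group.is_monoid monoid.r_one)

text \<open>Composition with an arrow b from Z is a homomorphism, so the unit of G A B is b composed
  with the unit of G A Z and therefore factors through zero. Uniqueness of zero arrows does the
  rest.\<close>

lemma zero_ar_iff:
  assumes f: "f \<in> Hom C A B"
  shows "is_zero_ar C f \<longleftrightarrow> f = \<one>\<^bsub>G A B\<^esub>"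
proof -
  obtain Z where Z: "is_zero_ob C Z" using zero_ob_exists by blast
  have obs: "A \<in> Ob C" "B \<in> Ob C" "Z \<in> Ob C" using Hom_Ob[OF f] Z by (auto simp: is_zero_ob_def)
  obtain b where b: "b \<in> Hom C Z B" using zero_ob_Hom_exists(2)[OF Z obs(2)] by blast
  have "is_zero_ar C (b \<cdot> \<one>\<^bsub>G A Z\<^esub>)" using zero_arI[OF Z one_Hom b] obs by blast
  then have "is_zero_ar C (\<one>\<^bsub>G A B\<^esub>)" using Cmp_one(2)[OF b obs(1)] by simp
  then show ?thesis using zero_ar_unique one_Hom f obs by metis
qed

text \<open>If gh = 0, then fr + sg = 1 gives h = f(rh), and rf = 1 forces every factorisation to be
  rh. Dually, hf = 0 gives h = (hs)g, and gs = 1 makes this the only way.\<close>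

lemma split_kernel_cokernel:
  assumes f: "f \<in> Hom C A B" and g: "g \<in> Hom C B D" and r: "r \<in> Hom C B A" and s: "s \<in> Hom C D B"
    and rf: "r \<cdot> f = Idt C A" and gs: "g \<cdot> s = Idt C D" and gf: "g \<cdot> f = \<one>\<^bsub>G A D\<^esub>"
    and sum: "(f \<cdot> r) \<otimes>\<^bsub>G B B\<^esub> (s \<cdot> g) = Idt C B"
  shows "is_kernel C f g" "is_cokernel C g f"
proof -
  have DC: "f \<in> Ar C" "g \<in> Ar C" "Dom C f = A" "Cod C f = B" "Dom C g = B" "Cod C g = D"
    using f g by (auto simp: Hom_simp)
  have obs: "A \<in> Ob C" "B \<in> Ob C" "D \<in> Ob C" using Hom_Ob f g by blast+
  have gf0: "is_zero_ar C (g \<cdot> f)" using zero_ar_iff[OF Cmp_Hom[OF f g]] gf by simp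
  note fr = Cmp_Hom[OF r f] and sg = Cmp_Hom[OF g s]
  show "is_kernel C f g"
    unfolding is_kernel_def
  proof (intro conjI allI ballI impI)
    fix X h assume h0: "h \<in> Hom C X (Dom C g)" "is_zero_ar C (g \<cdot> h)"
    then have h: "h \<in> Hom C X B" using DC by simp
    have X: "X \<in> Ob C" using Hom_Ob h by blast
    have gh: "g \<cdot> h = \<one>\<^bsub>G X D\<^esub>" using zero_ar_iff[OF Cmp_Hom[OF h g]] h0 by simp
    have "h = ((f \<cdot> r) \<otimes>\<^bsub>G B B\<^esub> (s \<cdot> g)) \<cdot> h" using sum Idt_Cmp[OF h] by simp
    also have "\<dots> = ((f \<cdot> r) \<cdot> h) \<otimes>\<^bsub>G X B\<^esub> ((s \<cdot> g) \<cdot> h)" using Cmp_mult(2)[OF fr sg h] .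
    also have "(s \<cdot> g) \<cdot> h = \<one>\<^bsub>G X B\<^esub>" using Cmp_assoc[OF h g s] Cmp_one(2)[OF s X] gh by simp
    also have "((f \<cdot> r) \<cdot> h) \<otimes>\<^bsub>G X B\<^esub> \<one>\<^bsub>G X B\<^esub> = f \<cdot> (r \<cdot> h)"
      using mult_one(2)[OF Cmp_Hom[OF h fr]] Cmp_assoc[OF h r f] by simp
    finally have "f \<cdot> (r \<cdot> h) = h" by simp
    moreover have "k = r \<cdot> h" if "k \<in> Hom C X A" "f \<cdot> k = h" for k
      using Cmp_assoc[OF that(1) f r] rf Idt_Cmp[OF that(1)] that(2) by simp
    ultimately show "\<exists>!k. k \<in> Hom C X (Dom C f) \<and> f \<cdot> k = h"
      using Cmp_Hom[OF h r] DC by metis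
  qed (use DC gf0 in auto)
  show "is_cokernel C g f"
    unfolding is_cokernel_def
  proof (intro conjI allI ballI impI)
    fix X h assume h0: "h \<in> Hom C (Cod C f) X" "is_zero_ar C (h \<cdot> f)"
    then have h: "h \<in> Hom C B X" using DC by simp
    have X: "X \<in> Ob C" using Hom_Ob h by blast
    have hf: "h \<cdot> f = \<one>\<^bsub>G A X\<^esub>" using zero_ar_iff[OF Cmp_Hom[OF f h]] h0 by simp
    have "h = h \<cdot> ((f \<cdot> r) \<otimes>\<^bsub>G B B\<^esub> (s \<cdot> g))" using sum Cmp_Idt[OF h] by simp
    also have "\<dots> = (h \<cdot> (f \<cdot> r)) \<otimes>\<^bsub>G B X\<^esub> (h \<cdot> (s \<cdot> g))" using Cmp_mult(1)[OF fr sg h] .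
    also have "h \<cdot> (f \<cdot> r) = \<one>\<^bsub>G B X\<^esub>" using Cmp_assoc[OF r f h] Cmp_one(1)[OF r X] hf by simp
    also have "\<one>\<^bsub>G B X\<^esub> \<otimes>\<^bsub>G B X\<^esub> (h \<cdot> (s \<cdot> g)) = (h \<cdot> s) \<cdot> g"
      using mult_one(1)[OF Cmp_Hom[OF sg h]] Cmp_assoc[OF g s h] by simp
    finally have "(h \<cdot> s) \<cdot> g = h" by simp
    moreover have "k = h \<cdot> s" if "k \<in> Hom C D X" "k \<cdot> g = h" for k
      using Cmp_assoc[OF s g that(1)] gs Cmp_Idt[OF that(1)] that(2) by simp
    ultimately show "\<exists>!k. k \<in> Hom C (Cod C g) X \<and> k \<cdot> g = h"
      using Cmp_Hom[OF s h] DC by metis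
  qed (use DC gf0 in auto)
qed

end

lemma abelian_imp_preadditive:
  assumes "abelian_category C"
  obtains G where "preadditive_category C G"
  using assms unfolding abelian_category_def preadditive_category_def preadditive_category_axioms_def
  by blast

section \<open>Pointwise constructions in functor categories\<close>

lemma func_cat_simps [simp]:
  "Ob (func_cat C D) = {F. is_functor C D F}"
  "Ar (func_cat C D) = {\<eta>. is_nat_trans C D \<eta>}"
  "Dom (func_cat C D) = NDom"
  "Cod (func_cat C D) = NCod"
  by (simp_all add: func_cat_def)

lemma NAt_Cmp [simp]: "X \<in> Ob C \<Longrightarrow> NAt (\<theta> \<cdot>\<^bsub>func_cat C D\<^esub> \<eta>) X = NAt \<theta> X \<cdot>\<^bsub>D\<^esub> NAt \<eta> X"
  by (simp add: func_cat_def)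

lemma NAt_Idt [simp]: "X \<in> Ob C \<Longrightarrow> NAt (Idt (func_cat C D) F) X = Idt D (FOb F X)"
  by (simp add: func_cat_def)

lemma functor_Ob: "is_functor C D F \<Longrightarrow> A \<in> Ob C \<Longrightarrow> FOb F A \<in> Ob D"
  by (auto simp: is_functor_def)

lemma functor_Hom: "is_functor C D F \<Longrightarrow> f \<in> Hom C A B \<Longrightarrow> FAr F f \<in> Hom D (FOb F A) (FOb F B)"
  by (auto simp: is_functor_def Hom_simp)

lemma functor_Idt: "is_functor C D F \<Longrightarrow> A \<in> Ob C \<Longrightarrow> FAr F (Idt C A) = Idt D (FOb F A)"
  by (auto simp: is_functor_def)

lemma functor_Cmp:
  "\<lbrakk>is_functor C D F; f \<in> Hom C A B; g \<in> Hom C B E\<rbrakk> \<Longrightarrow> FAr F (g \<cdot>\<^bsub>C\<^esub> f) = FAr F g \<cdot>\<^bsub>D\<^esub> FAr F f"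
  by (auto simp: is_functor_def Hom_simp)

lemma nat_functor:
  assumes "\<eta> \<in> Hom (func_cat C D) F G"
  shows "is_functor C D F" "is_functor C D G"
  using assms by (auto simp: is_nat_trans_def Hom_simp)

lemma nat_Hom: "\<lbrakk>\<eta> \<in> Hom (func_cat C D) F G; A \<in> Ob C\<rbrakk> \<Longrightarrow> NAt \<eta> A \<in> Hom D (FOb F A) (FOb G A)"
  by (auto simp: is_nat_trans_def Hom_simp)

lemma nat_square:
  "\<lbrakk>\<eta> \<in> Hom (func_cat C D) F G; f \<in> Hom C A B\<rbrakk>
    \<Longrightarrow> NAt \<eta> B \<cdot>\<^bsub>D\<^esub> FAr F f = FAr G f \<cdot>\<^bsub>D\<^esub> NAt \<eta> A"
  by (auto simp: is_nat_trans_def Hom_simp)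

text \<open>Extensionality fixes the components off \<open>Ob C\<close>, and source and target are
  fields of the record; hence agreement on objects is equality in HOL.\<close>

lemma nat_eqI:
  assumes "\<eta> \<in> Hom (func_cat C D) F G" "\<theta> \<in> Hom (func_cat C D) F G"
    and "\<And>X. X \<in> Ob C \<Longrightarrow> NAt \<eta> X = NAt \<theta> X"
  shows "\<eta> = \<theta>"
proof -
  have "NAt \<eta> = NAt \<theta>"
    using assms by (intro extensionalityI[of _ "Ob C"]) (auto simp: Hom_simp is_nat_trans_def)
  then show ?thesis using assms(1,2) by (cases \<eta>; cases \<theta>) (auto simp: Hom_simp)
qed

text \<open>The restriction to \<open>Ob C\<close> makes an arbitrary family of components
  extensional, as \<open>is_nat_trans\<close> demands; naturality is left to
  \<open>mk_nat_Hom\<close>.\<close>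

definition mk_nat ::
  "('o, 'm) cat \<Rightarrow> ('o, 'm, 'p, 'n) func \<Rightarrow> ('o, 'm, 'p, 'n) func \<Rightarrow> ('o \<Rightarrow> 'n) \<Rightarrow> ('o, 'm, 'p, 'n) nat_trans"
  where "mk_nat C F G t = \<lparr>NDom = F, NCod = G, NAt = (\<lambda>X \<in> Ob C. t X)\<rparr>"

lemma NAt_mk_nat [simp]: "X \<in> Ob C \<Longrightarrow> NAt (mk_nat C F G t) X = t X"
  by (simp add: mk_nat_def)

context
  fixes C :: "('o, 'm) cat" and D :: "('p, 'n) cat"
  assumes C: "category C" and D: "category D"
begin

lemma mk_nat_Hom:
  assumes "is_functor C D F" "is_functor C D G"
    and "\<And>X. X \<in> Ob C \<Longrightarrow> t X \<in> Hom D (FOb F X) (FOb G X)"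
    and "\<And>f A B. f \<in> Hom C A B \<Longrightarrow> t B \<cdot>\<^bsub>D\<^esub> FAr F f = FAr G f \<cdot>\<^bsub>D\<^esub> t A"
  shows "mk_nat C F G t \<in> Hom (func_cat C D) F G"
  using assms category.Dom_Ob[OF C] category.Cod_Ob[OF C]
  by (auto simp: mk_nat_def Hom_simp is_nat_trans_def)

lemma func_cat_Idt_Hom:
  assumes F: "is_functor C D F"
  shows "Idt (func_cat C D) F \<in> Hom (func_cat C D) F F"
proof -
  have "mk_nat C F F (\<lambda>X. Idt D (FOb F X)) \<in> Hom (func_cat C D) F F"
  proof (rule mk_nat_Hom[OF F F])
    show "Idt D (FOb F X) \<in> Hom D (FOb F X) (FOb F X)" if "X \<in> Ob C" for X
      using category.Idt_Hom[OF D] functor_Ob[OF F that] by blast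
    show "Idt D (FOb F B) \<cdot>\<^bsub>D\<^esub> FAr F f = FAr F f \<cdot>\<^bsub>D\<^esub> Idt D (FOb F A)" if "f \<in> Hom C A B" for f A B
      using category.Idt_Cmp[OF D] category.Cmp_Idt[OF D] functor_Hom[OF F that] by metis
  qed
  then show ?thesis by (simp add: mk_nat_def func_cat_def)
qed

lemma func_cat_Cmp_Hom:
  assumes \<eta>: "\<eta> \<in> Hom (func_cat C D) F G" and \<theta>: "\<theta> \<in> Hom (func_cat C D) G H"
  shows "\<theta> \<cdot>\<^bsub>func_cat C D\<^esub> \<eta> \<in> Hom (func_cat C D) F H"
proof -
  have "mk_nat C F H (\<lambda>X. NAt \<theta> X \<cdot>\<^bsub>D\<^esub> NAt \<eta> X) \<in> Hom (func_cat C D) F H"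
  proof (rule mk_nat_Hom)
    show "NAt \<theta> X \<cdot>\<^bsub>D\<^esub> NAt \<eta> X \<in> Hom D (FOb F X) (FOb H X)" if "X \<in> Ob C" for X
      using category.Cmp_Hom[OF D nat_Hom[OF \<eta> that] nat_Hom[OF \<theta> that]] .
    fix f A B assume f: "f \<in> Hom C A B"
    have A: "A \<in> Ob C" and B: "B \<in> Ob C" using category.Hom_Ob[OF C f] by auto
    note \<eta>A = nat_Hom[OF \<eta> A] and \<eta>B = nat_Hom[OF \<eta> B] and \<theta>A = nat_Hom[OF \<theta> A]
      and \<theta>B = nat_Hom[OF \<theta> B] and assoc = category.Cmp_assoc[OF D]
    note Ff = functor_Hom[OF nat_functor(1)[OF \<eta>] f] and Gf = functor_Hom[OF nat_functor(2)[OF \<eta>] f]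
      and Hf = functor_Hom[OF nat_functor(2)[OF \<theta>] f]
    show "(NAt \<theta> B \<cdot>\<^bsub>D\<^esub> NAt \<eta> B) \<cdot>\<^bsub>D\<^esub> FAr F f = FAr H f \<cdot>\<^bsub>D\<^esub> (NAt \<theta> A \<cdot>\<^bsub>D\<^esub> NAt \<eta> A)"
      using assoc[OF Ff \<eta>B \<theta>B] nat_square[OF \<eta> f] assoc[OF \<eta>A Gf \<theta>B] nat_square[OF \<theta> f]
        assoc[OF \<eta>A \<theta>A Hf] by simp
  qed (use nat_functor[OF \<eta>] nat_functor[OF \<theta>] in auto)
  moreover have "\<theta> \<cdot>\<^bsub>func_cat C D\<^esub> \<eta> = mk_nat C F H (\<lambda>X. NAt \<theta> X \<cdot>\<^bsub>D\<^esub> NAt \<eta> X)"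
    using \<eta> \<theta> by (simp add: mk_nat_def func_cat_def Hom_simp)
  ultimately show ?thesis by simp
qed

lemma func_cat_category: "category (func_cat C D)"
proof
  show "Dom (func_cat C D) \<eta> \<in> Ob (func_cat C D)" "Cod (func_cat C D) \<eta> \<in> Ob (func_cat C D)"
    if "\<eta> \<in> Ar (func_cat C D)" for \<eta>
    using that by (auto simp: is_nat_trans_def)
  show "Idt (func_cat C D) F \<in> Hom (func_cat C D) F F" if "F \<in> Ob (func_cat C D)" for F
    using that func_cat_Idt_Hom by simp
next
  fix \<eta> \<theta> F G H assume "\<eta> \<in> Hom (func_cat C D) F G" "\<theta> \<in> Hom (func_cat C D) G H"
  then show "\<theta> \<cdot>\<^bsub>func_cat C D\<^esub> \<eta> \<in> Hom (func_cat C D) F H" by (rule func_cat_Cmp_Hom)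
next
  fix \<eta> F G assume \<eta>: "\<eta> \<in> Hom (func_cat C D) F G"
  show "\<eta> \<cdot>\<^bsub>func_cat C D\<^esub> Idt (func_cat C D) F = \<eta>"
    using category.Cmp_Idt[OF D nat_Hom[OF \<eta>]]
    by (intro nat_eqI[OF func_cat_Cmp_Hom[OF func_cat_Idt_Hom \<eta>] \<eta>]) (auto intro: nat_functor[OF \<eta>])
  show "Idt (func_cat C D) G \<cdot>\<^bsub>func_cat C D\<^esub> \<eta> = \<eta>"
    using category.Idt_Cmp[OF D nat_Hom[OF \<eta>]]
    by (intro nat_eqI[OF func_cat_Cmp_Hom[OF \<eta> func_cat_Idt_Hom] \<eta>]) (auto intro: nat_functor[OF \<eta>])
next
  fix \<eta> \<theta> \<zeta> F G H K
  assume \<eta>: "\<eta> \<in> Hom (func_cat C D) F G" and \<theta>: "\<theta> \<in> Hom (func_cat C D) G H"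
    and \<zeta>: "\<zeta> \<in> Hom (func_cat C D) H K"
  show "\<zeta> \<cdot>\<^bsub>func_cat C D\<^esub> (\<theta> \<cdot>\<^bsub>func_cat C D\<^esub> \<eta>) = (\<zeta> \<cdot>\<^bsub>func_cat C D\<^esub> \<theta>) \<cdot>\<^bsub>func_cat C D\<^esub> \<eta>"
    by (rule nat_eqI[OF func_cat_Cmp_Hom[OF func_cat_Cmp_Hom[OF \<eta> \<theta>] \<zeta>]
          func_cat_Cmp_Hom[OF \<eta> func_cat_Cmp_Hom[OF \<theta> \<zeta>]]])
      (simp add: category.Cmp_assoc[OF D nat_Hom[OF \<eta>] nat_Hom[OF \<theta>] nat_Hom[OF \<zeta>]])
qed

lemma func_cat_zero_ob:
  assumes Z: "is_zero_ob D Z"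
  shows "is_zero_ob (func_cat C D) \<lparr>FOb = (\<lambda>A \<in> Ob C. Z), FAr = (\<lambda>f \<in> Ar C. Idt D Z)\<rparr>"
    (is "is_zero_ob _ ?Z")
proof -
  have zob: "Z \<in> Ob D" using Z by (simp add: is_zero_ob_def)
  note u = category.zero_ob_Hom_unique[OF D Z] and ex = category.zero_ob_Hom_exists[OF D Z]
  note cmp = category.Cmp_Hom[OF D]
  have ZF: "is_functor C D ?Z"
    unfolding is_functor_def
    using zob category.Idt_Hom[OF D zob] category.Idt_Cmp[OF D category.Idt_Hom[OF D zob]]
      category.Dom_Ob[OF C] category.Cod_Ob[OF C] category.Idt_Hom[OF C] category.Cmp_Hom[OF C]
    by (auto simp: Hom_simp)
  have "(\<exists>!\<eta>. \<eta> \<in> Hom (func_cat C D) F ?Z) \<and> (\<exists>!\<eta>. \<eta> \<in> Hom (func_cat C D) ?Z F)"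
    if F: "is_functor C D F" for F
  proof
    obtain t where t: "\<And>X. X \<in> Ob C \<Longrightarrow> t X \<in> Hom D (FOb F X) Z"
      using ex(1)[OF functor_Ob[OF F]] by metis
    have nat: "mk_nat C F ?Z t \<in> Hom (func_cat C D) F ?Z"
    proof (rule mk_nat_Hom[OF F ZF])
      fix f A B assume f: "f \<in> Hom C A B"
      have AB: "A \<in> Ob C" "B \<in> Ob C" using category.Hom_Ob[OF C f] by auto
      show "t B \<cdot>\<^bsub>D\<^esub> FAr F f = FAr ?Z f \<cdot>\<^bsub>D\<^esub> t A"
        using u(1)[OF cmp[OF functor_Hom[OF F f] t[OF AB(2)]], of "FAr ?Z f \<cdot>\<^bsub>D\<^esub> t A"]
          cmp[OF t[OF AB(1)], of "FAr ?Z f" Z] functor_Hom[OF ZF f] AB by simp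
    qed (use t in simp)
    show "\<exists>!\<eta>. \<eta> \<in> Hom (func_cat C D) F ?Z"
    proof (rule ex1I, rule nat)
      fix \<eta> assume \<eta>: "\<eta> \<in> Hom (func_cat C D) F ?Z"
      show "\<eta> = mk_nat C F ?Z t"
      proof (rule nat_eqI[OF \<eta> nat])
        fix X assume "X \<in> Ob C"
        then show "NAt \<eta> X = NAt (mk_nat C F ?Z t) X"
          using u(1)[OF _ t] nat_Hom[OF \<eta>, of X] by simp
      qed
    qed
  next
    obtain t where t: "\<And>X. X \<in> Ob C \<Longrightarrow> t X \<in> Hom D Z (FOb F X)"
      using ex(2)[OF functor_Ob[OF F]] by metis
    have nat: "mk_nat C ?Z F t \<in> Hom (func_cat C D) ?Z F"
    proof (rule mk_nat_Hom[OF ZF F])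
      fix f A B assume f: "f \<in> Hom C A B"
      have AB: "A \<in> Ob C" "B \<in> Ob C" using category.Hom_Ob[OF C f] by auto
      show "t B \<cdot>\<^bsub>D\<^esub> FAr ?Z f = FAr F f \<cdot>\<^bsub>D\<^esub> t A"
        using u(2)[OF _ cmp[OF t[OF AB(1)] functor_Hom[OF F f]], of "t B \<cdot>\<^bsub>D\<^esub> FAr ?Z f"]
          cmp[OF _ t[OF AB(2)], of "FAr ?Z f" Z] functor_Hom[OF ZF f] AB by simp
    qed (use t in simp)
    show "\<exists>!\<eta>. \<eta> \<in> Hom (func_cat C D) ?Z F"
    proof (rule ex1I, rule nat)
      fix \<eta> assume \<eta>: "\<eta> \<in> Hom (func_cat C D) ?Z F"
      show "\<eta> = mk_nat C ?Z F t"
      proof (rule nat_eqI[OF \<eta> nat])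
        fix X assume "X \<in> Ob C"
        then show "NAt \<eta> X = NAt (mk_nat C ?Z F t) X"
          using u(2)[OF _ t] nat_Hom[OF \<eta>, of X] by simp
      qed
    qed
  qed
  then show ?thesis using ZF by (simp add: is_zero_ob_def)
qed

text \<open>For the converse, factorisations chosen object by object would have to be shown natural.
  Instead a composite through the constant functor K, natural from the start, is compared with
  \<eta> at each object by uniqueness of zero arrows.\<close>

lemma func_cat_zero_ar:
  assumes Z: "is_zero_ob D Z" and \<eta>: "\<eta> \<in> Hom (func_cat C D) F G"
  shows "is_zero_ar (func_cat C D) \<eta> \<longleftrightarrow> (\<forall>X \<in> Ob C. is_zero_ar D (NAt \<eta> X))"
proof -
  define K where "K = \<lparr>FOb = (\<lambda>A \<in> Ob C. Z), FAr = (\<lambda>f \<in> Ar C. Idt D Z)\<rparr>"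
  have K: "is_zero_ob (func_cat C D) K" unfolding K_def by (rule func_cat_zero_ob[OF Z])
  have KZ: "FOb K X = Z" if "X \<in> Ob C" for X using that by (simp add: K_def)
  note cat = func_cat_category
  obtain a b where ab: "a \<in> Hom (func_cat C D) F K" "b \<in> Hom (func_cat C D) K G"
    using category.zero_ob_Hom_exists[OF cat K] nat_functor[OF \<eta>] by (metis func_cat_simps(1) mem_Collect_eq)
  have ptw: "is_zero_ar D (NAt (b' \<cdot>\<^bsub>func_cat C D\<^esub> a') X)" if "X \<in> Ob C"
    "a' \<in> Hom (func_cat C D) F K" "b' \<in> Hom (func_cat C D) K G" for X a' b'
    using category.zero_arI[OF D Z] nat_Hom[OF that(2,1)] nat_Hom[OF that(3,1)] that(1) KZ by simp
  show ?thesis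
  proof
    assume "is_zero_ar (func_cat C D) \<eta>"
    then show "\<forall>X \<in> Ob C. is_zero_ar D (NAt \<eta> X)"
      using category.zero_ar_factors[OF cat K _ \<eta>] ptw by metis
  next
    assume *: "\<forall>X \<in> Ob C. is_zero_ar D (NAt \<eta> X)"
    note ba = category.Cmp_Hom[OF cat ab]
    have "\<eta> = b \<cdot>\<^bsub>func_cat C D\<^esub> a"
      by (rule nat_eqI[OF \<eta> ba])
        (use category.zero_ar_unique[OF D] * ptw[OF _ ab] nat_Hom[OF \<eta>] nat_Hom[OF ba] in blast)
    then show "is_zero_ar (func_cat C D) \<eta>" using category.zero_arI[OF cat K ab] by simp
  qed
qed

text \<open>The factorisations t X exist object by object; the point is their naturality. For f from
  A to B, both sides of the square factor the same arrow, \<gamma> at B after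
  \<open>FAr K f\<close>, through \<eta> at B, and such factorisations are unique.\<close>

lemma func_cat_kernel:
  assumes Z: "is_zero_ob D Z"
    and \<eta>: "\<eta> \<in> Hom (func_cat C D) F G" and \<theta>: "\<theta> \<in> Hom (func_cat C D) G H"
    and ker: "\<And>X. X \<in> Ob C \<Longrightarrow> is_kernel D (NAt \<eta> X) (NAt \<theta> X)"
  shows "is_kernel (func_cat C D) \<eta> \<theta>"
  unfolding is_kernel_def
proof (intro conjI allI ballI impI)
  note cat = func_cat_category and cmp = category.Cmp_Hom[OF D] and assoc = category.Cmp_assoc[OF D]
  have DC: "\<eta> \<in> Ar (func_cat C D)" "\<theta> \<in> Ar (func_cat C D)" "NDom \<eta> = F" "NCod \<eta> = G" "NDom \<theta> = G"
    using \<eta> \<theta> by (auto simp: Hom_simp)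
  then show "\<theta> \<in> Ar (func_cat C D)" "\<eta> \<in> Ar (func_cat C D)"
    "Cod (func_cat C D) \<eta> = Dom (func_cat C D) \<theta>" by simp_all
  show "is_zero_ar (func_cat C D) (\<theta> \<cdot>\<^bsub>func_cat C D\<^esub> \<eta>)"
    unfolding func_cat_zero_ar[OF Z category.Cmp_Hom[OF cat \<eta> \<theta>]] using ker by (simp add: is_kernel_def)
  have fac: "\<exists>!h. h \<in> Hom D Y (FOb F X) \<and> NAt \<eta> X \<cdot>\<^bsub>D\<^esub> h = g"
    if "X \<in> Ob C" "g \<in> Hom D Y (FOb G X)" "is_zero_ar D (NAt \<theta> X \<cdot>\<^bsub>D\<^esub> g)" for X Y g
    using ker[OF that(1)] that nat_Hom[OF \<eta> that(1)] nat_Hom[OF \<theta> that(1)]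
    unfolding is_kernel_def by (simp add: Hom_simp)
  fix K \<gamma> assume "\<gamma> \<in> Hom (func_cat C D) K (Dom (func_cat C D) \<theta>)"
    and \<gamma>0: "is_zero_ar (func_cat C D) (\<theta> \<cdot>\<^bsub>func_cat C D\<^esub> \<gamma>)"
  then have \<gamma>: "\<gamma> \<in> Hom (func_cat C D) K G" using DC by simp
  have z: "is_zero_ar D (NAt \<theta> X \<cdot>\<^bsub>D\<^esub> NAt \<gamma> X)" if "X \<in> Ob C" for X
    using func_cat_zero_ar[OF Z category.Cmp_Hom[OF cat \<gamma> \<theta>]] \<gamma>0 that by simp
  have "\<exists>h. h \<in> Hom D (FOb K X) (FOb F X) \<and> NAt \<eta> X \<cdot>\<^bsub>D\<^esub> h = NAt \<gamma> X" if "X \<in> Ob C" for X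
    using fac[OF that nat_Hom[OF \<gamma> that] z[OF that]] by blast
  then obtain t where t: "\<And>X. X \<in> Ob C \<Longrightarrow> t X \<in> Hom D (FOb K X) (FOb F X)"
    "\<And>X. X \<in> Ob C \<Longrightarrow> NAt \<eta> X \<cdot>\<^bsub>D\<^esub> t X = NAt \<gamma> X" by metis
  have nat: "mk_nat C K F t \<in> Hom (func_cat C D) K F"
  proof (rule mk_nat_Hom[OF nat_functor(1)[OF \<gamma>] nat_functor(1)[OF \<eta>] t(1)])
    fix f A B assume f: "f \<in> Hom C A B"
    have A: "A \<in> Ob C" and B: "B \<in> Ob C" using category.Hom_Ob[OF C f] by auto
    note Kf = functor_Hom[OF nat_functor(1)[OF \<gamma>] f] and Ff = functor_Hom[OF nat_functor(1)[OF \<eta>] f]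
      and Gf = functor_Hom[OF nat_functor(2)[OF \<eta>] f]
    have 1: "NAt \<eta> B \<cdot>\<^bsub>D\<^esub> (t B \<cdot>\<^bsub>D\<^esub> FAr K f) = NAt \<gamma> B \<cdot>\<^bsub>D\<^esub> FAr K f"
      using assoc[OF Kf t(1)[OF B] nat_Hom[OF \<eta> B]] t(2)[OF B] by simp
    have 2: "NAt \<eta> B \<cdot>\<^bsub>D\<^esub> (FAr F f \<cdot>\<^bsub>D\<^esub> t A) = NAt \<gamma> B \<cdot>\<^bsub>D\<^esub> FAr K f"
      using assoc[OF t(1)[OF A] Ff nat_Hom[OF \<eta> B]] nat_square[OF \<eta> f] nat_square[OF \<gamma> f]
        assoc[OF t(1)[OF A] nat_Hom[OF \<eta> A] Gf] t(2)[OF A] by simp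
    \<comment> \<open>The uniqueness in \<open>fac\<close> is available only for arrows that
      \<theta> kills.\<close>
    have "is_zero_ar D (NAt \<theta> B \<cdot>\<^bsub>D\<^esub> (NAt \<gamma> B \<cdot>\<^bsub>D\<^esub> FAr K f))"
      using category.zero_ar_Cmp(2)[OF D z[OF B] cmp[OF nat_Hom[OF \<gamma> B] nat_Hom[OF \<theta> B]] Kf]
        assoc[OF Kf nat_Hom[OF \<gamma> B] nat_Hom[OF \<theta> B]] by simp
    then show "t B \<cdot>\<^bsub>D\<^esub> FAr K f = FAr F f \<cdot>\<^bsub>D\<^esub> t A"
      using fac[OF B cmp[OF Kf nat_Hom[OF \<gamma> B]]] 1 2 cmp[OF Kf t(1)[OF B]] cmp[OF t(1)[OF A] Ff] by blast
  qed
  have "\<exists>!h. h \<in> Hom (func_cat C D) K F \<and> \<eta> \<cdot>\<^bsub>func_cat C D\<^esub> h = \<gamma>"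
  proof (rule ex1I)
    show "mk_nat C K F t \<in> Hom (func_cat C D) K F \<and> \<eta> \<cdot>\<^bsub>func_cat C D\<^esub> mk_nat C K F t = \<gamma>"
      using nat t(2) nat_eqI[OF category.Cmp_Hom[OF cat nat \<eta>] \<gamma>] by simp
    fix h assume h: "h \<in> Hom (func_cat C D) K F \<and> \<eta> \<cdot>\<^bsub>func_cat C D\<^esub> h = \<gamma>"
    show "h = mk_nat C K F t"
    proof (rule nat_eqI[OF conjunct1[OF h] nat])
      fix X assume X: "X \<in> Ob C"
      have "NAt \<eta> X \<cdot>\<^bsub>D\<^esub> NAt h X = NAt \<gamma> X" using h X NAt_Cmp by metis
      then show "NAt h X = NAt (mk_nat C K F t) X"
        using fac[OF X nat_Hom[OF \<gamma> X] z[OF X]] t[OF X] nat_Hom[OF conjunct1[OF h] X] X NAt_mk_nat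
        by metis
    qed
  qed
  then show "\<exists>!h. h \<in> Hom (func_cat C D) K (Dom (func_cat C D) \<eta>) \<and> \<eta> \<cdot>\<^bsub>func_cat C D\<^esub> h = \<gamma>"
    using DC by simp
qed

text \<open>Dual to the kernel: here naturality at f from A to B is tested after precomposition with
  \<theta> at the source A, where factorisations are unique.\<close>

lemma func_cat_cokernel:
  assumes Z: "is_zero_ob D Z"
    and \<eta>: "\<eta> \<in> Hom (func_cat C D) F G" and \<theta>: "\<theta> \<in> Hom (func_cat C D) G H"
    and coker: "\<And>X. X \<in> Ob C \<Longrightarrow> is_cokernel D (NAt \<theta> X) (NAt \<eta> X)"
  shows "is_cokernel (func_cat C D) \<theta> \<eta>"
  unfolding is_cokernel_def
proof (intro conjI allI ballI impI)
  note cat = func_cat_category and cmp = category.Cmp_Hom[OF D] and assoc = category.Cmp_assoc[OF D]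
  have DC: "\<eta> \<in> Ar (func_cat C D)" "\<theta> \<in> Ar (func_cat C D)" "NCod \<theta> = H" "NCod \<eta> = G" "NDom \<theta> = G"
    using \<eta> \<theta> by (auto simp: Hom_simp)
  then show "\<theta> \<in> Ar (func_cat C D)" "\<eta> \<in> Ar (func_cat C D)"
    "Dom (func_cat C D) \<theta> = Cod (func_cat C D) \<eta>" by simp_all
  show "is_zero_ar (func_cat C D) (\<theta> \<cdot>\<^bsub>func_cat C D\<^esub> \<eta>)"
    unfolding func_cat_zero_ar[OF Z category.Cmp_Hom[OF cat \<eta> \<theta>]] using coker by (simp add: is_cokernel_def)
  have fac: "\<exists>!h. h \<in> Hom D (FOb H X) Y \<and> h \<cdot>\<^bsub>D\<^esub> NAt \<theta> X = g"
    if "X \<in> Ob C" "g \<in> Hom D (FOb G X) Y" "is_zero_ar D (g \<cdot>\<^bsub>D\<^esub> NAt \<eta> X)" for X Y g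
    using coker[OF that(1)] that nat_Hom[OF \<eta> that(1)] nat_Hom[OF \<theta> that(1)]
    unfolding is_cokernel_def by (simp add: Hom_simp)
  fix K \<gamma> assume "\<gamma> \<in> Hom (func_cat C D) (Cod (func_cat C D) \<eta>) K"
    and \<gamma>0: "is_zero_ar (func_cat C D) (\<gamma> \<cdot>\<^bsub>func_cat C D\<^esub> \<eta>)"
  then have \<gamma>: "\<gamma> \<in> Hom (func_cat C D) G K" using DC by simp
  have z: "is_zero_ar D (NAt \<gamma> X \<cdot>\<^bsub>D\<^esub> NAt \<eta> X)" if "X \<in> Ob C" for X
    using func_cat_zero_ar[OF Z category.Cmp_Hom[OF cat \<eta> \<gamma>]] \<gamma>0 that by simp
  have "\<exists>h. h \<in> Hom D (FOb H X) (FOb K X) \<and> h \<cdot>\<^bsub>D\<^esub> NAt \<theta> X = NAt \<gamma> X" if "X \<in> Ob C" for X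
    using fac[OF that nat_Hom[OF \<gamma> that] z[OF that]] by blast
  then obtain t where t: "\<And>X. X \<in> Ob C \<Longrightarrow> t X \<in> Hom D (FOb H X) (FOb K X)"
    "\<And>X. X \<in> Ob C \<Longrightarrow> t X \<cdot>\<^bsub>D\<^esub> NAt \<theta> X = NAt \<gamma> X" by metis
  have nat: "mk_nat C H K t \<in> Hom (func_cat C D) H K"
  proof (rule mk_nat_Hom[OF nat_functor(2)[OF \<theta>] nat_functor(2)[OF \<gamma>] t(1)])
    fix f A B assume f: "f \<in> Hom C A B"
    have A: "A \<in> Ob C" and B: "B \<in> Ob C" using category.Hom_Ob[OF C f] by auto
    note Kf = functor_Hom[OF nat_functor(2)[OF \<gamma>] f] and Hf = functor_Hom[OF nat_functor(2)[OF \<theta>] f]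
      and Gf = functor_Hom[OF nat_functor(2)[OF \<eta>] f]
    have 1: "(FAr K f \<cdot>\<^bsub>D\<^esub> t A) \<cdot>\<^bsub>D\<^esub> NAt \<theta> A = FAr K f \<cdot>\<^bsub>D\<^esub> NAt \<gamma> A"
      using assoc[OF nat_Hom[OF \<theta> A] t(1)[OF A] Kf] t(2)[OF A] by simp
    have 2: "(t B \<cdot>\<^bsub>D\<^esub> FAr H f) \<cdot>\<^bsub>D\<^esub> NAt \<theta> A = FAr K f \<cdot>\<^bsub>D\<^esub> NAt \<gamma> A"
      using assoc[OF nat_Hom[OF \<theta> A] Hf t(1)[OF B]] nat_square[OF \<theta> f] nat_square[OF \<gamma> f]
        assoc[OF Gf nat_Hom[OF \<theta> B] t(1)[OF B]] t(2)[OF B] by simp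
    have "is_zero_ar D ((FAr K f \<cdot>\<^bsub>D\<^esub> NAt \<gamma> A) \<cdot>\<^bsub>D\<^esub> NAt \<eta> A)"
      using category.zero_ar_Cmp(1)[OF D z[OF A] cmp[OF nat_Hom[OF \<eta> A] nat_Hom[OF \<gamma> A]] Kf]
        assoc[OF nat_Hom[OF \<eta> A] nat_Hom[OF \<gamma> A] Kf] by simp
    then show "t B \<cdot>\<^bsub>D\<^esub> FAr H f = FAr K f \<cdot>\<^bsub>D\<^esub> t A"
      using fac[OF A cmp[OF nat_Hom[OF \<gamma> A] Kf]] 1 2 cmp[OF Hf t(1)[OF B]] cmp[OF t(1)[OF A] Kf] by blast
  qed
  have "\<exists>!h. h \<in> Hom (func_cat C D) H K \<and> h \<cdot>\<^bsub>func_cat C D\<^esub> \<theta> = \<gamma>"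
  proof (rule ex1I)
    show "mk_nat C H K t \<in> Hom (func_cat C D) H K \<and> mk_nat C H K t \<cdot>\<^bsub>func_cat C D\<^esub> \<theta> = \<gamma>"
      using nat t(2) nat_eqI[OF category.Cmp_Hom[OF cat \<theta> nat] \<gamma>] by simp
    fix h assume h: "h \<in> Hom (func_cat C D) H K \<and> h \<cdot>\<^bsub>func_cat C D\<^esub> \<theta> = \<gamma>"
    show "h = mk_nat C H K t"
    proof (rule nat_eqI[OF conjunct1[OF h] nat])
      fix X assume X: "X \<in> Ob C"
      have "NAt h X \<cdot>\<^bsub>D\<^esub> NAt \<theta> X = NAt \<gamma> X" using h X NAt_Cmp by metis
      then show "NAt h X = NAt (mk_nat C H K t) X"
        using fac[OF X nat_Hom[OF \<gamma> X] z[OF X]] t[OF X] nat_Hom[OF conjunct1[OF h] X] X NAt_mk_nat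
        by metis
    qed
  qed
  then show "\<exists>!h. h \<in> Hom (func_cat C D) (Cod (func_cat C D) \<theta>) K \<and> h \<cdot>\<^bsub>func_cat C D\<^esub> \<theta> = \<gamma>"
    using DC by simp
qed

text \<open>The given p X and j X are kept on the nose, so that data chosen at a vertex are still
  recognisable after passing to \<open>Rep\<close> and from there to \<open>End\<close>.
  Functoriality of P and naturality of the induced maps are equations between arrows out of p X,
  hence tested on the inclusions.\<close>

lemma func_cat_coproduct:
  assumes A: "\<And>i. i \<in> I \<Longrightarrow> is_functor C D (A i)"
    and pj: "\<And>X. X \<in> Ob C \<Longrightarrow> is_coproduct D I (\<lambda>i. FOb (A i) X) (p X) (j X)"
  shows "\<exists>P \<iota>. is_coproduct (func_cat C D) I A P \<iota> \<and>
    (\<forall>X \<in> Ob C. FOb P X = p X \<and> (\<forall>i. NAt (\<iota> i) X = j X i))"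
proof -
  note cmp = category.Cmp_Hom[OF D] and assoc = category.Cmp_assoc[OF D]
  note j = category.coproduct_in[OF D pj] and eqI = category.coproduct_eqI[OF D pj]
  \<comment> \<open>The relation singles out the arrow induced on coproducts by the maps
    \<open>FAr (A i) f\<close>; naming it lets \<open>SOME\<close> pick a value for each f
    separately.\<close>
  define act where "act f h \<longleftrightarrow> h \<in> Hom D (p (Dom C f)) (p (Cod C f)) \<and>
    (\<forall>i\<in>I. h \<cdot>\<^bsub>D\<^esub> j (Dom C f) i = j (Cod C f) i \<cdot>\<^bsub>D\<^esub> FAr (A i) f)" for f h
  have act_ex: "\<exists>h. act f h" if f: "f \<in> Ar C" for f
    unfolding act_def
  proof (rule category.coproduct_desc[OF D pj])
    show "Dom C f \<in> Ob C" "p (Cod C f) \<in> Ob D"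
      using category.coproduct_Ob[OF D pj] category.Dom_Ob[OF C f] category.Cod_Ob[OF C f] by auto
    show "j (Cod C f) i \<cdot>\<^bsub>D\<^esub> FAr (A i) f \<in> Hom D (FOb (A i) (Dom C f)) (p (Cod C f))" if "i \<in> I" for i
      using cmp[OF functor_Hom[OF A[OF that], of f "Dom C f" "Cod C f"] j[OF _ that]]
        category.Cod_Ob[OF C f] f by (simp add: Hom_simp)
  qed
  define m where "m f = (SOME h. act f h)" for f
  have m: "m f \<in> Hom D (p X) (p Y)" "i \<in> I \<Longrightarrow> m f \<cdot>\<^bsub>D\<^esub> j X i = j Y i \<cdot>\<^bsub>D\<^esub> FAr (A i) f"
    if "f \<in> Hom C X Y" for f X Y i
  proof -
    have "act f (m f)"
      unfolding m_def by (rule someI_ex, rule act_ex) (use that in \<open>simp add: Hom_simp\<close>)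
    then show "m f \<in> Hom D (p X) (p Y)" "i \<in> I \<Longrightarrow> m f \<cdot>\<^bsub>D\<^esub> j X i = j Y i \<cdot>\<^bsub>D\<^esub> FAr (A i) f"
      using that unfolding act_def by (simp_all add: Hom_simp)
  qed
  define P where "P = \<lparr>FOb = (\<lambda>X \<in> Ob C. p X), FAr = (\<lambda>f \<in> Ar C. m f)\<rparr>"
  have Pp: "FOb P X = p X" if "X \<in> Ob C" for X using that by (simp add: P_def)
  have Pm: "FAr P f = m f" if "f \<in> Hom C X Y" for f X Y using that by (simp add: P_def Hom_simp)
  have P: "is_functor C D P"
    unfolding is_functor_def
  proof (intro conjI ballI impI)
    show "FOb P \<in> Ob C \<rightarrow>\<^sub>E Ob D" using category.coproduct_Ob[OF D pj] by (auto simp: P_def)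
    show "FAr P \<in> extensional (Ar C)" by (simp add: P_def)
    show "FAr P f \<in> Hom D (FOb P (Dom C f)) (FOb P (Cod C f))" if "f \<in> Ar C" for f
      using m(1)[of f "Dom C f" "Cod C f"] that category.Dom_Ob[OF C that] category.Cod_Ob[OF C that]
      by (simp add: P_def Hom_simp)
  next
    fix X assume X: "X \<in> Ob C"
    note iX = category.Idt_Hom[OF C X]
    have "m (Idt C X) = Idt D (p X)"
    proof (rule eqI[OF X m(1)[OF iX]])
      show "Idt D (p X) \<in> Hom D (p X) (p X)"
        using category.Idt_Hom[OF D category.coproduct_Ob[OF D pj[OF X]]] .
      show "m (Idt C X) \<cdot>\<^bsub>D\<^esub> j X i = Idt D (p X) \<cdot>\<^bsub>D\<^esub> j X i" if i: "i \<in> I" for i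
        using m(2)[OF iX i] functor_Idt[OF A[OF i] X] category.Cmp_Idt[OF D j[OF X i]]
          category.Idt_Cmp[OF D j[OF X i]] by simp
    qed
    then show "FAr P (Idt C X) = Idt D (FOb P X)" using Pp[OF X] Pm[OF iX] by simp
  next
    fix f g assume "f \<in> Ar C" "g \<in> Ar C" "Cod C f = Dom C g"
    then obtain X Y Z where f: "f \<in> Hom C X Y" and g: "g \<in> Hom C Y Z" by (auto simp: Hom_simp)
    note gf = category.Cmp_Hom[OF C f g]
    have obs: "X \<in> Ob C" "Y \<in> Ob C" "Z \<in> Ob C" using category.Hom_Ob[OF C] f g by auto
    have "m (g \<cdot>\<^bsub>C\<^esub> f) = m g \<cdot>\<^bsub>D\<^esub> m f"
    proof (rule eqI[OF obs(1) m(1)[OF gf] cmp[OF m(1)[OF f] m(1)[OF g]]])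
      fix i assume i: "i \<in> I"
      note Af = functor_Hom[OF A[OF i] f] and Ag = functor_Hom[OF A[OF i] g]
      show "m (g \<cdot>\<^bsub>C\<^esub> f) \<cdot>\<^bsub>D\<^esub> j X i = (m g \<cdot>\<^bsub>D\<^esub> m f) \<cdot>\<^bsub>D\<^esub> j X i"
        using m(2)[OF gf i] functor_Cmp[OF A[OF i] f g] assoc[OF Af Ag j[OF obs(3) i]] m(2)[OF g i]
          assoc[OF Af j[OF obs(2) i] m(1)[OF g]] m(2)[OF f i] assoc[OF j[OF obs(1) i] m(1)[OF f] m(1)[OF g]]
        by simp
    qed
    then show "FAr P (g \<cdot>\<^bsub>C\<^esub> f) = FAr P g \<cdot>\<^bsub>D\<^esub> FAr P f" using Pm f g gf by simp
  qed
  define \<iota> where "\<iota> i = mk_nat C (A i) P (\<lambda>X. j X i)" for i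
  have \<iota>: "\<iota> i \<in> Hom (func_cat C D) (A i) P" if i: "i \<in> I" for i
    unfolding \<iota>_def
    by (rule mk_nat_Hom[OF A[OF i] P])
      (use j Pp Pm m(2) i category.Hom_Ob[OF C] in auto)
  have ptw: "is_coproduct D I (\<lambda>i. FOb (A i) X) (FOb P X) (\<lambda>i. NAt (\<iota> i) X)" if "X \<in> Ob C" for X
    using pj[OF that] Pp[OF that] that by (simp add: \<iota>_def)
  have "is_coproduct (func_cat C D) I A P \<iota>"
  proof (rule category.coproductI[OF func_cat_category])
    fix F g assume F: "F \<in> Ob (func_cat C D)" and g: "\<And>i. i \<in> I \<Longrightarrow> g i \<in> Hom (func_cat C D) (A i) F"
    then have F: "is_functor C D F" by simp
    have "\<exists>h. h \<in> Hom D (p X) (FOb F X) \<and> (\<forall>i\<in>I. h \<cdot>\<^bsub>D\<^esub> j X i = NAt (g i) X)" if "X \<in> Ob C" for X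
      using category.coproduct_desc[OF D pj[OF that] functor_Ob[OF F that], of "\<lambda>i. NAt (g i) X"]
        nat_Hom[OF g that] by simp
    then obtain t where t: "\<And>X. X \<in> Ob C \<Longrightarrow> t X \<in> Hom D (p X) (FOb F X)"
      "\<And>X i. \<lbrakk>X \<in> Ob C; i \<in> I\<rbrakk> \<Longrightarrow> t X \<cdot>\<^bsub>D\<^esub> j X i = NAt (g i) X" by (metis (no_types))
    have nat: "mk_nat C P F t \<in> Hom (func_cat C D) P F"
    proof (rule mk_nat_Hom[OF P F])
      show "t X \<in> Hom D (FOb P X) (FOb F X)" if "X \<in> Ob C" for X using t(1) Pp that by simp
      fix f X Y assume f: "f \<in> Hom C X Y"
      have X: "X \<in> Ob C" and Y: "Y \<in> Ob C" using category.Hom_Ob[OF C f] by auto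
      note Ff = functor_Hom[OF F f]
      have "t Y \<cdot>\<^bsub>D\<^esub> m f = FAr F f \<cdot>\<^bsub>D\<^esub> t X"
      proof (rule eqI[OF X cmp[OF m(1)[OF f] t(1)[OF Y]] cmp[OF t(1)[OF X] Ff]])
        fix i assume i: "i \<in> I"
        show "(t Y \<cdot>\<^bsub>D\<^esub> m f) \<cdot>\<^bsub>D\<^esub> j X i = (FAr F f \<cdot>\<^bsub>D\<^esub> t X) \<cdot>\<^bsub>D\<^esub> j X i"
          using assoc[OF j[OF X i] m(1)[OF f] t(1)[OF Y]] m(2)[OF f i] t(2)[OF Y i] t(2)[OF X i]
            assoc[OF functor_Hom[OF A[OF i] f] j[OF Y i] t(1)[OF Y]] nat_square[OF g[OF i] f]
            assoc[OF j[OF X i] t(1)[OF X] Ff] by simp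
      qed
      then show "t Y \<cdot>\<^bsub>D\<^esub> FAr P f = FAr F f \<cdot>\<^bsub>D\<^esub> t X" using Pm[OF f] by simp
    qed
    have "mk_nat C P F t \<cdot>\<^bsub>func_cat C D\<^esub> \<iota> i = g i" if i: "i \<in> I" for i
      by (rule nat_eqI[OF func_cat_Cmp_Hom[OF \<iota>[OF i] nat] g[OF i]]) (simp add: \<iota>_def t(2) i)
    then show "\<exists>h. h \<in> Hom (func_cat C D) P F \<and> (\<forall>i\<in>I. h \<cdot>\<^bsub>func_cat C D\<^esub> \<iota> i = g i)"
      using nat by blast
  next
    fix F g h assume g: "g \<in> Hom (func_cat C D) P F" and h: "h \<in> Hom (func_cat C D) P F"
      and gh: "\<And>i. i \<in> I \<Longrightarrow> g \<cdot>\<^bsub>func_cat C D\<^esub> \<iota> i = h \<cdot>\<^bsub>func_cat C D\<^esub> \<iota> i"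
    show "g = h"
    proof (rule nat_eqI[OF g h], rule category.coproduct_eqI[OF D ptw])
      fix X i assume "X \<in> Ob C" "i \<in> I"
      then show "NAt g X \<cdot>\<^bsub>D\<^esub> NAt (\<iota> i) X = NAt h X \<cdot>\<^bsub>D\<^esub> NAt (\<iota> i) X" using gh NAt_Cmp by metis
    qed (use nat_Hom g h in auto)
  qed (use P \<iota> in auto)
  then show ?thesis using Pp
    by (intro exI[of _ P] exI[of _ \<iota>]) (simp add: \<iota>_def)
qed

end

section \<open>Composite and identity functors\<close>

lemma comp_func_functor:
  assumes F: "is_functor C D F" and G: "is_functor D E G"
    and C: "category C" and D: "category D"
  shows "is_functor C E (comp_func C G F)"
  unfolding is_functor_def
proof (intro conjI ballI impI)
  show "FOb (comp_func C G F) \<in> Ob C \<rightarrow>\<^sub>E Ob E"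
    using functor_Ob[OF F] functor_Ob[OF G] by (auto simp: comp_func_def)
  show "FAr (comp_func C G F) \<in> extensional (Ar C)" by (simp add: comp_func_def)
  show "FAr (comp_func C G F) f \<in> Hom E (FOb (comp_func C G F) (Dom C f)) (FOb (comp_func C G F) (Cod C f))"
    if f: "f \<in> Ar C" for f
    using functor_Hom[OF G functor_Hom[OF F, of f "Dom C f" "Cod C f"]] f
      category.Dom_Ob[OF C f] category.Cod_Ob[OF C f] by (simp add: comp_func_def Hom_simp)
  show "FAr (comp_func C G F) (Idt C A) = Idt E (FOb (comp_func C G F) A)" if A: "A \<in> Ob C" for A
    using functor_Idt[OF F A] functor_Idt[OF G functor_Ob[OF F A]] category.Idt_Hom[OF C A] A
    by (simp add: comp_func_def Hom_simp)
  fix f g assume "f \<in> Ar C" "g \<in> Ar C" "Cod C f = Dom C g"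
  then obtain X Y Z where f: "f \<in> Hom C X Y" and g: "g \<in> Hom C Y Z" by (auto simp: Hom_simp)
  show "FAr (comp_func C G F) (g \<cdot>\<^bsub>C\<^esub> f) = FAr (comp_func C G F) g \<cdot>\<^bsub>E\<^esub> FAr (comp_func C G F) f"
    using functor_Cmp[OF F f g] functor_Cmp[OF G functor_Hom[OF F f] functor_Hom[OF F g]]
      category.Cmp_Hom[OF C f g] f g by (simp add: comp_func_def Hom_simp)
qed

lemma id_functor: "category C \<Longrightarrow> is_functor C C (id_func C)"
  unfolding is_functor_def id_func_def
  using category.Dom_Ob category.Cod_Ob category.Idt_Hom category.Cmp_Hom
  by (fastforce simp: Hom_simp)

section \<open>Free representations of a quiver\<close>

text \<open>Either the supremum is already a strict bound or its successor is taken. This strictness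
  is what turns \<open>ltccn Q \<le>o \<kappa>\<close> into the strict inequality that
  \<open>AB3\<close> asks for.\<close>

lemma card_size_greater:
  assumes "r \<in> X" and X: "\<And>r. r \<in> X \<Longrightarrow> Card_order r"
  shows "r <o card_size X"
proof -
  have sup: "Card_order (card_sup X)" "r \<le>o card_sup X"
    using card_sup_exists[OF X] assms(1) by (auto simp: is_card_sup_def)
  show ?thesis
  proof (cases "\<forall>r\<in>X. r <o card_sup X")
    case True
    \<comment> \<open>In this case \<open>card_size X\<close> is the copy of the supremum along
      singletons, and the strict bound has to be carried over to the copy.\<close>
    have "|(\<lambda>x. {x}) ` Field (card_sup X)| =o |Field (card_sup X)|"
      using card_of_ordIso bij_betw_imageI[of "\<lambda>x. {x}" "Field (card_sup X)"] ordIso_symmetric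
      by (metis inj_onI singleton_inject)
    then have "card_sup X =o |(\<lambda>x. {x}) ` Field (card_sup X)|"
      using card_of_Field_ordIso[OF sup(1)] ordIso_transitive ordIso_symmetric by blast
    then show ?thesis using True assms(1) ordLess_ordIso_trans by (auto simp: card_size_def)
  next
    case False
    then show ?thesis
      using sup cardSuc_greater[OF sup(1)] ordLeq_ordLess_trans by (auto simp: card_size_def)
  qed
qed

section \<open>The path category and the number of its paths\<close>

lemma path_cat_simps [simp]:
  "Ob (path_cat Q) = verts Q"
  "Dom (path_cat Q) (i, p, j) = i"
  "Cod (path_cat Q) (i, p, j) = j"
  "Idt (path_cat Q) i = (i, [], i)"
  "(j, q, k) \<cdot>\<^bsub>path_cat Q\<^esub> (i, p, j') = (i, p @ q, k)"
  by (simp_all add: path_cat_def)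

lemma paths_iff: "x \<in> paths Q i j \<longleftrightarrow> (\<exists>p. x = (i, p, j) \<and> pre_digraph.awalk Q i p j)"
  by (cases x) (auto simp: Hom_simp path_cat_def)

context wf_digraph
begin

lemma path_cat_category: "category (path_cat G)"
proof
  show "Dom (path_cat G) x \<in> Ob (path_cat G)" "Cod (path_cat G) x \<in> Ob (path_cat G)"
    if "x \<in> Ar (path_cat G)" for x
    using that by (auto simp: path_cat_def)
  show "Idt (path_cat G) i \<in> paths G i i" if "i \<in> Ob (path_cat G)" for i
    using that by (simp add: paths_iff awalk_Nil_iff)
  show "y \<cdot>\<^bsub>path_cat G\<^esub> x \<in> paths G i k" if "x \<in> paths G i j" "y \<in> paths G j k" for x y i j k
    using that by (auto simp: paths_iff)
qed (auto simp: paths_iff)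

lemma arc_path: "e \<in> arcs G \<Longrightarrow> (tail G e, [e], head G e) \<in> paths G (tail G e) (head G e)"
  by (simp add: paths_iff arc_implies_awalk)

text \<open>Arrows are listed in the order in which they are traversed, so recursion on the list
  removes the first arrow of the path. \<open>retraction\<close> and the inductions about it run
  along this cut.\<close>

lemma Cons_path:
  "(i, e # p, j) \<in> paths G i j \<longleftrightarrow> e \<in> arcs G \<and> i = tail G e \<and> (head G e, p, j) \<in> paths G (head G e) j"
  by (auto simp: paths_iff awalk_Cons_iff)

lemma paths_to_card:
  assumes "ltccn G \<le>o \<kappa>" "j \<in> verts G"
  shows "|paths_to G j| <o \<kappa>"
proof -
  have "|paths_to G j| <o ltccn G"
    unfolding ltccn_def using assms(2) by (intro card_size_greater) (auto simp: card_of_Card_order)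
  then show ?thesis using assms(1) by (rule ordLess_ordLeq_trans)
qed

end

locale quiver_representations =
  Q: wf_digraph Q + preadditive_category C G
  for Q :: "('v, 'a) pre_digraph" and C :: "('o, 'm) cat" (structure) and G +
  fixes \<kappa> :: "'k rel"
  assumes \<kappa>: "Card_order \<kappa>" and ltccn: "ltccn Q \<le>o \<kappa>" and AB3: "AB3 \<kappa> C"
begin

section \<open>Representations, copowers and free representations\<close>

lemma Ob_Rep: "F \<in> Ob (Rep Q C) \<longleftrightarrow> is_functor (path_cat Q) C F"
  by (simp add: Rep_def)

lemmas rep_Ob = functor_Ob[of "path_cat Q" C, folded Ob_Rep, simplified]
  and rep_Hom = functor_Hom[of "path_cat Q" C, folded Ob_Rep]
  and rep_Cmp = functor_Cmp[of "path_cat Q" C, folded Ob_Rep]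
  and rep_mor_Hom = nat_Hom[of _ "path_cat Q" C, folded Rep_def, simplified]
  and rep_mor_square = nat_square[of _ "path_cat Q" C, folded Rep_def]
  and rep_mor_eqI = nat_eqI[of _ "path_cat Q" C, folded Rep_def, simplified]
  and Rep_category = func_cat_category[OF Q.path_cat_category category_axioms, folded Rep_def]
  and mk_rep_mor_Hom = mk_nat_Hom[OF Q.path_cat_category category_axioms, folded Rep_def Ob_Rep, simplified]

lemma rep_Idt: "F \<in> Ob (Rep Q C) \<Longrightarrow> i \<in> verts Q \<Longrightarrow> FAr F (i, [], i) = Idt C (FOb F i)"
  using functor_Idt[of "path_cat Q" C F i] by (simp add: Ob_Rep)

lemma rep_NAt_Cmp: "k \<in> verts Q \<Longrightarrow> NAt (\<theta> \<cdot>\<^bsub>Rep Q C\<^esub> \<eta>) k = NAt \<theta> k \<cdot> NAt \<eta> k"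
  by (simp add: Rep_def)

lemma rep_NAt_Idt: "k \<in> verts Q \<Longrightarrow> NAt (Idt (Rep Q C) F) k = Idt C (FOb F k)"
  by (simp add: Rep_def)

lemma paths_verts: "p \<in> paths Q i j \<Longrightarrow> i \<in> verts Q" "p \<in> paths Q i j \<Longrightarrow> j \<in> verts Q"
  using category.Hom_Ob[OF Q.path_cat_category] by simp_all

text \<open>Every coproduct formed at a vertex k has an index set that injects into the paths ending
  at k. Bounding X by those paths confines the comparison with \<kappa> to this lemma.\<close>

lemma coproduct_exists:
  assumes "k \<in> verts Q" "|X| \<le>o |paths_to Q k|" "\<And>x. x \<in> X \<Longrightarrow> A x \<in> Ob C"
  shows "\<exists>P \<iota>. is_coproduct C X A P \<iota>"
  by (rule AB3_coproduct[OF AB3 \<kappa> ordLeq_ordLess_trans[OF assms(2) Q.paths_to_card[OF ltccn assms(1)]] assms(3)])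

text \<open>Justifies the choice made in \<open>copower\<close>: the paths from i to j are among
  those ending at j, so a coproduct exists for \<open>SOME\<close> to pick.\<close>

lemma copower_coproduct:
  assumes A: "A \<in> Ob C" and ij: "i \<in> verts Q" "j \<in> verts Q"
  shows "is_coproduct C (paths Q i j) (\<lambda>_. A) (copow C A (paths Q i j)) (copow_in C A (paths Q i j))"
proof -
  have "|paths Q i j| \<le>o |paths_to Q j|"
    using ij by (intro card_of_mono1) (auto simp: paths_to_def)
  then have "\<exists>x. case x of (P, \<iota>) \<Rightarrow> is_coproduct C (paths Q i j) (\<lambda>_. A) P \<iota>"
    using coproduct_exists[OF ij(2), of "paths Q i j" "\<lambda>_. A"] A by auto
  then have "case copower C A (paths Q i j) of (P, \<iota>) \<Rightarrow> is_coproduct C (paths Q i j) (\<lambda>_. A) P \<iota>"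
    unfolding copower_def by (rule someI_ex)
  then show ?thesis by (simp add: case_prod_beta)
qed

lemma copow_in_Hom:
  "\<lbrakk>A \<in> Ob C; \<rho> \<in> paths Q i j\<rbrakk> \<Longrightarrow> copow_in C A (paths Q i j) \<rho> \<in> Hom C A (copow C A (paths Q i j))"
  using coproduct_in[OF copower_coproduct] paths_verts by blast

lemma FOb_free_rep [simp]: "j \<in> verts Q \<Longrightarrow> FOb (free_rep Q C i A) j = copow C A (paths Q i j)"
  by (simp add: free_rep_def)

text \<open>Gives access to the \<open>THE\<close> descriptions inside \<open>free_rep\<close> and
  \<open>free_rep_mor\<close>, which are instances of the universal property and thus have exactly
  one solution.\<close>

lemma coproduct_the:
  assumes "is_coproduct C I A P \<iota>" "X \<in> Ob C" "\<And>i. i \<in> I \<Longrightarrow> g i \<in> Hom C (A i) X"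
  shows "(THE h. h \<in> Hom C P X \<and> (\<forall>i\<in>I. h \<cdot> \<iota> i = g i)) \<in> Hom C P X \<and>
    (\<forall>i\<in>I. (THE h. h \<in> Hom C P X \<and> (\<forall>i\<in>I. h \<cdot> \<iota> i = g i)) \<cdot> \<iota> i = g i)"
  by (rule theI') (use assms in \<open>simp add: is_coproduct_def\<close>)

lemma free_rep_arrow:
  assumes A: "A \<in> Ob C" and i: "i \<in> verts Q" and \<alpha>: "\<alpha> \<in> paths Q k l"
  shows "FAr (free_rep Q C i A) \<alpha> \<in> Hom C (copow C A (paths Q i k)) (copow C A (paths Q i l))"
    and "\<rho> \<in> paths Q i k \<Longrightarrow> FAr (free_rep Q C i A) \<alpha> \<cdot> copow_in C A (paths Q i k) \<rho>
      = copow_in C A (paths Q i l) (\<alpha> \<cdot>\<^bsub>path_cat Q\<^esub> \<rho>)"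
proof -
  note kl = paths_verts[OF \<alpha>]
  note the = coproduct_the[OF copower_coproduct[OF A i kl(1)] coproduct_Ob[OF copower_coproduct[OF A i kl(2)]],
      of "\<lambda>\<rho>. copow_in C A (paths Q i l) (\<alpha> \<cdot>\<^bsub>path_cat Q\<^esub> \<rho>)"]
  have "copow_in C A (paths Q i l) (\<alpha> \<cdot>\<^bsub>path_cat Q\<^esub> \<rho>) \<in> Hom C A (copow C A (paths Q i l))"
    if "\<rho> \<in> paths Q i k" for \<rho>
    using copow_in_Hom[OF A category.Cmp_Hom[OF Q.path_cat_category that \<alpha>]] .
  note the' = the[OF this]
  have \<alpha>': "\<alpha> \<in> Ar (path_cat Q)" "Dom (path_cat Q) \<alpha> = k" "Cod (path_cat Q) \<alpha> = l"
    using \<alpha> by (auto simp: Hom_simp)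
  show "FAr (free_rep Q C i A) \<alpha> \<in> Hom C (copow C A (paths Q i k)) (copow C A (paths Q i l))"
    using the' \<alpha>' by (simp add: free_rep_def)
  show "FAr (free_rep Q C i A) \<alpha> \<cdot> copow_in C A (paths Q i k) \<rho>
      = copow_in C A (paths Q i l) (\<alpha> \<cdot>\<^bsub>path_cat Q\<^esub> \<rho>)" if "\<rho> \<in> paths Q i k"
    using the' \<alpha>' that by (simp add: free_rep_def)
qed

text \<open>On the inclusions the functor laws become the unit and associativity laws for
  composition of paths.\<close>

lemma free_rep_Ob:
  assumes A: "A \<in> Ob C" and i: "i \<in> verts Q"
  shows "free_rep Q C i A \<in> Ob (Rep Q C)"
  unfolding Ob_Rep is_functor_def
proof (intro conjI ballI impI)
  let ?F = "free_rep Q C i A"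
  note cp = copower_coproduct[OF A i] and ar = free_rep_arrow[OF A i]
    and pcmp = category.Cmp_Hom[OF Q.path_cat_category]
  show "FOb ?F \<in> Ob (path_cat Q) \<rightarrow>\<^sub>E Ob C"
    using coproduct_Ob[OF cp] by (auto simp: free_rep_def)
  show "FAr ?F \<in> extensional (Ar (path_cat Q))" by (simp add: free_rep_def)
  show "FAr ?F \<alpha> \<in> Hom C (FOb ?F (Dom (path_cat Q) \<alpha>)) (FOb ?F (Cod (path_cat Q) \<alpha>))"
    if "\<alpha> \<in> Ar (path_cat Q)" for \<alpha>
    using ar(1)[OF category.Ar_Hom[OF Q.path_cat_category that]]
      paths_verts[OF category.Ar_Hom[OF Q.path_cat_category that]] by simp
  show "FAr ?F (Idt (path_cat Q) j) = Idt C (FOb ?F j)" if "j \<in> Ob (path_cat Q)" for j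
  proof -
    have j: "j \<in> verts Q" and jj: "(j, [], j) \<in> paths Q j j"
      using that category.Idt_Hom[OF Q.path_cat_category that] by simp_all
    have "FAr ?F (j, [], j) = Idt C (copow C A (paths Q i j))"
    proof (rule coproduct_eqI[OF cp[OF j] ar(1)[OF jj] Idt_Hom[OF coproduct_Ob[OF cp[OF j]]]])
      fix \<rho> assume \<rho>: "\<rho> \<in> paths Q i j"
      have "(j, [], j) \<cdot>\<^bsub>path_cat Q\<^esub> \<rho> = \<rho>" using category.Idt_Cmp[OF Q.path_cat_category \<rho>] by simp
      then show "FAr ?F (j, [], j) \<cdot> copow_in C A (paths Q i j) \<rho>
          = Idt C (copow C A (paths Q i j)) \<cdot> copow_in C A (paths Q i j) \<rho>"
        using ar(2)[OF jj \<rho>] Idt_Cmp[OF copow_in_Hom[OF A \<rho>]] by simp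
    qed
    then show ?thesis using j by simp
  qed
  fix \<alpha> \<beta> assume "\<alpha> \<in> Ar (path_cat Q)" "\<beta> \<in> Ar (path_cat Q)" "Cod (path_cat Q) \<alpha> = Dom (path_cat Q) \<beta>"
  then obtain j k l where \<alpha>: "\<alpha> \<in> paths Q j k" and \<beta>: "\<beta> \<in> paths Q k l" by (auto simp: Hom_simp)
  note \<beta>\<alpha> = pcmp[OF \<alpha> \<beta>]
  show "FAr ?F (\<beta> \<cdot>\<^bsub>path_cat Q\<^esub> \<alpha>) = FAr ?F \<beta> \<cdot> FAr ?F \<alpha>"
  proof (rule coproduct_eqI[OF cp[OF paths_verts(1)[OF \<alpha>]] ar(1)[OF \<beta>\<alpha>] Cmp_Hom[OF ar(1)[OF \<alpha>] ar(1)[OF \<beta>]]])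
    fix \<rho> assume \<rho>: "\<rho> \<in> paths Q i j"
    show "FAr ?F (\<beta> \<cdot>\<^bsub>path_cat Q\<^esub> \<alpha>) \<cdot> copow_in C A (paths Q i j) \<rho>
        = (FAr ?F \<beta> \<cdot> FAr ?F \<alpha>) \<cdot> copow_in C A (paths Q i j) \<rho>"
      using ar(2)[OF \<beta>\<alpha> \<rho>] ar(2)[OF \<alpha> \<rho>] ar(2)[OF \<beta> pcmp[OF \<rho> \<alpha>]]
        category.Cmp_assoc[OF Q.path_cat_category \<rho> \<alpha> \<beta>]
        Cmp_assoc[OF copow_in_Hom[OF A \<rho>] ar(1)[OF \<alpha>] ar(1)[OF \<beta>]] by simp
  qed
qed

lemma free_rep_mor_eqI:
  assumes A: "A \<in> Ob C" and i: "i \<in> verts Q"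
    and \<phi>: "\<phi> \<in> Hom (Rep Q C) (free_rep Q C i A) M" and \<psi>: "\<psi> \<in> Hom (Rep Q C) (free_rep Q C i A) M"
    and eq: "\<And>j \<rho>. \<rho> \<in> paths Q i j \<Longrightarrow>
      NAt \<phi> j \<cdot> copow_in C A (paths Q i j) \<rho> = NAt \<psi> j \<cdot> copow_in C A (paths Q i j) \<rho>"
  shows "\<phi> = \<psi>"
proof (rule rep_mor_eqI[OF \<phi> \<psi>])
  fix j assume j: "j \<in> verts Q"
  show "NAt \<phi> j = NAt \<psi> j"
    using coproduct_eqI[OF copower_coproduct[OF A i j] _ _ eq] rep_mor_Hom[OF \<phi> j] rep_mor_Hom[OF \<psi> j] j
    by simp
qed

text \<open>The existence half of the adjunction between f and e at i, with \<phi> the transpose of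
  a. The prescribed values on inclusions are compatible with an arrow \<alpha> because M sends the
  path \<alpha>\<rho> to the composite of its values at \<alpha> and \<rho>.\<close>

lemma free_rep_adjunct:
  assumes i: "i \<in> verts Q" and M: "M \<in> Ob (Rep Q C)" and a: "a \<in> Hom C A (FOb M i)"
  shows "\<exists>\<phi>. \<phi> \<in> Hom (Rep Q C) (free_rep Q C i A) M \<and>
    (\<forall>j. \<forall>\<rho> \<in> paths Q i j. NAt \<phi> j \<cdot> copow_in C A (paths Q i j) \<rho> = FAr M \<rho> \<cdot> a)"
proof -
  have A: "A \<in> Ob C" using Hom_Ob[OF a] by simp
  note cp = copower_coproduct[OF A i] and ar = free_rep_arrow[OF A i]
  have "\<exists>h. h \<in> Hom C (copow C A (paths Q i j)) (FOb M j) \<and>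
      (\<forall>\<rho> \<in> paths Q i j. h \<cdot> copow_in C A (paths Q i j) \<rho> = FAr M \<rho> \<cdot> a)" if "j \<in> verts Q" for j
    by (rule coproduct_desc[OF cp[OF that] rep_Ob[OF M that]])
      (use Cmp_Hom[OF a rep_Hom[OF M]] in blast)
  then obtain t where t: "\<And>j. j \<in> verts Q \<Longrightarrow> t j \<in> Hom C (copow C A (paths Q i j)) (FOb M j)"
    "\<And>j \<rho>. \<rho> \<in> paths Q i j \<Longrightarrow> t j \<cdot> copow_in C A (paths Q i j) \<rho> = FAr M \<rho> \<cdot> a"
    using paths_verts by (metis (no_types))
  have "mk_nat (path_cat Q) (free_rep Q C i A) M t \<in> Hom (Rep Q C) (free_rep Q C i A) M"
  proof (rule mk_rep_mor_Hom[OF free_rep_Ob[OF A i] M])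
    show "t j \<in> Hom C (FOb (free_rep Q C i A) j) (FOb M j)" if "j \<in> verts Q" for j
      using t(1) that by simp
    fix \<alpha> k l assume \<alpha>: "\<alpha> \<in> paths Q k l"
    note kl = paths_verts[OF \<alpha>] and M\<alpha> = rep_Hom[OF M \<alpha>]
    show "t l \<cdot> FAr (free_rep Q C i A) \<alpha> = FAr M \<alpha> \<cdot> t k"
    proof (rule coproduct_eqI[OF cp[OF kl(1)] Cmp_Hom[OF ar(1)[OF \<alpha>] t(1)[OF kl(2)]]
          Cmp_Hom[OF t(1)[OF kl(1)] M\<alpha>]])
      fix \<rho> assume \<rho>: "\<rho> \<in> paths Q i k"
      note \<mu> = copow_in_Hom[OF A \<rho>]
      show "(t l \<cdot> FAr (free_rep Q C i A) \<alpha>) \<cdot> copow_in C A (paths Q i k) \<rho>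
          = (FAr M \<alpha> \<cdot> t k) \<cdot> copow_in C A (paths Q i k) \<rho>"
        using Cmp_assoc[OF \<mu> ar(1)[OF \<alpha>] t(1)[OF kl(2)]] ar(2)[OF \<alpha> \<rho>]
          t(2)[OF category.Cmp_Hom[OF Q.path_cat_category \<rho> \<alpha>]] rep_Cmp[OF M \<rho> \<alpha>]
          Cmp_assoc[OF \<mu> t(1)[OF kl(1)] M\<alpha>] t(2)[OF \<rho>] Cmp_assoc[OF a rep_Hom[OF M \<rho>] M\<alpha>] by simp
    qed
  qed
  moreover have "NAt (mk_nat (path_cat Q) (free_rep Q C i A) M t) j = t j" if "\<rho> \<in> paths Q i j" for j \<rho>
    using paths_verts(2)[OF that] by simp
  ultimately show ?thesis using t(2) by auto
qed

lemma free_rep_mor: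
  assumes i: "i \<in> verts Q" and u: "u \<in> Hom C A B"
  shows "free_rep_mor Q C i u \<in> Hom (Rep Q C) (free_rep Q C i A) (free_rep Q C i B)"
    and "\<rho> \<in> paths Q i j \<Longrightarrow> NAt (free_rep_mor Q C i u) j \<cdot> copow_in C A (paths Q i j) \<rho>
      = copow_in C B (paths Q i j) \<rho> \<cdot> u"
proof -
  have A: "A \<in> Ob C" and B: "B \<in> Ob C" using Hom_Ob[OF u] by auto
  have DC: "Dom C u = A" "Cod C u = B" using u by (auto simp: Hom_simp)
  note cpA = copower_coproduct[OF A i] and cpB = copower_coproduct[OF B i]
    and arA = free_rep_arrow[OF A i] and arB = free_rep_arrow[OF B i]
  have t: "NAt (free_rep_mor Q C i u) j \<in> Hom C (copow C A (paths Q i j)) (copow C B (paths Q i j)) \<and>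
      (\<forall>\<rho> \<in> paths Q i j. NAt (free_rep_mor Q C i u) j \<cdot> copow_in C A (paths Q i j) \<rho>
        = copow_in C B (paths Q i j) \<rho> \<cdot> u)" if j: "j \<in> verts Q" for j
    using coproduct_the[OF cpA[OF j] coproduct_Ob[OF cpB[OF j]], of "\<lambda>\<rho>. copow_in C B (paths Q i j) \<rho> \<cdot> u"]
      Cmp_Hom[OF u copow_in_Hom[OF B]] j
    by (simp add: free_rep_mor_def DC)
  then show "\<rho> \<in> paths Q i j \<Longrightarrow> NAt (free_rep_mor Q C i u) j \<cdot> copow_in C A (paths Q i j) \<rho>
      = copow_in C B (paths Q i j) \<rho> \<cdot> u" using paths_verts by blast
  let ?t = "NAt (free_rep_mor Q C i u)"
  have "mk_nat (path_cat Q) (free_rep Q C i A) (free_rep Q C i B) ?t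
      \<in> Hom (Rep Q C) (free_rep Q C i A) (free_rep Q C i B)"
  proof (rule mk_rep_mor_Hom[OF free_rep_Ob[OF A i] free_rep_Ob[OF B i]])
    show "?t j \<in> Hom C (FOb (free_rep Q C i A) j) (FOb (free_rep Q C i B) j)" if "j \<in> verts Q" for j
      using t[OF that] that by simp
    fix \<alpha> k l assume \<alpha>: "\<alpha> \<in> paths Q k l"
    note kl = paths_verts[OF \<alpha>]
    note tk = conjunct1[OF t[OF kl(1)]] and tl = conjunct1[OF t[OF kl(2)]]
    show "?t l \<cdot> FAr (free_rep Q C i A) \<alpha> = FAr (free_rep Q C i B) \<alpha> \<cdot> ?t k"
    proof (rule coproduct_eqI[OF cpA[OF kl(1)] Cmp_Hom[OF arA(1)[OF \<alpha>] tl] Cmp_Hom[OF tk arB(1)[OF \<alpha>]]])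
      fix \<rho> assume \<rho>: "\<rho> \<in> paths Q i k"
      show "(?t l \<cdot> FAr (free_rep Q C i A) \<alpha>) \<cdot> copow_in C A (paths Q i k) \<rho>
          = (FAr (free_rep Q C i B) \<alpha> \<cdot> ?t k) \<cdot> copow_in C A (paths Q i k) \<rho>"
        using Cmp_assoc[OF copow_in_Hom[OF A \<rho>] arA(1)[OF \<alpha>] tl] arA(2)[OF \<alpha> \<rho>] t[OF kl(2)]
          category.Cmp_Hom[OF Q.path_cat_category \<rho> \<alpha>] arB(2)[OF \<alpha> \<rho>]
          Cmp_assoc[OF copow_in_Hom[OF A \<rho>] tk arB(1)[OF \<alpha>]] t[OF kl(1)] \<rho>
          Cmp_assoc[OF u copow_in_Hom[OF B \<rho>] arB(1)[OF \<alpha>]] by simp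
    qed
  qed
  moreover have "mk_nat (path_cat Q) (free_rep Q C i A) (free_rep Q C i B) ?t = free_rep_mor Q C i u"
    by (simp add: mk_nat_def free_rep_mor_def DC restrict_def fun_eq_iff)
  ultimately show "free_rep_mor Q C i u \<in> Hom (Rep Q C) (free_rep Q C i A) (free_rep Q C i B)" by simp
qed

section \<open>The functors of the sequence and maps out of them\<close>

lemma free_func_functor:
  assumes i: "i \<in> verts Q"
  shows "is_functor C (Rep Q C) (free_func Q C i)"
  unfolding is_functor_def
proof (intro conjI ballI impI)
  let ?f = "free_func Q C i"
  note mor = free_rep_mor[OF i] and NHom = rep_mor_Hom[OF free_rep_mor(1)[OF i]]
  show "FOb ?f \<in> Ob C \<rightarrow>\<^sub>E Ob (Rep Q C)" using free_rep_Ob[OF _ i] by (auto simp: free_func_def)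
  show "FAr ?f \<in> extensional (Ar C)" by (simp add: free_func_def)
  show "FAr ?f u \<in> Hom (Rep Q C) (FOb ?f (Dom C u)) (FOb ?f (Cod C u))" if "u \<in> Ar C" for u
    using mor(1)[OF Ar_Hom[OF that]] Dom_Ob[OF that] Cod_Ob[OF that] that by (simp add: free_func_def)
  show "FAr ?f (Idt C A) = Idt (Rep Q C) (FOb ?f A)" if A: "A \<in> Ob C" for A
  proof -
    note IA = Idt_Hom[OF A]
    note IF = category.Idt_Hom[OF Rep_category free_rep_Ob[OF A i]]
    have "free_rep_mor Q C i (Idt C A) = Idt (Rep Q C) (free_rep Q C i A)"
    proof (rule free_rep_mor_eqI[OF A i mor(1)[OF IA] IF])
      fix j \<rho> assume \<rho>: "\<rho> \<in> paths Q i j"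
      note j = paths_verts(2)[OF \<rho>] and \<mu> = copow_in_Hom[OF A \<rho>]
      show "NAt (free_rep_mor Q C i (Idt C A)) j \<cdot> copow_in C A (paths Q i j) \<rho>
          = NAt (Idt (Rep Q C) (free_rep Q C i A)) j \<cdot> copow_in C A (paths Q i j) \<rho>"
        using mor(2)[OF IA \<rho>] Cmp_Idt[OF \<mu>] Idt_Cmp[OF \<mu>] rep_NAt_Idt[OF j] j by simp
    qed
    then show ?thesis using A IA by (simp add: free_func_def Hom_simp)
  qed
  fix u v assume "u \<in> Ar C" "v \<in> Ar C" "Cod C u = Dom C v"
  then obtain A B D where u: "u \<in> Hom C A B" and v: "v \<in> Hom C B D" by (auto simp: Hom_simp)
  note vu = Cmp_Hom[OF u v]
  note A = Hom_Ob(1)[OF u] and B = Hom_Ob(1)[OF v] and D = Hom_Ob(2)[OF v]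
  have "free_rep_mor Q C i (v \<cdot> u) = free_rep_mor Q C i v \<cdot>\<^bsub>Rep Q C\<^esub> free_rep_mor Q C i u"
  proof (rule free_rep_mor_eqI[OF A i mor(1)[OF vu] category.Cmp_Hom[OF Rep_category mor(1)[OF u] mor(1)[OF v]]])
    fix j \<rho> assume \<rho>: "\<rho> \<in> paths Q i j"
    note j = paths_verts(2)[OF \<rho>]
    note \<mu> = copow_in_Hom[OF A \<rho>] copow_in_Hom[OF B \<rho>] copow_in_Hom[OF D \<rho>]
    note Nu = NHom[OF u j, simplified FOb_free_rep[OF j]] and Nv = NHom[OF v j, simplified FOb_free_rep[OF j]]
    show "NAt (free_rep_mor Q C i (v \<cdot> u)) j \<cdot> copow_in C A (paths Q i j) \<rho>
        = NAt (free_rep_mor Q C i v \<cdot>\<^bsub>Rep Q C\<^esub> free_rep_mor Q C i u) j \<cdot> copow_in C A (paths Q i j) \<rho>"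
      using mor(2)[OF vu \<rho>] rep_NAt_Cmp[OF j] Cmp_assoc[OF \<mu>(1) Nu Nv] mor(2)[OF u \<rho>]
        Cmp_assoc[OF u \<mu>(2) Nv] mor(2)[OF v \<rho>] Cmp_assoc[OF u v \<mu>(3)] by simp
  qed
  then show "FAr ?f (v \<cdot> u) = FAr ?f v \<cdot>\<^bsub>Rep Q C\<^esub> FAr ?f u"
    using u v vu by (simp add: free_func_def Hom_simp)
qed

lemma eval_func_functor:
  assumes i: "i \<in> verts Q"
  shows "is_functor (Rep Q C) C (eval_func Q C i)"
  unfolding is_functor_def
proof (intro conjI ballI impI)
  let ?e = "eval_func Q C i"
  show "FOb ?e \<in> Ob (Rep Q C) \<rightarrow>\<^sub>E Ob C" using rep_Ob[OF _ i] by (auto simp: eval_func_def)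
  show "FAr ?e \<in> extensional (Ar (Rep Q C))" by (simp add: eval_func_def)
  show "FAr ?e \<eta> \<in> Hom C (FOb ?e (Dom (Rep Q C) \<eta>)) (FOb ?e (Cod (Rep Q C) \<eta>))"
    if "\<eta> \<in> Ar (Rep Q C)" for \<eta>
    using rep_mor_Hom[OF category.Ar_Hom[OF Rep_category that] i] category.Dom_Ob[OF Rep_category that]
      category.Cod_Ob[OF Rep_category that] that by (simp add: eval_func_def)
  show "FAr ?e (Idt (Rep Q C) F) = Idt C (FOb ?e F)" if "F \<in> Ob (Rep Q C)" for F
    using category.Idt_Hom[OF Rep_category that] rep_NAt_Idt[OF i] that
    by (simp add: eval_func_def Hom_simp)
  show "FAr ?e (\<theta> \<cdot>\<^bsub>Rep Q C\<^esub> \<eta>) = FAr ?e \<theta> \<cdot> FAr ?e \<eta>"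
    if "\<eta> \<in> Ar (Rep Q C)" "\<theta> \<in> Ar (Rep Q C)" "Cod (Rep Q C) \<eta> = Dom (Rep Q C) \<theta>" for \<eta> \<theta>
    using category.Cmp_Hom[OF Rep_category, of \<eta> _ _ \<theta>] rep_NAt_Cmp[OF i] that
    by (simp add: eval_func_def Hom_simp)
qed

lemma fe_functor: "\<lbrakk>i \<in> verts Q; j \<in> verts Q\<rbrakk> \<Longrightarrow> is_functor (Rep Q C) (Rep Q C) (fe Q C j i)"
  unfolding fe_def
  by (rule comp_func_functor[OF eval_func_functor free_func_functor Rep_category category_axioms])

lemma FOb_fe:
  assumes "F \<in> Ob (Rep Q C)" "i \<in> verts Q"
  shows "FOb (fe Q C j i) F = free_rep Q C j (FOb F i)"
  using assms rep_Ob[OF assms] by (simp add: fe_def comp_func_def eval_func_def free_func_def)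

lemma FAr_fe:
  assumes "\<eta> \<in> Hom (Rep Q C) F F'" "i \<in> verts Q"
  shows "FAr (fe Q C j i) \<eta> = free_rep_mor Q C j (NAt \<eta> i)"
  using assms rep_mor_Hom[OF assms] by (simp add: fe_def comp_func_def eval_func_def free_func_def Hom_simp)

text \<open>The adjunction made natural in F: a transformation from evaluation at i to evaluation of
  K at j has a transpose out of \<open>fe Q C j i\<close>. It is given by components a and their
  squares \<open>nat\<close>, so that evaluation after K need not be packaged as a functor.\<close>

lemma fe_adjunct:
  assumes i: "i \<in> verts Q" and j: "j \<in> verts Q" and K: "is_functor (Rep Q C) (Rep Q C) K"
    and a: "\<And>F. F \<in> Ob (Rep Q C) \<Longrightarrow> a F \<in> Hom C (FOb F i) (FOb (FOb K F) j)"
    and nat: "\<And>F F' \<eta>. \<eta> \<in> Hom (Rep Q C) F F' \<Longrightarrow> NAt (FAr K \<eta>) j \<cdot> a F = a F' \<cdot> NAt \<eta> i"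
  shows "\<exists>\<Phi>. \<Phi> \<in> Hom (End_cat (Rep Q C)) (fe Q C j i) K \<and>
    (\<forall>F \<in> Ob (Rep Q C). \<forall>k. \<forall>\<rho> \<in> paths Q j k.
      NAt (NAt \<Phi> F) k \<cdot> copow_in C (FOb F i) (paths Q j k) \<rho> = FAr (FOb K F) \<rho> \<cdot> a F)"
proof -
  have "\<exists>\<phi>. \<phi> \<in> Hom (Rep Q C) (free_rep Q C j (FOb F i)) (FOb K F) \<and>
    (\<forall>k. \<forall>\<rho> \<in> paths Q j k. NAt \<phi> k \<cdot> copow_in C (FOb F i) (paths Q j k) \<rho> = FAr (FOb K F) \<rho> \<cdot> a F)"
    if "F \<in> Ob (Rep Q C)" for F
    by (rule free_rep_adjunct[OF j functor_Ob[OF K that] a[OF that]])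
  then obtain t where t: "\<And>F. F \<in> Ob (Rep Q C) \<Longrightarrow> t F \<in> Hom (Rep Q C) (free_rep Q C j (FOb F i)) (FOb K F)"
    "\<And>F k \<rho>. \<lbrakk>F \<in> Ob (Rep Q C); \<rho> \<in> paths Q j k\<rbrakk> \<Longrightarrow>
      NAt (t F) k \<cdot> copow_in C (FOb F i) (paths Q j k) \<rho> = FAr (FOb K F) \<rho> \<cdot> a F"
    by (metis (no_types))
  have "mk_nat (Rep Q C) (fe Q C j i) K t \<in> Hom (End_cat (Rep Q C)) (fe Q C j i) K"
  proof (rule mk_nat_Hom[OF Rep_category Rep_category fe_functor[OF i j] K])
    show "t F \<in> Hom (Rep Q C) (FOb (fe Q C j i) F) (FOb K F)" if "F \<in> Ob (Rep Q C)" for F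
      using t(1)[OF that] FOb_fe[OF that i] by simp
    fix \<eta> F F' assume \<eta>: "\<eta> \<in> Hom (Rep Q C) F F'"
    have F: "F \<in> Ob (Rep Q C)" and F': "F' \<in> Ob (Rep Q C)"
      using category.Hom_Ob[OF Rep_category \<eta>] by auto
    note \<eta>i = rep_mor_Hom[OF \<eta> i] and K\<eta> = functor_Hom[OF K \<eta>]
    note m = free_rep_mor[OF j \<eta>i]
    have "t F' \<cdot>\<^bsub>Rep Q C\<^esub> free_rep_mor Q C j (NAt \<eta> i) = FAr K \<eta> \<cdot>\<^bsub>Rep Q C\<^esub> t F"
    proof (rule free_rep_mor_eqI[OF rep_Ob[OF F i] j category.Cmp_Hom[OF Rep_category m(1) t(1)[OF F']]
          category.Cmp_Hom[OF Rep_category t(1)[OF F] K\<eta>]])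
      fix k \<rho> assume \<rho>: "\<rho> \<in> paths Q j k"
      note k = paths_verts(2)[OF \<rho>]
      note \<mu> = copow_in_Hom[OF rep_Ob[OF F i] \<rho>] and \<mu>' = copow_in_Hom[OF rep_Ob[OF F' i] \<rho>]
      note mk = rep_mor_Hom[OF m(1) k, simplified FOb_free_rep[OF k]]
        and tF = rep_mor_Hom[OF t(1)[OF F] k, simplified FOb_free_rep[OF k]]
        and tF' = rep_mor_Hom[OF t(1)[OF F'] k, simplified FOb_free_rep[OF k]]
        and Kk = rep_mor_Hom[OF K\<eta> k] and Kj = rep_mor_Hom[OF K\<eta> j]
      note K\<rho> = rep_Hom[OF functor_Ob[OF K F] \<rho>] and K\<rho>' = rep_Hom[OF functor_Ob[OF K F'] \<rho>]
      \<comment> \<open>Both sides are rewritten to end in \<open>FAr (FOb K F') \<rho>\<close>: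
        this one by the effect of \<open>free_rep_mor\<close> on inclusions, the other by naturality
        of \<open>FAr K \<eta>\<close> along \<rho>. The assumption \<open>nat\<close> joins
        them.\<close>
      have "(NAt (t F') k \<cdot> NAt (free_rep_mor Q C j (NAt \<eta> i)) k) \<cdot> copow_in C (FOb F i) (paths Q j k) \<rho>
          = FAr (FOb K F') \<rho> \<cdot> (a F' \<cdot> NAt \<eta> i)"
        using Cmp_assoc[OF \<mu> mk tF'] m(2)[OF \<rho>] Cmp_assoc[OF \<eta>i \<mu>' tF'] t(2)[OF F' \<rho>]
          Cmp_assoc[OF \<eta>i a[OF F'] K\<rho>'] by simp
      also have "\<dots> = (FAr (FOb K F') \<rho> \<cdot> NAt (FAr K \<eta>) j) \<cdot> a F"
        using nat[OF \<eta>] Cmp_assoc[OF a[OF F] Kj K\<rho>'] by simp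
      also have "\<dots> = (NAt (FAr K \<eta>) k \<cdot> NAt (t F) k) \<cdot> copow_in C (FOb F i) (paths Q j k) \<rho>"
        using rep_mor_square[OF K\<eta> \<rho>] Cmp_assoc[OF a[OF F] K\<rho> Kk] t(2)[OF F \<rho>] Cmp_assoc[OF \<mu> tF Kk] by simp
      finally show "NAt (t F' \<cdot>\<^bsub>Rep Q C\<^esub> free_rep_mor Q C j (NAt \<eta> i)) k \<cdot> copow_in C (FOb F i) (paths Q j k) \<rho>
          = NAt (FAr K \<eta> \<cdot>\<^bsub>Rep Q C\<^esub> t F) k \<cdot> copow_in C (FOb F i) (paths Q j k) \<rho>"
        using rep_NAt_Cmp[OF k] by simp
    qed
    then show "t F' \<cdot>\<^bsub>Rep Q C\<^esub> FAr (fe Q C j i) \<eta> = FAr K \<eta> \<cdot>\<^bsub>Rep Q C\<^esub> t F"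
      using FAr_fe[OF \<eta> i] by simp
  qed
  then show ?thesis using t(2) by (intro exI[of _ "mk_nat (Rep Q C) (fe Q C j i) K t"]) simp
qed

text \<open>One choice has to be coherent on three levels. Coproducts are chosen at each vertex,
  assembled over the vertices for each F, then over all F. The flat description in C has explicit
  composite inclusions because computations with \<Gamma> and \<epsilon> take place on them.\<close>

lemma fe_coproduct:
  fixes I :: "'i set"
  assumes st: "\<And>x. x \<in> I \<Longrightarrow> s x \<in> verts Q" "\<And>x. x \<in> I \<Longrightarrow> t x \<in> verts Q"
    and card: "\<And>k. k \<in> verts Q \<Longrightarrow> |SIGMA x:I. paths Q (t x) k| \<le>o |paths_to Q k|"
  shows "\<exists>P \<iota>. is_coproduct (End_cat (Rep Q C)) I (\<lambda>x. fe Q C (t x) (s x)) P \<iota> \<and>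
    (\<forall>F \<in> Ob (Rep Q C).
      is_coproduct (Rep Q C) I (\<lambda>x. FOb (fe Q C (t x) (s x)) F) (FOb P F) (\<lambda>x. NAt (\<iota> x) F) \<and>
      (\<forall>k \<in> verts Q. is_coproduct C (SIGMA x:I. paths Q (t x) k) (\<lambda>(x, _). FOb F (s x)) (FOb (FOb P F) k)
        (\<lambda>(x, \<rho>). NAt (NAt (\<iota> x) F) k \<cdot> copow_in C (FOb F (s x)) (paths Q (t x) k) \<rho>)))"
proof -
  \<comment> \<open>Object and inclusions form one pair c, so that a single application of
    \<open>bchoice\<close> selects them for all F together with both properties.\<close>
  define rcop where "rcop F c \<longleftrightarrow>
      is_coproduct (Rep Q C) I (\<lambda>x. FOb (fe Q C (t x) (s x)) F) (fst c) (snd c) \<and>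
      (\<forall>k \<in> verts Q. is_coproduct C (SIGMA x:I. paths Q (t x) k) (\<lambda>(x, _). FOb F (s x)) (FOb (fst c) k)
        (\<lambda>(x, \<rho>). NAt (snd c x) k \<cdot> copow_in C (FOb F (s x)) (paths Q (t x) k) \<rho>))" for F c
  have "\<exists>c. rcop F c" if F: "F \<in> Ob (Rep Q C)" for F
  proof -
    have cp: "is_coproduct C (paths Q (t x) k) (\<lambda>_. FOb F (s x)) (FOb (FOb (fe Q C (t x) (s x)) F) k)
        (copow_in C (FOb F (s x)) (paths Q (t x) k))" if "x \<in> I" "k \<in> verts Q" for x k
      using copower_coproduct[OF rep_Ob[OF F st(1)] st(2) that(2)] FOb_fe[OF F st(1)] that by simp
    define cop where "cop k c \<longleftrightarrow>
      is_coproduct C I (\<lambda>x. FOb (FOb (fe Q C (t x) (s x)) F) k) (fst c) (snd c)" for k c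
    have "\<exists>c. cop k c" if k: "k \<in> verts Q" for k
    proof -
      \<comment> \<open>This flat coproduct is what the cardinal bound provides. It is regrouped
        over I; \<open>coproduct_Sigma\<close> later restores the flat form, with inclusions that
        pass through the chosen copowers.\<close>
      obtain P \<gamma> where P: "is_coproduct C (SIGMA x:I. paths Q (t x) k) (\<lambda>(x, _). FOb F (s x)) P \<gamma>"
        using coproduct_exists[OF k card[OF k], of "\<lambda>(x, _). FOb F (s x)"] rep_Ob[OF F st(1)] by auto
      obtain \<iota> where "is_coproduct C I (\<lambda>x. FOb (FOb (fe Q C (t x) (s x)) F) k) P \<iota>"
        using coproduct_of_copowers[OF P cp[OF _ k]] by blast
      then show ?thesis unfolding cop_def by (intro exI[of _ "(P, \<iota>)"]) simp
    qed
    then obtain c where "\<forall>k \<in> verts Q. cop k (c k)"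
      using bchoice[of "verts Q" cop] by blast
    then have pj: "is_coproduct C I (\<lambda>x. FOb (FOb (fe Q C (t x) (s x)) F) k) (fst (c k)) (snd (c k))" if "k \<in> verts Q" for k
      using that by (simp add: cop_def)
    obtain P \<iota> where P: "is_coproduct (Rep Q C) I (\<lambda>x. FOb (fe Q C (t x) (s x)) F) P \<iota>"
      and P\<iota>: "\<And>k. k \<in> verts Q \<Longrightarrow> FOb P k = fst (c k)" "\<And>k x. k \<in> verts Q \<Longrightarrow> NAt (\<iota> x) k = snd (c k) x"
      using func_cat_coproduct[OF Q.path_cat_category category_axioms, of I "\<lambda>x. FOb (fe Q C (t x) (s x)) F" "\<lambda>k. fst (c k)"
          "\<lambda>k. snd (c k)", folded Ob_Rep Rep_def] functor_Ob[OF fe_functor[OF st] F] pj by auto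
    have "is_coproduct C (SIGMA x:I. paths Q (t x) k) (\<lambda>(x, _). FOb F (s x)) (FOb P k)
        (\<lambda>(x, \<rho>). NAt (\<iota> x) k \<cdot> copow_in C (FOb F (s x)) (paths Q (t x) k) \<rho>)" if "k \<in> verts Q" for k
      using coproduct_Sigma[OF pj[OF that] cp[OF _ that]] P\<iota> that by simp
    then show ?thesis using P unfolding rcop_def by (intro exI[of _ "(P, \<iota>)"]) simp
  qed
  then obtain c where "\<forall>F \<in> Ob (Rep Q C). rcop F (c F)"
    using bchoice[of "Ob (Rep Q C)" rcop] by blast
  then have
    p: "\<And>F. F \<in> Ob (Rep Q C) \<Longrightarrow>
      is_coproduct (Rep Q C) I (\<lambda>x. FOb (fe Q C (t x) (s x)) F) (fst (c F)) (snd (c F))"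
    and pk: "\<And>F k. \<lbrakk>F \<in> Ob (Rep Q C); k \<in> verts Q\<rbrakk> \<Longrightarrow>
      is_coproduct C (SIGMA x:I. paths Q (t x) k) (\<lambda>(x, _). FOb F (s x)) (FOb (fst (c F)) k)
        (\<lambda>(x, \<rho>). NAt (snd (c F) x) k \<cdot> copow_in C (FOb F (s x)) (paths Q (t x) k) \<rho>)"
    by (simp_all add: rcop_def)
  obtain P \<iota> where P: "is_coproduct (End_cat (Rep Q C)) I (\<lambda>x. fe Q C (t x) (s x)) P \<iota>"
    and P\<iota>: "\<And>F. F \<in> Ob (Rep Q C) \<Longrightarrow> FOb P F = fst (c F)" "\<And>F x. F \<in> Ob (Rep Q C) \<Longrightarrow> NAt (\<iota> x) F = snd (c F) x"
    using func_cat_coproduct[OF Rep_category Rep_category, of I "\<lambda>x. fe Q C (t x) (s x)"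
        "\<lambda>F. fst (c F)" "\<lambda>F. snd (c F)"]
      fe_functor[OF st] p by auto
  show ?thesis
    by (rule exI[of _ P], rule exI[of _ \<iota>]) (simp add: P P\<iota> p pk)
qed

end

section \<open>The standard resolution\<close>

context quiver_representations
begin

section \<open>The splitting at a single vertex\<close>

abbreviation arc_act :: "('v, 'a, 'o, 'm) rep \<Rightarrow> 'a \<Rightarrow> 'm" where
  "arc_act F e \<equiv> FAr F (tail Q e, [e], head Q e)"

lemma arc_act_Hom:
  "\<lbrakk>F \<in> Ob (Rep Q C); e \<in> arcs Q\<rbrakk> \<Longrightarrow> arc_act F e \<in> Hom C (FOb F (tail Q e)) (FOb F (head Q e))"
  by (rule rep_Hom[OF _ Q.arc_path])

lemma rep_Cons:
  assumes "F \<in> Ob (Rep Q C)" "e \<in> arcs Q" "(head Q e, p, k) \<in> paths Q (head Q e) k"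
  shows "FAr F (tail Q e, e # p, k) = FAr F (head Q e, p, k) \<cdot> arc_act F e"
  using rep_Cmp[OF assms(1) Q.arc_path[OF assms(2)] assms(3)] by simp

text \<open>For a path with arrows e_1, ..., e_n in order of traversal, this is the sum over j of
  \<gamma> at e_j and the rest e_(j+1), ..., e_n, precomposed with the action of e_1, ..., e_(j-1).
  Applying \<Gamma> makes the sum telescope to the inclusion of the whole path minus s after the
  action of the path. The trivial path gets 0 because its inclusion is s, the part complementary to
  the image of \<Gamma>. The argument i only selects the hom-group.\<close>

primrec retraction :: "('v, 'a, 'o, 'm) rep \<Rightarrow> 'o \<Rightarrow> ('a \<times> 'v \<times> 'a list \<times> 'v \<Rightarrow> 'm) \<Rightarrow> 'v \<Rightarrow> 'v \<Rightarrow> 'a list \<Rightarrow> 'm"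
  where
    "retraction F P \<gamma> k i [] = \<one>\<^bsub>G (FOb F i) P\<^esub>"
  | "retraction F P \<gamma> k i (e # p) =
      \<gamma> (e, (head Q e, p, k)) \<otimes>\<^bsub>G (FOb F i) P\<^esub> (retraction F P \<gamma> k (head Q e) p \<cdot> arc_act F e)"

lemma retraction_Hom:
  assumes F: "F \<in> Ob (Rep Q C)"
    and P: "is_coproduct C (SIGMA e:arcs Q. paths Q (head Q e) k) (\<lambda>(e, _). FOb F (tail Q e)) P \<gamma>"
  shows "(i, p, k) \<in> paths Q i k \<Longrightarrow> retraction F P \<gamma> k i p \<in> Hom C (FOb F i) P"
proof (induction p arbitrary: i)
  case Nil
  then show ?case using one_Hom[OF rep_Ob[OF F] coproduct_Ob[OF P]] paths_verts by simp
next
  case (Cons e p)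
  then have e: "e \<in> arcs Q" "i = tail Q e" and p: "(head Q e, p, k) \<in> paths Q (head Q e) k"
    by (simp_all add: Q.Cons_path)
  have "\<gamma> (e, (head Q e, p, k)) \<in> Hom C (FOb F i) P"
    using coproduct_in[OF P, of "(e, (head Q e, p, k))"] e p by simp
  then show ?case using mult_Hom Cmp_Hom[OF arc_act_Hom[OF F e(1)] Cons.IH[OF p]] e(2) by simp
qed

text \<open>S, P and their inclusions are arbitrary here, which keeps functor categories out of the
  computation. One step of the recursion gives r\<Gamma> = 1, functoriality of F on a path cut after
  its first arrow gives \<epsilon>\<Gamma> = 0, and telescoping gives the decomposition of the
  identity of S.\<close>

lemma vertex_split:
  assumes F: "F \<in> Ob (Rep Q C)" and k: "k \<in> verts Q"
    and S: "is_coproduct C (SIGMA i:verts Q. paths Q i k) (\<lambda>(i, _). FOb F i) S \<tau>"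
    and P: "is_coproduct C (SIGMA e:arcs Q. paths Q (head Q e) k) (\<lambda>(e, _). FOb F (tail Q e)) P \<gamma>"
    and \<Gamma>: "\<Gamma> \<in> Hom C P S" and \<epsilon>: "\<epsilon> \<in> Hom C S (FOb F k)"
    and \<Gamma>_in: "\<And>e p. \<lbrakk>e \<in> arcs Q; (head Q e, p, k) \<in> paths Q (head Q e) k\<rbrakk> \<Longrightarrow>
      \<Gamma> \<cdot> \<gamma> (e, (head Q e, p, k)) = sub (FOb F (tail Q e)) S (\<tau> (tail Q e, (tail Q e, e # p, k)))
        (\<tau> (head Q e, (head Q e, p, k)) \<cdot> arc_act F e)"
    and \<epsilon>_in: "\<And>i p. p \<in> paths Q i k \<Longrightarrow> \<epsilon> \<cdot> \<tau> (i, p) = FAr F p"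
  shows "\<exists>r \<in> Hom C S P. \<exists>s \<in> Hom C (FOb F k) S. r \<cdot> \<Gamma> = Idt C P \<and> \<epsilon> \<cdot> s = Idt C (FOb F k) \<and>
    \<epsilon> \<cdot> \<Gamma> = \<one>\<^bsub>G P (FOb F k)\<^esub> \<and> (\<Gamma> \<cdot> r) \<otimes>\<^bsub>G S S\<^esub> (s \<cdot> \<epsilon>) = Idt C S"
proof -
  note obP = coproduct_Ob[OF P] and obS = coproduct_Ob[OF S]
  have \<tau>: "\<tau> (i, p) \<in> Hom C (FOb F i) S" if "p \<in> paths Q i k" for i p
    using coproduct_in[OF S, of "(i, p)"] that paths_verts(1)[OF that] by simp
  have \<gamma>: "\<gamma> (e, p) \<in> Hom C (FOb F (tail Q e)) P" if "e \<in> arcs Q" "p \<in> paths Q (head Q e) k" for e p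
    using coproduct_in[OF P, of "(e, p)"] that by simp
  note ret = retraction_Hom[OF F P]
  have "\<exists>r. r \<in> Hom C S P \<and> (\<forall>x \<in> SIGMA i:verts Q. paths Q i k. r \<cdot> \<tau> x = (\<lambda>(i, (_, p, _)). retraction F P \<gamma> k i p) x)"
  proof (rule coproduct_desc[OF S obP])
    fix x assume "x \<in> (SIGMA i:verts Q. paths Q i k)"
    then obtain i p where "x = (i, (i, p, k))" "(i, p, k) \<in> paths Q i k" by (auto simp: paths_iff)
    then show "(\<lambda>(i, (_, p, _)). retraction F P \<gamma> k i p) x \<in> Hom C (case x of (i, _) \<Rightarrow> FOb F i) P"
      using ret by simp
  qed
  then obtain r where r: "r \<in> Hom C S P"
    and "\<forall>x \<in> SIGMA i:verts Q. paths Q i k. r \<cdot> \<tau> x = (\<lambda>(i, (_, p, _)). retraction F P \<gamma> k i p) x" by blast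
  then have r_in: "r \<cdot> \<tau> (i, (i, p, k)) = retraction F P \<gamma> k i p" if "(i, p, k) \<in> paths Q i k" for i p
    using that paths_verts(1)[OF that] by force
  have kk: "(k, [], k) \<in> paths Q k k" using category.Idt_Hom[OF Q.path_cat_category, of k] k by simp
  define s where "s = \<tau> (k, (k, [], k))"
  have s: "s \<in> Hom C (FOb F k) S" unfolding s_def by (rule \<tau>[OF kk])
  have \<epsilon>s: "\<epsilon> \<cdot> s = Idt C (FOb F k)" unfolding s_def using \<epsilon>_in[OF kk] rep_Idt[OF F k] by simp
  have r\<Gamma>: "r \<cdot> \<Gamma> = Idt C P"
  proof (rule coproduct_eqI[OF P Cmp_Hom[OF \<Gamma> r] Idt_Hom[OF obP]])
    fix x assume "x \<in> (SIGMA e:arcs Q. paths Q (head Q e) k)"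
    then obtain e p where x: "x = (e, (head Q e, p, k))" and e: "e \<in> arcs Q"
      and p: "(head Q e, p, k) \<in> paths Q (head Q e) k" by (auto simp: paths_iff)
    have ep: "(tail Q e, e # p, k) \<in> paths Q (tail Q e) k" using Q.Cons_path e p by simp
    note Fe = arc_act_Hom[OF F e]
    have "r \<cdot> (\<Gamma> \<cdot> \<gamma> x) = sub (FOb F (tail Q e)) P (r \<cdot> \<tau> (tail Q e, (tail Q e, e # p, k)))
        (r \<cdot> (\<tau> (head Q e, (head Q e, p, k)) \<cdot> arc_act F e))"
      unfolding x \<Gamma>_in[OF e p] by (rule Cmp_sub(1)[OF \<tau>[OF ep] Cmp_Hom[OF Fe \<tau>[OF p]] r])
    \<comment> \<open>By the recursion the first term of the difference is \<open>\<gamma> x\<close>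
      plus the second term.\<close>
    also have "\<dots> = \<gamma> x"
      using r_in[OF ep] r_in[OF p] Cmp_assoc[OF Fe \<tau>[OF p] r]
        add_sub_cancel(1)[OF \<gamma>[OF e p] Cmp_Hom[OF Fe ret[OF p]]] x by simp
    finally show "(r \<cdot> \<Gamma>) \<cdot> \<gamma> x = Idt C P \<cdot> \<gamma> x"
      using Cmp_assoc[OF \<gamma>[OF e p] \<Gamma> r] Idt_Cmp[OF \<gamma>[OF e p]] x by simp
  qed
  have \<epsilon>\<Gamma>: "\<epsilon> \<cdot> \<Gamma> = \<one>\<^bsub>G P (FOb F k)\<^esub>"
  proof (rule coproduct_eqI[OF P Cmp_Hom[OF \<Gamma> \<epsilon>] one_Hom[OF obP rep_Ob[OF F k]]])
    fix x assume "x \<in> (SIGMA e:arcs Q. paths Q (head Q e) k)"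
    then obtain e p where x: "x = (e, (head Q e, p, k))" and e: "e \<in> arcs Q"
      and p: "(head Q e, p, k) \<in> paths Q (head Q e) k" by (auto simp: paths_iff)
    have ep: "(tail Q e, e # p, k) \<in> paths Q (tail Q e) k" using Q.Cons_path e p by simp
    note Fe = arc_act_Hom[OF F e]
    have "\<epsilon> \<cdot> (\<Gamma> \<cdot> \<gamma> x) = sub (FOb F (tail Q e)) (FOb F k) (\<epsilon> \<cdot> \<tau> (tail Q e, (tail Q e, e # p, k)))
        (\<epsilon> \<cdot> (\<tau> (head Q e, (head Q e, p, k)) \<cdot> arc_act F e))"
      unfolding x \<Gamma>_in[OF e p] by (rule Cmp_sub(1)[OF \<tau>[OF ep] Cmp_Hom[OF Fe \<tau>[OF p]] \<epsilon>])
    also have "\<dots> = \<one>\<^bsub>G (FOb F (tail Q e)) (FOb F k)\<^esub>"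
      using \<epsilon>_in[OF ep] \<epsilon>_in[OF p] Cmp_assoc[OF Fe \<tau>[OF p] \<epsilon>] rep_Cons[OF F e p]
        sub_self[OF rep_Hom[OF F ep]] by simp
    finally show "(\<epsilon> \<cdot> \<Gamma>) \<cdot> \<gamma> x = \<one>\<^bsub>G P (FOb F k)\<^esub> \<cdot> \<gamma> x"
      using Cmp_assoc[OF \<gamma>[OF e p] \<Gamma> \<epsilon>] Cmp_one(1)[OF \<gamma>[OF e p] rep_Ob[OF F k]] x by simp
  qed
  \<comment> \<open>The telescoping, for all sources i at once because the source moves along the
    path. For the trivial path both sides are s. In the step \<Gamma> contributes the inclusion of
    the longer path minus a correction, and the induction hypothesis precomposed with
    \<open>arc_act F e\<close> is exactly that correction.\<close>
  have path_sum: "(i, p, k) \<in> paths Q i k \<Longrightarrow>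
      (\<Gamma> \<cdot> retraction F P \<gamma> k i p) \<otimes>\<^bsub>G (FOb F i) S\<^esub> (s \<cdot> FAr F (i, p, k)) = \<tau> (i, (i, p, k))" for i p
  proof (induction p arbitrary: i)
    case Nil
    then have "i = k" by (auto simp: paths_iff Q.awalk_Nil_iff)
    then show ?case
      using Cmp_one(2)[OF \<Gamma> rep_Ob[OF F k]] rep_Idt[OF F k] Cmp_Idt[OF s] mult_one(1)[OF s] s_def by simp
  next
    case (Cons e p)
    then have e: "e \<in> arcs Q" and i: "i = tail Q e" and p: "(head Q e, p, k) \<in> paths Q (head Q e) k"
      by (simp_all add: Q.Cons_path)
    let ?R = "retraction F P \<gamma> k (head Q e) p" and ?Fe = "arc_act F e" and ?x = "(head Q e, p, k)"
    let ?A = "FOb F (tail Q e)" and ?B = "FOb F (head Q e)"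
    let ?\<tau>' = "\<tau> (tail Q e, (tail Q e, e # p, k))"
    note Fe = arc_act_Hom[OF F e] and R = ret[OF p] and Fx = rep_Hom[OF F p]
    have \<tau>': "?\<tau>' \<in> Hom C ?A S" using \<tau> Cons.prems i by simp
    note \<tau>Fe = Cmp_Hom[OF Fe \<tau>[OF p]] and \<Gamma>R = Cmp_Hom[OF R \<Gamma>] and sFx = Cmp_Hom[OF Fx s]
    have 1: "\<Gamma> \<cdot> retraction F P \<gamma> k (tail Q e) (e # p)
        = sub ?A S ?\<tau>' (\<tau> (head Q e, ?x) \<cdot> ?Fe) \<otimes>\<^bsub>G ?A S\<^esub> ((\<Gamma> \<cdot> ?R) \<cdot> ?Fe)"
      using Cmp_mult(1)[OF \<gamma>[OF e p] Cmp_Hom[OF Fe R] \<Gamma>] \<Gamma>_in[OF e p] Cmp_assoc[OF Fe R \<Gamma>] by simp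
    have 2: "s \<cdot> FAr F (tail Q e, e # p, k) = (s \<cdot> FAr F ?x) \<cdot> ?Fe"
      using rep_Cons[OF F e p] Cmp_assoc[OF Fe Fx s] by simp
    have 3: "((\<Gamma> \<cdot> ?R) \<cdot> ?Fe) \<otimes>\<^bsub>G ?A S\<^esub> ((s \<cdot> FAr F ?x) \<cdot> ?Fe) = \<tau> (head Q e, ?x) \<cdot> ?Fe"
      using Cmp_mult(2)[OF \<Gamma>R sFx Fe] Cons.IH[OF p] by simp
    show ?case
      unfolding i 1 2 mult_assoc[OF sub_Hom[OF \<tau>' \<tau>Fe] Cmp_Hom[OF Fe \<Gamma>R] Cmp_Hom[OF Fe sFx]] 3
      by (rule add_sub_cancel(2)[OF \<tau>' \<tau>Fe])
  qed
  have "(\<Gamma> \<cdot> r) \<otimes>\<^bsub>G S S\<^esub> (s \<cdot> \<epsilon>) = Idt C S"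
  proof (rule coproduct_eqI[OF S mult_Hom[OF Cmp_Hom[OF r \<Gamma>] Cmp_Hom[OF \<epsilon> s]] Idt_Hom[OF obS]])
    fix x assume "x \<in> (SIGMA i:verts Q. paths Q i k)"
    then obtain i p where x: "x = (i, (i, p, k))" and p: "(i, p, k) \<in> paths Q i k"
      by (auto simp: paths_iff)
    note \<tau>p = \<tau>[OF p]
    show "((\<Gamma> \<cdot> r) \<otimes>\<^bsub>G S S\<^esub> (s \<cdot> \<epsilon>)) \<cdot> \<tau> x = Idt C S \<cdot> \<tau> x"
      using Cmp_mult(2)[OF Cmp_Hom[OF r \<Gamma>] Cmp_Hom[OF \<epsilon> s] \<tau>p] Cmp_assoc[OF \<tau>p r \<Gamma>] r_in[OF p]
        Cmp_assoc[OF \<tau>p \<epsilon> s] \<epsilon>_in[OF p] path_sum[OF p] Idt_Cmp[OF \<tau>p] x by simp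
  qed
  then show ?thesis using r s r\<Gamma> \<epsilon>s \<epsilon>\<Gamma> by blast
qed

text \<open>Putting e in front of p loses nothing: the list gives back e and its tail, and the end
  points follow. So the index set of the first term at k is a copy of the nontrivial paths ending at
  k.\<close>

lemma arc_paths_card:
  assumes k: "k \<in> verts Q"
  shows "|SIGMA e:arcs Q. paths Q (head Q e) k| \<le>o |paths_to Q k|"
proof -
  let ?f = "\<lambda>(e, (_, p, _)). (tail Q e, e # p, k)"
  have "inj_on ?f (SIGMA e:arcs Q. paths Q (head Q e) k)"
    by (auto simp: inj_on_def paths_iff)
  moreover have "?f ` (SIGMA e:arcs Q. paths Q (head Q e) k) \<subseteq> paths_to Q k"
  proof
    fix y assume "y \<in> ?f ` (SIGMA e:arcs Q. paths Q (head Q e) k)"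
    then obtain e p where "y = (tail Q e, e # p, k)" "e \<in> arcs Q" "(head Q e, p, k) \<in> paths Q (head Q e) k"
      by (auto simp: paths_iff)
    then have "y \<in> paths Q (tail Q e) k" by (simp add: Q.Cons_path)
    then show "y \<in> paths_to Q k" using paths_verts(1)[of y] unfolding paths_to_def by blast
  qed
  ultimately show ?thesis
    by (intro iffD1[OF card_of_ordLeq] exI[of _ ?f] conjI)
qed

text \<open>A path records its own source, so the first component of a pair can be recovered from
  the second.\<close>

lemma vertex_paths_card: "|SIGMA i:verts Q. paths Q i k| \<le>o |paths_to Q k|"
proof -
  have "inj_on snd (SIGMA i:verts Q. paths Q i k)" "snd ` (SIGMA i:verts Q. paths Q i k) \<subseteq> paths_to Q k"
    by (auto simp: inj_on_def paths_iff paths_to_def)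
  then show ?thesis
    by (intro iffD1[OF card_of_ordLeq] exI[of _ snd] conjI)
qed

text \<open>The group structure G is fixed only for the proof, where the formula for \<Gamma>
  requires subtraction; the conclusion does not mention it.\<close>

theorem standard_resolution:
  "\<exists>P \<iota> S \<sigma> \<Gamma> \<epsilon>.
    is_coproduct (End_cat (Rep Q C)) (arcs Q) (\<lambda>\<rho>. fe Q C (head Q \<rho>) (tail Q \<rho>)) P \<iota> \<and>
    is_coproduct (End_cat (Rep Q C)) (verts Q) (\<lambda>i. fe Q C i i) S \<sigma> \<and>
    \<Gamma> \<in> Hom (End_cat (Rep Q C)) P S \<and>
    \<epsilon> \<in> Hom (End_cat (Rep Q C)) S (id_func (Rep Q C)) \<and>
    short_exact (End_cat (Rep Q C)) \<Gamma> \<epsilon> \<and>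
    (\<forall>F \<in> Ob (Rep Q C).
       is_coproduct (Rep Q C) (arcs Q) (\<lambda>\<rho>. FOb (fe Q C (head Q \<rho>) (tail Q \<rho>)) F)
         (FOb P F) (\<lambda>\<rho>. NAt (\<iota> \<rho>) F) \<and>
       is_coproduct (Rep Q C) (verts Q) (\<lambda>i. FOb (fe Q C i i) F)
         (FOb S F) (\<lambda>i. NAt (\<sigma> i) F) \<and>
       NAt \<Gamma> F \<in> Hom (Rep Q C) (FOb P F) (FOb S F) \<and>
       NAt \<epsilon> F \<in> Hom (Rep Q C) (FOb S F) F \<and>
       short_exact (Rep Q C) (NAt \<Gamma> F) (NAt \<epsilon> F) \<and>
       (\<forall>k \<in> verts Q.
          split_short_exact C (FAr (eval_func Q C k) (NAt \<Gamma> F)) (FAr (eval_func Q C k) (NAt \<epsilon> F))))"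
proof -
  let ?R = "Rep Q C" and ?E = "End_cat (Rep Q C)"
  note End_category = func_cat_category[OF Rep_category Rep_category]
  obtain P \<iota> where P: "is_coproduct ?E (arcs Q) (\<lambda>e. fe Q C (head Q e) (tail Q e)) P \<iota>"
    and PF: "\<And>F. F \<in> Ob ?R \<Longrightarrow> is_coproduct ?R (arcs Q) (\<lambda>e. FOb (fe Q C (head Q e) (tail Q e)) F)
      (FOb P F) (\<lambda>e. NAt (\<iota> e) F)"
    and Pk: "\<And>F k. \<lbrakk>F \<in> Ob ?R; k \<in> verts Q\<rbrakk> \<Longrightarrow>
      is_coproduct C (SIGMA e:arcs Q. paths Q (head Q e) k) (\<lambda>(e, _). FOb F (tail Q e)) (FOb (FOb P F) k)
        (\<lambda>(e, \<rho>). NAt (NAt (\<iota> e) F) k \<cdot> copow_in C (FOb F (tail Q e)) (paths Q (head Q e) k) \<rho>)"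
    using fe_coproduct[of "arcs Q" "tail Q" "head Q"] arc_paths_card by auto
  obtain S \<sigma> where S: "is_coproduct ?E (verts Q) (\<lambda>i. fe Q C i i) S \<sigma>"
    and SF: "\<And>F. F \<in> Ob ?R \<Longrightarrow> is_coproduct ?R (verts Q) (\<lambda>i. FOb (fe Q C i i) F)
      (FOb S F) (\<lambda>i. NAt (\<sigma> i) F)"
    and Sk: "\<And>F k. \<lbrakk>F \<in> Ob ?R; k \<in> verts Q\<rbrakk> \<Longrightarrow>
      is_coproduct C (SIGMA i:verts Q. paths Q i k) (\<lambda>(i, _). FOb F i) (FOb (FOb S F) k)
        (\<lambda>(i, \<rho>). NAt (NAt (\<sigma> i) F) k \<cdot> copow_in C (FOb F i) (paths Q i k) \<rho>)"
    using fe_coproduct[of "verts Q" "\<lambda>i. i" "\<lambda>i. i"] vertex_paths_card by auto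
  define \<tau> where "\<tau> F k = (\<lambda>(i, \<rho>). NAt (NAt (\<sigma> i) F) k \<cdot> copow_in C (FOb F i) (paths Q i k) \<rho>)" for F k
  define \<gamma> where "\<gamma> F k = (\<lambda>(e, \<rho>). NAt (NAt (\<iota> e) F) k
    \<cdot> copow_in C (FOb F (tail Q e)) (paths Q (head Q e) k) \<rho>)" for F k
  note S\<tau> = Sk[folded \<tau>_def] and P\<gamma> = Pk[folded \<gamma>_def]
  have Sfun: "is_functor ?R ?R S" using category.coproduct_Ob[OF End_category S] by simp
  have Pfun: "is_functor ?R ?R P" using category.coproduct_Ob[OF End_category P] by simp
  note SOb = functor_Ob[OF Sfun] and \<sigma> = category.coproduct_in[OF End_category S]
    and \<iota> = category.coproduct_in[OF End_category P]
  have \<tau>_Hom: "\<tau> F k (i, \<rho>) \<in> Hom C (FOb F i) (FOb (FOb S F) k)"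
    if "F \<in> Ob ?R" "\<rho> \<in> paths Q i k" for F k i \<rho>
    using coproduct_in[OF S\<tau>[OF that(1) paths_verts(2)[OF that(2)]], of "(i, \<rho>)"]
      that paths_verts(1)[OF that(2)] by simp
  have \<sigma>k: "NAt (NAt (\<sigma> i) F) k \<in> Hom C (copow C (FOb F i) (paths Q i k)) (FOb (FOb S F) k)"
    if "F \<in> Ob ?R" "i \<in> verts Q" "k \<in> verts Q" for F i k
    using rep_mor_Hom[OF nat_Hom[OF \<sigma>[OF that(2)] that(1)] that(3)] FOb_fe[OF that(1,2)] that by simp
  \<comment> \<open>Naturality of \<open>NAt (\<sigma> i) F\<close> along \<alpha>, combined with
    the action of the free representation on inclusions. With its counterpart
    \<open>\<tau>_nat\<close> for morphisms in F, this is what the construction of \<Gamma> needs to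
    know about the action on S.\<close>
  have \<tau>_act: "FAr (FOb S F) \<alpha> \<cdot> \<tau> F k (i, \<rho>) = \<tau> F l (i, \<alpha> \<cdot>\<^bsub>path_cat Q\<^esub> \<rho>)"
    if F: "F \<in> Ob ?R" and \<rho>: "\<rho> \<in> paths Q i k" and \<alpha>: "\<alpha> \<in> paths Q k l" for F \<alpha> \<rho> i k l
  proof -
    note i = paths_verts(1)[OF \<rho>] and k = paths_verts(1)[OF \<alpha>] and l = paths_verts(2)[OF \<alpha>]
    note Fi = rep_Ob[OF F i] and S\<alpha> = rep_Hom[OF SOb[OF F] \<alpha>]
    note \<mu> = copow_in_Hom[OF Fi \<rho>] and f\<alpha> = free_rep_arrow[OF Fi i \<alpha>]
    have sq: "NAt (NAt (\<sigma> i) F) l \<cdot> FAr (free_rep Q C i (FOb F i)) \<alpha> = FAr (FOb S F) \<alpha> \<cdot> NAt (NAt (\<sigma> i) F) k"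
      using rep_mor_square[OF nat_Hom[OF \<sigma>[OF i] F] \<alpha>] FOb_fe[OF F i] by simp
    show ?thesis
      using Cmp_assoc[OF \<mu> \<sigma>k[OF F i k] S\<alpha>] sq Cmp_assoc[OF \<mu> f\<alpha>(1) \<sigma>k[OF F i l]] f\<alpha>(2)[OF \<rho>]
      by (simp add: \<tau>_def)
  qed
  have \<tau>_nat: "NAt (FAr S \<eta>) k \<cdot> \<tau> F k (i, \<rho>) = \<tau> F' k (i, \<rho>) \<cdot> NAt \<eta> i"
    if \<eta>: "\<eta> \<in> Hom ?R F F'" and \<rho>: "\<rho> \<in> paths Q i k" for F F' \<eta> \<rho> i k
  proof -
    have F: "F \<in> Ob ?R" and F': "F' \<in> Ob ?R" using category.Hom_Ob[OF Rep_category \<eta>] by auto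
    note i = paths_verts(1)[OF \<rho>] and k = paths_verts(2)[OF \<rho>]
    note \<mu> = copow_in_Hom[OF rep_Ob[OF F i] \<rho>] and \<mu>' = copow_in_Hom[OF rep_Ob[OF F' i] \<rho>]
    note \<eta>i = rep_mor_Hom[OF \<eta> i] and S\<eta> = rep_mor_Hom[OF functor_Hom[OF Sfun \<eta>] k]
    note m = free_rep_mor[OF i \<eta>i]
    note mk = rep_mor_Hom[OF m(1) k, simplified FOb_free_rep[OF k]]
    have "NAt (\<sigma> i) F' \<cdot>\<^bsub>?R\<^esub> free_rep_mor Q C i (NAt \<eta> i) = FAr S \<eta> \<cdot>\<^bsub>?R\<^esub> NAt (\<sigma> i) F"
      using nat_square[OF \<sigma>[OF i] \<eta>] FAr_fe[OF \<eta> i] by simp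
    then have sq: "NAt (NAt (\<sigma> i) F') k \<cdot> NAt (free_rep_mor Q C i (NAt \<eta> i)) k
        = NAt (FAr S \<eta>) k \<cdot> NAt (NAt (\<sigma> i) F) k"
      using rep_NAt_Cmp[OF k] by metis
    show ?thesis
      using Cmp_assoc[OF \<mu> \<sigma>k[OF F i k] S\<eta>] sq Cmp_assoc[OF \<mu> mk \<sigma>k[OF F' i k]] m(2)[OF \<rho>]
        Cmp_assoc[OF \<eta>i \<mu>' \<sigma>k[OF F' i k]] by (simp add: \<tau>_def)
  qed

  \<comment> \<open>The transpose of \<Gamma> on the summand e: the inclusion of e as a path of
    length one, minus that of the trivial path at its head after \<open>arc_act F e\<close>. Acting
    on it by a path p yields the value of \<Gamma> that \<open>vertex_split\<close> expects.\<close>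
  define a where "a e F = sub (FOb F (tail Q e)) (FOb (FOb S F) (head Q e))
    (\<tau> F (head Q e) (tail Q e, (tail Q e, [e], head Q e)))
    (\<tau> F (head Q e) (head Q e, (head Q e, [], head Q e)) \<cdot> arc_act F e)" for e F
  have triv: "(i, [], i) \<in> paths Q i i" if "i \<in> verts Q" for i
    using category.Idt_Hom[OF Q.path_cat_category, of i] that by simp
  have "\<exists>\<Phi>. \<Phi> \<in> Hom ?E (fe Q C (head Q e) (tail Q e)) S \<and> (\<forall>F \<in> Ob ?R. \<forall>k. \<forall>\<rho> \<in> paths Q (head Q e) k.
      NAt (NAt \<Phi> F) k \<cdot> copow_in C (FOb F (tail Q e)) (paths Q (head Q e) k) \<rho> = FAr (FOb S F) \<rho> \<cdot> a e F)"
    if e: "e \<in> arcs Q" for e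
  proof (rule fe_adjunct[OF _ _ Sfun])
    show t: "tail Q e \<in> verts Q" and h: "head Q e \<in> verts Q" using e by auto
    note p = Q.arc_path[OF e] and p0 = triv[OF h]
    show "a e F \<in> Hom C (FOb F (tail Q e)) (FOb (FOb S F) (head Q e))" if F: "F \<in> Ob ?R" for F
      unfolding a_def by (rule sub_Hom[OF \<tau>_Hom[OF F p] Cmp_Hom[OF arc_act_Hom[OF F e] \<tau>_Hom[OF F p0]]])
    fix F F' \<eta> assume \<eta>: "\<eta> \<in> Hom ?R F F'"
    have F: "F \<in> Ob ?R" and F': "F' \<in> Ob ?R" using category.Hom_Ob[OF Rep_category \<eta>] by auto
    note Fe = arc_act_Hom[OF F e] and F'e = arc_act_Hom[OF F' e]
    note \<eta>t = rep_mor_Hom[OF \<eta> t] and \<eta>h = rep_mor_Hom[OF \<eta> h]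
      and S\<eta> = rep_mor_Hom[OF functor_Hom[OF Sfun \<eta>] h]
    show "NAt (FAr S \<eta>) (head Q e) \<cdot> a e F = a e F' \<cdot> NAt \<eta> (tail Q e)"
      unfolding a_def Cmp_sub(1)[OF \<tau>_Hom[OF F p] Cmp_Hom[OF Fe \<tau>_Hom[OF F p0]] S\<eta>]
        Cmp_sub(2)[OF \<tau>_Hom[OF F' p] Cmp_Hom[OF F'e \<tau>_Hom[OF F' p0]] \<eta>t]
      using \<tau>_nat[OF \<eta> p] \<tau>_nat[OF \<eta> p0] Cmp_assoc[OF Fe \<tau>_Hom[OF F p0] S\<eta>]
        Cmp_assoc[OF Fe \<eta>h \<tau>_Hom[OF F' p0]] rep_mor_square[OF \<eta> p]
        Cmp_assoc[OF \<eta>t F'e \<tau>_Hom[OF F' p0]] by simp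
  qed
  then obtain \<Phi> where \<Phi>: "\<And>e. e \<in> arcs Q \<Longrightarrow> \<Phi> e \<in> Hom ?E (fe Q C (head Q e) (tail Q e)) S"
    and \<Phi>_in: "\<And>e F k \<rho>. \<lbrakk>e \<in> arcs Q; F \<in> Ob ?R; \<rho> \<in> paths Q (head Q e) k\<rbrakk> \<Longrightarrow>
      NAt (NAt (\<Phi> e) F) k \<cdot> copow_in C (FOb F (tail Q e)) (paths Q (head Q e) k) \<rho> = FAr (FOb S F) \<rho> \<cdot> a e F"
    by metis
  obtain \<Gamma> where \<Gamma>: "\<Gamma> \<in> Hom ?E P S" and \<Gamma>\<iota>: "\<And>e. e \<in> arcs Q \<Longrightarrow> \<Gamma> \<cdot>\<^bsub>?E\<^esub> \<iota> e = \<Phi> e"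
    using category.coproduct_desc[OF End_category P category.coproduct_Ob[OF End_category S] \<Phi>] by blast

  have Ifun: "is_functor ?R ?R (id_func ?R)" by (rule id_functor[OF Rep_category])
  have IF: "FOb (id_func ?R) F = F" if "F \<in> Ob ?R" for F using that by (simp add: id_func_def)
  \<comment> \<open>On the summand i, \<epsilon> is the counit of the adjunction, that is, the
    transpose of the identity.\<close>
  have "\<exists>\<Psi>. \<Psi> \<in> Hom ?E (fe Q C i i) (id_func ?R) \<and> (\<forall>F \<in> Ob ?R. \<forall>k. \<forall>\<rho> \<in> paths Q i k.
      NAt (NAt \<Psi> F) k \<cdot> copow_in C (FOb F i) (paths Q i k) \<rho> = FAr (FOb (id_func ?R) F) \<rho> \<cdot> Idt C (FOb F i))"
    if i: "i \<in> verts Q" for i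
  proof (rule fe_adjunct[OF i i Ifun])
    show "Idt C (FOb F i) \<in> Hom C (FOb F i) (FOb (FOb (id_func ?R) F) i)" if "F \<in> Ob ?R" for F
      using Idt_Hom[OF rep_Ob[OF that i]] IF[OF that] by simp
    show "NAt (FAr (id_func ?R) \<eta>) i \<cdot> Idt C (FOb F i) = Idt C (FOb F' i) \<cdot> NAt \<eta> i"
      if "\<eta> \<in> Hom ?R F F'" for F F' \<eta>
      using that Cmp_Idt[OF rep_mor_Hom[OF that i]] Idt_Cmp[OF rep_mor_Hom[OF that i]]
      by (simp add: id_func_def Hom_simp)
  qed
  then obtain \<Psi> where \<Psi>: "\<And>i. i \<in> verts Q \<Longrightarrow> \<Psi> i \<in> Hom ?E (fe Q C i i) (id_func ?R)"
    and \<Psi>_in: "\<And>i F k \<rho>. \<lbrakk>i \<in> verts Q; F \<in> Ob ?R; \<rho> \<in> paths Q i k\<rbrakk> \<Longrightarrow>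
      NAt (NAt (\<Psi> i) F) k \<cdot> copow_in C (FOb F i) (paths Q i k) \<rho> = FAr (FOb (id_func ?R) F) \<rho> \<cdot> Idt C (FOb F i)"
    by metis
  obtain \<epsilon> where \<epsilon>: "\<epsilon> \<in> Hom ?E S (id_func ?R)" and \<epsilon>\<sigma>: "\<And>i. i \<in> verts Q \<Longrightarrow> \<epsilon> \<cdot>\<^bsub>?E\<^esub> \<sigma> i = \<Psi> i"
    using category.coproduct_desc[OF End_category S _ \<Psi>] Ifun by auto

  have \<Gamma>F: "NAt \<Gamma> F \<in> Hom ?R (FOb P F) (FOb S F)" if "F \<in> Ob ?R" for F by (rule nat_Hom[OF \<Gamma> that])
  have \<epsilon>F: "NAt \<epsilon> F \<in> Hom ?R (FOb S F) F" if "F \<in> Ob ?R" for F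
    using nat_Hom[OF \<epsilon> that] IF[OF that] by simp

  \<comment> \<open>The maps r and s are recorded only as existing at this k. The kernel and
    cokernel properties are the part that passes on to functors.\<close>
  have vertex: "is_kernel C (NAt (NAt \<Gamma> F) k) (NAt (NAt \<epsilon> F) k) \<and>
      is_cokernel C (NAt (NAt \<epsilon> F) k) (NAt (NAt \<Gamma> F) k) \<and>
      (\<exists>r \<in> Hom C (FOb (FOb S F) k) (FOb (FOb P F) k). r \<cdot> NAt (NAt \<Gamma> F) k = Idt C (FOb (FOb P F) k)) \<and>
      (\<exists>s \<in> Hom C (FOb F k) (FOb (FOb S F) k). NAt (NAt \<epsilon> F) k \<cdot> s = Idt C (FOb F k))"
    if F: "F \<in> Ob ?R" and k: "k \<in> verts Q" for F k
  proof -
    note \<Gamma>k = rep_mor_Hom[OF \<Gamma>F[OF F] k] and \<epsilon>k = rep_mor_Hom[OF \<epsilon>F[OF F] k]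
    have \<Gamma>_in: "NAt (NAt \<Gamma> F) k \<cdot> \<gamma> F k (e, (head Q e, p, k)) =
        sub (FOb F (tail Q e)) (FOb (FOb S F) k) (\<tau> F k (tail Q e, (tail Q e, e # p, k)))
          (\<tau> F k (head Q e, (head Q e, p, k)) \<cdot> arc_act F e)"
      if e: "e \<in> arcs Q" and p: "(head Q e, p, k) \<in> paths Q (head Q e) k" for e p
    proof -
      have t: "tail Q e \<in> verts Q" and h: "head Q e \<in> verts Q" using e by auto
      note \<mu> = copow_in_Hom[OF rep_Ob[OF F t] p] and Sp = rep_Hom[OF SOb[OF F] p]
        and Fe = arc_act_Hom[OF F e] and ep = Q.arc_path[OF e] and p0 = triv[OF h]
      have \<iota>k: "NAt (NAt (\<iota> e) F) k \<in> Hom C (copow C (FOb F (tail Q e)) (paths Q (head Q e) k)) (FOb (FOb P F) k)"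
        using rep_mor_Hom[OF nat_Hom[OF \<iota>[OF e] F] k] FOb_fe[OF F t] k by simp
      have "NAt (NAt \<Gamma> F) k \<cdot> NAt (NAt (\<iota> e) F) k = NAt (NAt (\<Phi> e) F) k"
        using \<Gamma>\<iota>[OF e] NAt_Cmp[OF F, of ?R \<Gamma> "\<iota> e"] rep_NAt_Cmp[OF k] by metis
      then have "NAt (NAt \<Gamma> F) k \<cdot> \<gamma> F k (e, (head Q e, p, k)) = FAr (FOb S F) (head Q e, p, k) \<cdot> a e F"
        using Cmp_assoc[OF \<mu> \<iota>k \<Gamma>k] \<Phi>_in[OF e F p] by (simp add: \<gamma>_def)
      also have "\<dots> = sub (FOb F (tail Q e)) (FOb (FOb S F) k) (\<tau> F k (tail Q e, (tail Q e, e # p, k)))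
          (\<tau> F k (head Q e, (head Q e, p, k)) \<cdot> arc_act F e)"
        unfolding a_def Cmp_sub(1)[OF \<tau>_Hom[OF F ep] Cmp_Hom[OF Fe \<tau>_Hom[OF F p0]] Sp]
        using \<tau>_act[OF F ep p] \<tau>_act[OF F p0 p] Cmp_assoc[OF Fe \<tau>_Hom[OF F p0] Sp] by simp
      finally show ?thesis .
    qed
    have \<epsilon>_in: "NAt (NAt \<epsilon> F) k \<cdot> \<tau> F k (i, \<rho>) = FAr F \<rho>" if \<rho>: "\<rho> \<in> paths Q i k" for i \<rho>
    proof -
      note i = paths_verts(1)[OF \<rho>]
      have "NAt (NAt \<epsilon> F) k \<cdot> NAt (NAt (\<sigma> i) F) k = NAt (NAt (\<Psi> i) F) k"
        using \<epsilon>\<sigma>[OF i] NAt_Cmp[OF F, of ?R \<epsilon> "\<sigma> i"] rep_NAt_Cmp[OF k] by metis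
      then show ?thesis
        using Cmp_assoc[OF copow_in_Hom[OF rep_Ob[OF F i] \<rho>] \<sigma>k[OF F i k] \<epsilon>k] \<Psi>_in[OF i F \<rho>] IF[OF F]
          Cmp_Idt[OF rep_Hom[OF F \<rho>]] by (simp add: \<tau>_def)
    qed
    obtain r s where r: "r \<in> Hom C (FOb (FOb S F) k) (FOb (FOb P F) k)"
      and s: "s \<in> Hom C (FOb F k) (FOb (FOb S F) k)"
      and eqs: "r \<cdot> NAt (NAt \<Gamma> F) k = Idt C (FOb (FOb P F) k)" "NAt (NAt \<epsilon> F) k \<cdot> s = Idt C (FOb F k)"
        "NAt (NAt \<epsilon> F) k \<cdot> NAt (NAt \<Gamma> F) k = \<one>\<^bsub>G (FOb (FOb P F) k) (FOb F k)\<^esub>"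
        "(NAt (NAt \<Gamma> F) k \<cdot> r) \<otimes>\<^bsub>G (FOb (FOb S F) k) (FOb (FOb S F) k)\<^esub> (s \<cdot> NAt (NAt \<epsilon> F) k)
          = Idt C (FOb (FOb S F) k)"
      using vertex_split[OF F k S\<tau>[OF F k] P\<gamma>[OF F k] \<Gamma>k \<epsilon>k \<Gamma>_in \<epsilon>_in] by blast
    show ?thesis
      using split_kernel_cokernel[OF \<Gamma>k \<epsilon>k r s eqs] r s eqs(1,2) by blast
  qed

  obtain Z where Z: "is_zero_ob C Z" using zero_ob_exists by blast
  obtain ZR where ZR: "is_zero_ob ?R ZR"
    using func_cat_zero_ob[OF Q.path_cat_category category_axioms Z, folded Rep_def] by blast
  obtain ZE where ZE: "is_zero_ob ?E ZE"
    using func_cat_zero_ob[OF Rep_category Rep_category ZR] by blast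
  \<comment> \<open>First ascent, from C to \<open>Rep\<close>, by varying the vertex. Varying F
    afterwards repeats the argument from \<open>Rep\<close> to \<open>End\<close>, with the zero
    representation in place of the zero object of C.\<close>
  have kerF: "is_kernel ?R (NAt \<Gamma> F) (NAt \<epsilon> F)" and cokerF: "is_cokernel ?R (NAt \<epsilon> F) (NAt \<Gamma> F)"
    if F: "F \<in> Ob ?R" for F
    using func_cat_kernel[OF Q.path_cat_category category_axioms Z, folded Rep_def, OF \<Gamma>F[OF F] \<epsilon>F[OF F]]
      func_cat_cokernel[OF Q.path_cat_category category_axioms Z, folded Rep_def, OF \<Gamma>F[OF F] \<epsilon>F[OF F]]
      vertex[OF F] by simp_all
  have "short_exact ?E \<Gamma> \<epsilon>"
    by (rule category.short_exactI[OF End_category ZE \<Gamma> \<epsilon>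
          func_cat_kernel[OF Rep_category Rep_category ZR \<Gamma> \<epsilon> kerF]
          func_cat_cokernel[OF Rep_category Rep_category ZR \<Gamma> \<epsilon> cokerF]])
  moreover have "short_exact ?R (NAt \<Gamma> F) (NAt \<epsilon> F)" if F: "F \<in> Ob ?R" for F
    by (rule category.short_exactI[OF Rep_category ZR \<Gamma>F[OF F] \<epsilon>F[OF F] kerF[OF F] cokerF[OF F]])
  moreover have "split_short_exact C (FAr (eval_func Q C k) (NAt \<Gamma> F)) (FAr (eval_func Q C k) (NAt \<epsilon> F))"
    if F: "F \<in> Ob ?R" and k: "k \<in> verts Q" for F k
  proof -
    note \<Gamma>k = rep_mor_Hom[OF \<Gamma>F[OF F] k] and \<epsilon>k = rep_mor_Hom[OF \<epsilon>F[OF F] k]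
    have ev: "FAr (eval_func Q C k) (NAt \<Gamma> F) = NAt (NAt \<Gamma> F) k" "FAr (eval_func Q C k) (NAt \<epsilon> F) = NAt (NAt \<epsilon> F) k"
      using \<Gamma>F[OF F] \<epsilon>F[OF F] by (simp_all add: eval_func_def Hom_simp)
    have "short_exact C (NAt (NAt \<Gamma> F) k) (NAt (NAt \<epsilon> F) k)"
      using short_exactI[OF Z \<Gamma>k \<epsilon>k] vertex[OF F k] by blast
    then show ?thesis
      unfolding split_short_exact_def ev using vertex[OF F k] \<Gamma>k \<epsilon>k by (simp add: Hom_simp)
  qed
  ultimately show ?thesis using P S \<Gamma> \<epsilon> PF SF \<Gamma>F \<epsilon>F
    by (intro exI[of _ P] exI[of _ \<iota>] exI[of _ S] exI[of _ \<sigma>] exI[of _ \<Gamma>] exI[of _ \<epsilon>]) simp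
qed

end

theorem corollary3p10:
  fixes Q :: "('v, 'a) pre_digraph"
    and C :: "('o, 'm) cat"
    and \<kappa> :: "'k rel"
  assumes "wf_digraph Q"
    and "Card_order \<kappa>" and "infinite (Field \<kappa>)"
    and "rccn Q \<le>o \<kappa>" and "ltccn Q \<le>o \<kappa>"
    and "abelian_category C" and "AB3 \<kappa> C"
  shows "\<exists>P \<iota> S \<sigma> \<Gamma> \<epsilon>.
    is_coproduct (End_cat (Rep Q C)) (arcs Q) (\<lambda>\<rho>. fe Q C (head Q \<rho>) (tail Q \<rho>)) P \<iota> \<and>
    is_coproduct (End_cat (Rep Q C)) (verts Q) (\<lambda>i. fe Q C i i) S \<sigma> \<and>
    \<Gamma> \<in> Hom (End_cat (Rep Q C)) P S \<and>
    \<epsilon> \<in> Hom (End_cat (Rep Q C)) S (id_func (Rep Q C)) \<and>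
    short_exact (End_cat (Rep Q C)) \<Gamma> \<epsilon> \<and>
    (\<forall>F \<in> Ob (Rep Q C).
       is_coproduct (Rep Q C) (arcs Q) (\<lambda>\<rho>. FOb (fe Q C (head Q \<rho>) (tail Q \<rho>)) F)
         (FOb P F) (\<lambda>\<rho>. NAt (\<iota> \<rho>) F) \<and>
       is_coproduct (Rep Q C) (verts Q) (\<lambda>i. FOb (fe Q C i i) F)
         (FOb S F) (\<lambda>i. NAt (\<sigma> i) F) \<and>
       NAt \<Gamma> F \<in> Hom (Rep Q C) (FOb P F) (FOb S F) \<and>
       NAt \<epsilon> F \<in> Hom (Rep Q C) (FOb S F) F \<and>
       short_exact (Rep Q C) (NAt \<Gamma> F) (NAt \<epsilon> F) \<and>
       (\<forall>k \<in> verts Q.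
          split_short_exact C (FAr (eval_func Q C k) (NAt \<Gamma> F)) (FAr (eval_func Q C k) (NAt \<epsilon> F))))"
proof -
  obtain G where "preadditive_category C G" using abelian_imp_preadditive[OF assms(6)] .
  then have "quiver_representations Q C G \<kappa>"
    using assms(1,2,5,7) by (simp add: quiver_representations_def quiver_representations_axioms_def)
  then show ?thesis by (rule quiver_representations.standard_resolution)
qed

end
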